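(* Let $H,K$ be commutative and cancellative monoids, each containing at least one element of infinite order. Then $\mathcal{P}_{\mathrm{fin},1}(H)\simeq\mathcal{P}_{\mathrm{fin},1}(K)$ if and only if one of the following holds: (1) $H$ is isomorphic to $K$; (2) $H$ and $K$ are reduced and $K$ is isomorphic to a submonoid of $\mathsf{q}(H)$ of the form $(H\setminus H_v)\sqcup\tilde H$, where $\tilde H$ is a reduced valuation monoid with $\mathsf{q}(\tilde H)=\mathsf{q}(H_v)$.
   Context: $\mathcal{P}_{\mathrm{fin},1}(H)$ is the monoid of finite subsets of $H$ containing $1_H$ under setwise multiplication $XY=\{xy:x\in X,y\in Y\}$. $H$ is reduced if its only unit is $1_H$. $\mathsf{q}(H)$ is the quotient group of $H$, with $H\subseteq\mathsf{q}(H)$. A commutative cancellative monoid $M$ is a valuation monoid if for every $x\in\mathsf{q}(M)$, $x\in M$ or $x^{-1}\in M$. An element $a\in H$ is a pseudo-unit of $H$ if for all $b\in H$, $ab^{-1}\in H$ or $ba^{-1}\in H$; $H_v$ denotes the set of pseudo-units of $H$ (a submonoid of $H$), and $H\setminus H_v$ its complement. *)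

theory Defs
  imports "HOL-Algebra.Divisibility"
begin

definition power_monoid :: "('a, 'm) monoid_scheme \<Rightarrow> 'a set monoid" where
  "power_monoid H =
    \<lparr>carrier = {X. finite X \<and> X \<subseteq> carrier H \<and> \<one>\<^bsub>H\<^esub> \<in> X},
     mult = (\<lambda>X Y. X <#>\<^bsub>H\<^esub> Y),
     one = {\<one>\<^bsub>H\<^esub>}\<rparr>"

text \<open>
  The order of an element of a monoid is the cardinality of the submonoid it generates.
  The library's \<open>ord\<close> is only available for groups.
\<close>

definition infinite_order :: "('a, 'm) monoid_scheme \<Rightarrow> 'a \<Rightarrow> bool" where
  "infinite_order H x \<longleftrightarrow> infinite (range (\<lambda>n::nat. x [^]\<^bsub>H\<^esub> n))"

definition reduced_monoid :: "('a, 'm) monoid_scheme \<Rightarrow> bool" where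
  "reduced_monoid H \<longleftrightarrow> Units H = {\<one>\<^bsub>H\<^esub>}"


section \<open>The quotient group of a commutative cancellative monoid\<close>

text \<open>
  The pair \<open>(a, b)\<close> represents the formal fraction \<open>a b\<^sup>-\<^sup>1\<close>. Since the monoids considered are
  cancellative, \<open>a d = c b\<close> is an equivalence relation on pairs and \<open>quot_embed\<close> is injective;
  the inclusion of a monoid in its quotient group is read as \<open>quot_embed\<close>.
\<close>

definition quot_rel :: "('a, 'm) monoid_scheme \<Rightarrow> (('a \<times> 'a) \<times> ('a \<times> 'a)) set" where
  "quot_rel M = {((a, b), (c, d)) | a b c d.
     a \<in> carrier M \<and> b \<in> carrier M \<and> c \<in> carrier M \<and> d \<in> carrier M \<and> a \<otimes>\<^bsub>M\<^esub> d = c \<otimes>\<^bsub>M\<^esub> b}"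

definition formal_frac :: "('a, 'm) monoid_scheme \<Rightarrow> 'a \<Rightarrow> 'a \<Rightarrow> ('a \<times> 'a) set" where
  "formal_frac M a b = quot_rel M `` {(a, b)}"

definition quot_group :: "('a, 'm) monoid_scheme \<Rightarrow> ('a \<times> 'a) set monoid" where
  "quot_group M =
    \<lparr>carrier = (carrier M \<times> carrier M) // quot_rel M,
     mult = (\<lambda>X Y. \<Union>(a, b)\<in>X. \<Union>(c, d)\<in>Y. formal_frac M (a \<otimes>\<^bsub>M\<^esub> c) (b \<otimes>\<^bsub>M\<^esub> d)),
     one = formal_frac M \<one>\<^bsub>M\<^esub> \<one>\<^bsub>M\<^esub>\<rparr>"

definition quot_embed :: "('a, 'm) monoid_scheme \<Rightarrow> 'a \<Rightarrow> ('a \<times> 'a) set" where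
  "quot_embed M a = formal_frac M a \<one>\<^bsub>M\<^esub>"

text \<open>
  For a submonoid \<open>M\<close> of an abelian group \<open>G\<close>, this is the quotient group of \<open>M\<close> realized inside
  \<open>G\<close>; see \<open>quot_group_iso_fractions\<close> below.
\<close>

definition fractions :: "('a, 'm) monoid_scheme \<Rightarrow> 'a set \<Rightarrow> 'a set" where
  "fractions G M = {x \<otimes>\<^bsub>G\<^esub> inv\<^bsub>G\<^esub> y | x y. x \<in> M \<and> y \<in> M}"

definition valuation_monoid :: "('a, 'm) monoid_scheme \<Rightarrow> bool" where
  "valuation_monoid M \<longleftrightarrow> comm_monoid_cancel M \<and>
     (\<forall>x \<in> carrier (quot_group M).
        x \<in> quot_embed M ` carrier M \<or> inv\<^bsub>quot_group M\<^esub> x \<in> quot_embed M ` carrier M)"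

definition pseudo_units :: "('a, 'm) monoid_scheme \<Rightarrow> 'a set" where
  "pseudo_units H = {a \<in> carrier H. \<forall>b \<in> carrier H.
     quot_embed H a \<otimes>\<^bsub>quot_group H\<^esub> inv\<^bsub>quot_group H\<^esub> (quot_embed H b) \<in> quot_embed H ` carrier H \<or>
     quot_embed H b \<otimes>\<^bsub>quot_group H\<^esub> inv\<^bsub>quot_group H\<^esub> (quot_embed H a) \<in> quot_embed H ` carrier H}"


section \<open>Basic properties of the quotient group\<close>

context comm_monoid_cancel
begin

lemma quot_rel_equiv: "equiv (carrier G \<times> carrier G) (quot_rel G)"
proof (rule equivI)
  show "quot_rel G \<subseteq> (carrier G \<times> carrier G) \<times> (carrier G \<times> carrier G)"
    by (auto simp: quot_rel_def)
  show "refl_on (carrier G \<times> carrier G) (quot_rel G)"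
    by (auto simp: refl_on_def quot_rel_def)
  show "sym (quot_rel G)"
    by (auto simp: sym_def quot_rel_def)
  show "trans (quot_rel G)"
  proof (rule transI)
    fix p q r assume "(p, q) \<in> quot_rel G" "(q, r) \<in> quot_rel G"
    then obtain a b c d e f where p: "p = (a, b)" "q = (c, d)" "r = (e, f)"
      and [simp]: "a \<in> carrier G" "b \<in> carrier G" "c \<in> carrier G" "d \<in> carrier G"
        "e \<in> carrier G" "f \<in> carrier G"
      and 1: "a \<otimes> d = c \<otimes> b" and 2: "c \<otimes> f = e \<otimes> d"
      by (auto simp: quot_rel_def)
    have "d \<otimes> (a \<otimes> f) = (a \<otimes> d) \<otimes> f" by (simp add: m_ac)
    also have "\<dots> = b \<otimes> (c \<otimes> f)" by (simp add: 1 m_ac)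
    also have "\<dots> = d \<otimes> (e \<otimes> b)" by (simp add: 2 m_ac)
    finally have "a \<otimes> f = e \<otimes> b" by (rule l_cancel) auto
    then show "(p, r) \<in> quot_rel G" by (simp add: p quot_rel_def)
  qed
qed

lemma frac_eq_iff:
  assumes "a \<in> carrier G" "b \<in> carrier G" "c \<in> carrier G" "d \<in> carrier G"
  shows "formal_frac G a b = formal_frac G c d \<longleftrightarrow> a \<otimes> d = c \<otimes> b"
  unfolding formal_frac_def
  using eq_equiv_class_iff[OF quot_rel_equiv, of "(a, b)" "(c, d)"] assms
  by (simp add: quot_rel_def)

lemma mem_frac_iff:
  assumes "a \<in> carrier G" "b \<in> carrier G"
  shows "(c, d) \<in> formal_frac G a b \<longleftrightarrow>
    c \<in> carrier G \<and> d \<in> carrier G \<and> formal_frac G c d = formal_frac G a b"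
proof -
  have "(c, d) \<in> formal_frac G a b \<longleftrightarrow> c \<in> carrier G \<and> d \<in> carrier G \<and> a \<otimes> d = c \<otimes> b"
    using assms by (simp add: formal_frac_def quot_rel_def)
  then show ?thesis using assms frac_eq_iff[of c d a b] by auto
qed

lemma carrier_quot_group:
  "carrier (quot_group G) = {formal_frac G a b | a b. a \<in> carrier G \<and> b \<in> carrier G}"
  by (auto simp: quot_group_def quotient_def formal_frac_def)

lemma frac_closed [simp]:
  "a \<in> carrier G \<Longrightarrow> b \<in> carrier G \<Longrightarrow> formal_frac G a b \<in> carrier (quot_group G)"
  by (auto simp: carrier_quot_group)

lemma one_quot_group: "\<one>\<^bsub>quot_group G\<^esub> = formal_frac G \<one> \<one>"
  by (simp add: quot_group_def)

lemma mult_frac: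
  assumes [simp]: "a \<in> carrier G" "b \<in> carrier G" "c \<in> carrier G" "d \<in> carrier G"
  shows "formal_frac G a b \<otimes>\<^bsub>quot_group G\<^esub> formal_frac G c d = formal_frac G (a \<otimes> c) (b \<otimes> d)"
proof -
  have *: "formal_frac G (x \<otimes> u) (y \<otimes> v) = formal_frac G (a \<otimes> c) (b \<otimes> d)"
    if "(x, y) \<in> formal_frac G a b" "(u, v) \<in> formal_frac G c d" for x y u v
  proof -
    from that have [simp]: "x \<in> carrier G" "y \<in> carrier G" "u \<in> carrier G" "v \<in> carrier G"
      by (auto simp: mem_frac_iff)
    from that have 1: "x \<otimes> b = a \<otimes> y" and 2: "u \<otimes> d = c \<otimes> v"
      by (auto simp: mem_frac_iff frac_eq_iff)
    have "(x \<otimes> u) \<otimes> (b \<otimes> d) = (x \<otimes> b) \<otimes> (u \<otimes> d)" by (simp add: m_ac)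
    also have "\<dots> = (a \<otimes> c) \<otimes> (y \<otimes> v)" by (simp add: 1 2 m_ac)
    finally show ?thesis by (simp add: frac_eq_iff)
  qed
  have "(a, b) \<in> formal_frac G a b" "(c, d) \<in> formal_frac G c d" by (simp_all add: mem_frac_iff)
  then have "formal_frac G a b \<noteq> {}" "formal_frac G c d \<noteq> {}" by blast+
  moreover have "formal_frac G a b \<otimes>\<^bsub>quot_group G\<^esub> formal_frac G c d =
      (\<Union>p\<in>formal_frac G a b. \<Union>q\<in>formal_frac G c d. formal_frac G (a \<otimes> c) (b \<otimes> d))"
    unfolding quot_group_def monoid.simps
  proof (intro SUP_cong refl)
    fix p assume p: "p \<in> formal_frac G a b"
    obtain x y where xy: "p = (x, y)" by fastforce
    have "(\<Union>(u, v)\<in>formal_frac G c d. formal_frac G (x \<otimes> u) (y \<otimes> v)) =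
        (\<Union>q\<in>formal_frac G c d. formal_frac G (a \<otimes> c) (b \<otimes> d))"
    proof (intro SUP_cong refl)
      fix q assume q: "q \<in> formal_frac G c d"
      show "(case q of (u, v) \<Rightarrow> formal_frac G (x \<otimes> u) (y \<otimes> v)) = formal_frac G (a \<otimes> c) (b \<otimes> d)"
        using p q * unfolding xy by (cases q) blast
    qed
    then show "(case p of (a, b) \<Rightarrow> \<Union>(c, d)\<in>formal_frac G c d. formal_frac G (a \<otimes> c) (b \<otimes> d)) =
        (\<Union>q\<in>formal_frac G c d. formal_frac G (a \<otimes> c) (b \<otimes> d))"
      by (simp add: xy)
  qed
  ultimately show ?thesis by simp
qed

lemma quot_group_comm_group: "comm_group (quot_group G)"
proof (rule comm_groupI)
  show "\<one>\<^bsub>quot_group G\<^esub> \<in> carrier (quot_group G)"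
    by (simp add: one_quot_group)
next
  fix x assume "x \<in> carrier (quot_group G)"
  then obtain a b where [simp]: "a \<in> carrier G" "b \<in> carrier G" and x: "x = formal_frac G a b"
    by (auto simp: carrier_quot_group)
  show "\<one>\<^bsub>quot_group G\<^esub> \<otimes>\<^bsub>quot_group G\<^esub> x = x"
    by (simp add: x mult_frac one_quot_group)
  have "formal_frac G b a \<otimes>\<^bsub>quot_group G\<^esub> x = \<one>\<^bsub>quot_group G\<^esub>"
    by (simp add: x mult_frac one_quot_group frac_eq_iff m_comm)
  then show "\<exists>y\<in>carrier (quot_group G). y \<otimes>\<^bsub>quot_group G\<^esub> x = \<one>\<^bsub>quot_group G\<^esub>"
    by (meson frac_closed \<open>a \<in> carrier G\<close> \<open>b \<in> carrier G\<close>)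
  fix y assume "y \<in> carrier (quot_group G)"
  then obtain c d where [simp]: "c \<in> carrier G" "d \<in> carrier G" and y: "y = formal_frac G c d"
    by (auto simp: carrier_quot_group)
  show "x \<otimes>\<^bsub>quot_group G\<^esub> y \<in> carrier (quot_group G)"
    by (simp add: x y mult_frac)
  show "x \<otimes>\<^bsub>quot_group G\<^esub> y = y \<otimes>\<^bsub>quot_group G\<^esub> x"
    by (simp add: x y mult_frac m_comm)
  fix z assume "z \<in> carrier (quot_group G)"
  then obtain e f where [simp]: "e \<in> carrier G" "f \<in> carrier G" and z: "z = formal_frac G e f"
    by (auto simp: carrier_quot_group)
  show "x \<otimes>\<^bsub>quot_group G\<^esub> y \<otimes>\<^bsub>quot_group G\<^esub> z = x \<otimes>\<^bsub>quot_group G\<^esub> (y \<otimes>\<^bsub>quot_group G\<^esub> z)"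
    by (simp add: x y z mult_frac m_assoc)
qed

lemma quot_embed_hom: "quot_embed G \<in> hom G (quot_group G)"
  by (auto simp: hom_def quot_embed_def mult_frac)

lemma quot_embed_inj: "inj_on (quot_embed G) (carrier G)"
  by (auto simp: inj_on_def quot_embed_def frac_eq_iff)

lemma frac_eq_quot_embed:
  assumes [simp]: "a \<in> carrier G" "b \<in> carrier G"
  shows "formal_frac G a b = quot_embed G a \<otimes>\<^bsub>quot_group G\<^esub> inv\<^bsub>quot_group G\<^esub> (quot_embed G b)"
proof -
  interpret Q: comm_group "quot_group G" by (rule quot_group_comm_group)
  have "formal_frac G a b \<otimes>\<^bsub>quot_group G\<^esub> quot_embed G b = quot_embed G a"
    by (simp add: quot_embed_def mult_frac frac_eq_iff m_ac)
  then show ?thesis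
    by (simp add: Q.inv_solve_right quot_embed_def)
qed

end

lemma (in comm_group) quot_group_iso_fractions:
  assumes "submonoid M G"
  shows "quot_group (G\<lparr>carrier := M\<rparr>) \<cong> G\<lparr>carrier := fractions G M\<rparr>"
proof -
  interpret S: submonoid M G by fact
  define N where "N = G\<lparr>carrier := M\<rparr>"
  have [simp]: "carrier N = M" "mult N = mult G" "one N = one G" by (simp_all add: N_def)
  interpret N: comm_monoid_cancel N
    by (rule comm_monoid_cancelI, rule comm_monoidI) (auto simp: m_ac)
  define h where "h X = (THE z. \<exists>(a, b)\<in>X. z = a \<otimes> inv b)" for X
  have cross: "a \<otimes> inv b = c \<otimes> inv d \<longleftrightarrow> a \<otimes> d = c \<otimes> b"
    if "a \<in> M" "b \<in> M" "c \<in> M" "d \<in> M" for a b c d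
  proof -
    have [simp]: "a \<in> carrier G" "b \<in> carrier G" "c \<in> carrier G" "d \<in> carrier G"
      using that by auto
    have "a \<otimes> inv b = c \<otimes> inv d \<longleftrightarrow> a \<otimes> inv b \<otimes> (b \<otimes> d) = c \<otimes> inv d \<otimes> (b \<otimes> d)"
      by (rule right_cancel[symmetric]) auto
    also have "a \<otimes> inv b \<otimes> (b \<otimes> d) = a \<otimes> (inv b \<otimes> b) \<otimes> d"
      by (simp only: m_assoc m_closed inv_closed \<open>a \<in> carrier G\<close> \<open>b \<in> carrier G\<close> \<open>d \<in> carrier G\<close>)
    also have "\<dots> = a \<otimes> d"
      by simp
    also have "c \<otimes> inv d \<otimes> (b \<otimes> d) = c \<otimes> (inv d \<otimes> d) \<otimes> b"
      by (simp only: m_comm[of b d] m_assoc m_closed inv_closed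
          \<open>b \<in> carrier G\<close> \<open>c \<in> carrier G\<close> \<open>d \<in> carrier G\<close>)
    also have "\<dots> = c \<otimes> b"
      by simp
    finally show ?thesis .
  qed
  have h: "h (formal_frac N a b) = a \<otimes> inv b" if ab: "a \<in> M" "b \<in> M" for a b
    unfolding h_def
  proof (rule the_equality)
    show "\<exists>(c, d)\<in>formal_frac N a b. a \<otimes> inv b = c \<otimes> inv d"
      using ab by (auto intro!: bexI[of _ "(a, b)"] simp: N.mem_frac_iff)
  next
    fix z assume "\<exists>(c, d)\<in>formal_frac N a b. z = c \<otimes> inv d"
    then show "z = a \<otimes> inv b"
      using ab by (auto simp: N.mem_frac_iff N.frac_eq_iff cross)
  qed
  have "h \<in> iso (quot_group N) (G\<lparr>carrier := fractions G M\<rparr>)"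
    unfolding iso_def hom_def bij_betw_def inj_on_def
  proof (intro CollectI conjI ballI impI funcsetI)
    fix x y assume "x \<in> carrier (quot_group N)" "y \<in> carrier (quot_group N)"
    then obtain a b c d where 1: "a \<in> M" "b \<in> M" "c \<in> M" "d \<in> M"
      and x: "x = formal_frac N a b" and y: "y = formal_frac N c d"
      by (auto simp: N.carrier_quot_group)
    then have [simp]: "a \<in> carrier G" "b \<in> carrier G" "c \<in> carrier G" "d \<in> carrier G"
      by auto
    have "x \<otimes>\<^bsub>quot_group N\<^esub> y = formal_frac N (a \<otimes> c) (b \<otimes> d)"
      using 1 N.mult_frac[of a b c d] by (simp add: x y)
    then show "h (x \<otimes>\<^bsub>quot_group N\<^esub> y) = h x \<otimes>\<^bsub>G\<lparr>carrier := fractions G M\<rparr>\<^esub> h y"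
      using 1 by (simp add: x y h inv_mult m_ac)
    show "x = y" if "h x = h y"
      using that 1 by (simp add: x y h cross N.frac_eq_iff)
  next
    show "h ` carrier (quot_group N) = carrier (G\<lparr>carrier := fractions G M\<rparr>)"
    proof
      show "h ` carrier (quot_group N) \<subseteq> carrier (G\<lparr>carrier := fractions G M\<rparr>)"
        by (auto simp: N.carrier_quot_group fractions_def h) blast
      show "carrier (G\<lparr>carrier := fractions G M\<rparr>) \<subseteq> h ` carrier (quot_group N)"
      proof
        fix z assume "z \<in> carrier (G\<lparr>carrier := fractions G M\<rparr>)"
        then obtain a b where ab: "a \<in> M" "b \<in> M" and z: "z = a \<otimes> inv b"
          by (auto simp: fractions_def)
        have "formal_frac N a b \<in> carrier (quot_group N)"
          using ab by simp
        then show "z \<in> h ` carrier (quot_group N)"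
          using h[OF ab] z by (metis imageI)
      qed
    qed
  next
    fix x assume "x \<in> carrier (quot_group N)"
    then obtain a b where ab: "a \<in> M" "b \<in> M" and x: "x = formal_frac N a b"
      by (auto simp: N.carrier_quot_group)
    then show "h x \<in> carrier (G\<lparr>carrier := fractions G M\<rparr>)"
      by (auto simp: x h fractions_def)
  qed
  then show ?thesis by (auto simp: is_iso_def N_def)
qed

end

theory Submission
  imports Defs
begin

text \<open>
  Both monoids live in their quotient groups, and \<open>f\<close> is an isomorphism of the power monoids. A set
  \<open>{1, a}\<close> with \<open>a\<close> of infinite order is recognized by two facts: its powers are pairwise distinct, and
  \<open>Z X = X\<^sup>3\<close> has at most two solutions \<open>Z\<close>. Hence \<open>f {1, a} = {1, b}\<close>, while \<open>f {1, a, a\<^sup>3}\<close> is either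
  \<open>{1, b, b\<^sup>3}\<close> or its reflection \<open>{1, b\<^sup>2, b\<^sup>3}\<close>; the image of \<open>a\<close> is taken to be \<open>b\<close> or \<open>b\<^sup>-\<^sup>1\<close>
  accordingly. For generic \<open>z\<close>, the equation \<open>{1, z, z\<^sup>3} Y' = {1, z, z\<^sup>3} Y\<close> with
  \<open>Y = Q {1, k z\<^sup>2} {1, k' z\<^sup>3}\<close> has a solution \<open>Y' \<noteq> Y\<close> if and only if the finite set \<open>Q\<close> contains a
  coincidence \<open>p = k q = k' r\<close>. Transporting such equations along \<open>f\<close> shows that the
  image map is multiplicative, so that it extends to an isomorphism of the quotient groups, and that \<open>f X\<close>
  contains a translate of the image of every triple of elements of \<open>X\<close>. If one of the monoids has
  a nontrivial unit, the extension maps one monoid onto the other; otherwise it does so up to inverting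
  elements, and elements of an incomparable pair are never inverted.

  Conversely, two reduced valuation monoids with the same quotient group \<open>L\<close> are the positive cones
  of two orders on \<open>L\<close>, and dividing \<open>X\<close> by the least element of \<open>X \<inter> L\<close> for the second order is an
  isomorphism of the power monoids.
\<close>


section \<open>A rigid equation between finite sets\<close>

text \<open>The obstacle is that \<open>f\<close> may truly reverse elements, as the second
  alternative of the theorem shows: a pair \<open>{1, a}\<close> is a translate of
  \<open>{1, a^-1}\<close>, so pairs determine an image only up to inversion, and the equations used
  must be insensitive to translation. The exponents 0, 1, 3 break the symmetry, since
  \<open>{0, 1, 3}\<close> is not a translate of its mirror image. The exponents 2 and 3 of the
  other two factors make a single hole possible: a point in degree 1, multiplied by
  \<open>{1, z, z^3}\<close>, occupies degrees 1, 2 and 4, and these equal 0 + 1, 2 + 0 and 3 + 1,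
  so the point is invisible exactly when its coefficient occurs in degrees 0, 2 and 3 at once.
  Elements of infinite order serve twice. They are the only ones that the test on pairs recognizes,
  so the map is defined on them alone, every element of the quotient group being a fraction of two
  such elements. Powers of one of them also supply the generic \<open>z\<close>; as the group may be
  infinite cyclic, genericity can only mean that relations with small exponents are
  excluded.\<close>

lemma mem_set_mult_iff: "x \<in> A <#>\<^bsub>G\<^esub> B \<longleftrightarrow> (\<exists>a\<in>A. \<exists>b\<in>B. x = a \<otimes>\<^bsub>G\<^esub> b)"
  by (auto simp: set_mult_def)

lemma set_multE:
  assumes "x \<in> A <#>\<^bsub>G\<^esub> B"
  obtains a b where "a \<in> A" "b \<in> B" "x = a \<otimes>\<^bsub>G\<^esub> b"
  using assms by (auto simp: mem_set_mult_iff)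

lemma set_multI: "a \<in> A \<Longrightarrow> b \<in> B \<Longrightarrow> x = a \<otimes>\<^bsub>G\<^esub> b \<Longrightarrow> x \<in> A <#>\<^bsub>G\<^esub> B"
  by (auto simp: mem_set_mult_iff)

context comm_group
begin

lemma div_eq_iff: "a \<in> carrier G \<Longrightarrow> b \<in> carrier G \<Longrightarrow> x \<in> carrier G \<Longrightarrow> a \<otimes> inv b = x \<longleftrightarrow> a = x \<otimes> b"
  using inv_solve_right' by auto

lemma eq_div_iff: "a \<in> carrier G \<Longrightarrow> b \<in> carrier G \<Longrightarrow> x \<in> carrier G \<Longrightarrow> x = a \<otimes> inv b \<longleftrightarrow> x \<otimes> b = a"
  using inv_solve_right by auto

text \<open>Cancelling the smaller power of \<open>z\<close> turns a coincidence of two layers into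
  one that involves a single power, which \<open>sep\<close> excludes.\<close>

lemma layers_separated:
  assumes "B \<subseteq> carrier G" "z \<in> carrier G"
    and sep: "\<And>b b' k. b \<in> B \<Longrightarrow> b' \<in> B \<Longrightarrow> 0 < k \<Longrightarrow> k \<le> n \<Longrightarrow> b \<otimes> z [^] (k::nat) \<noteq> b'"
    and "b \<in> B" "b' \<in> B" "i \<le> n" "j \<le> n" "b \<otimes> z [^] i = b' \<otimes> z [^] (j::nat)"
  shows "b = b' \<and> i = j"
proof -
  have *: "b = b' \<and> i = j" if "b \<in> B" "b' \<in> B" "i \<le> j" "j \<le> n" "b \<otimes> z [^] i = b' \<otimes> z [^] j" for b b'
    and i j :: nat
  proof -
    have [simp]: "b \<in> carrier G" "b' \<in> carrier G" "z \<in> carrier G" using that assms by auto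
    have "b \<otimes> z [^] i = b' \<otimes> z [^] (j - i) \<otimes> z [^] i"
      using that by (simp add: m_assoc nat_pow_mult)
    then have "b = b' \<otimes> z [^] (j - i)" by simp
    then show ?thesis using sep[of b' b "j - i"] that by (cases "i = j") (auto simp: le_diff_conv)
  qed
  show ?thesis
    using *[of b b' i j] *[of b' b j i] assms by (cases "i \<le> j") auto
qed

text \<open>
  The sets are graded by the exponent of \<open>z\<close>; for a fixed coefficient the hypothesis becomes a
  purely Boolean condition on nine layers.
\<close>
lemma graded_rigidity:
  assumes Q: "Q \<subseteq> carrier G" and k[simp]: "k \<in> carrier G" "k' \<in> carrier G" "z \<in> carrier G"
    and B: "B = Q \<union> ({k} <#> Q) \<union> ({k'} <#> Q) \<union> ({k \<otimes> k'} <#> Q)"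
    and sep: "\<And>b b' i. b \<in> B \<Longrightarrow> b' \<in> B \<Longrightarrow> 0 < i \<Longrightarrow> i \<le> 12 \<Longrightarrow> b \<otimes> z [^] (i::nat) \<noteq> b'"
    and Y: "Y = (Q <#> {\<one>, k \<otimes> z [^] (2::nat)}) <#> {\<one>, k' \<otimes> z [^] (3::nat)}"
    and Y': "Y' \<subseteq> carrier G"
    and eq: "{\<one>, z, z [^] (3::nat)} <#> Y' = {\<one>, z, z [^] (3::nat)} <#> Y"
    and neq: "Y' \<noteq> Y"
  shows "\<exists>p\<in>Q. \<exists>q\<in>Q. \<exists>r\<in>Q. p = k \<otimes> q \<and> p = k' \<otimes> r"
proof (rule ccontr)
  assume no: "\<not> ?thesis"
  \<comment> \<open>\<open>R i\<close> holds the coefficients of \<open>Y\<close> in degree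
    \<open>i\<close>. Expanding the two factors gives the degrees 0, 2, 3 and 2 + 3 only; the gap at
    degree 1 is where an extra point can hide.\<close>
  define R where "R i = (if i = 0 then Q else if i = 2 then {k} <#> Q else if i = 3 then {k'} <#> Q
    else if i = 5 then {k \<otimes> k'} <#> Q else {})" for i :: nat
  have BG: "B \<subseteq> carrier G" using subsetD[OF Q] by (auto simp: B mem_set_mult_iff)
  have RB: "R i \<subseteq> B" for i by (auto simp: R_def B)
  have uniq: "b = b' \<and> i = j" if "b \<in> B" "b' \<in> B" "i \<le> 12" "j \<le> 12" "b \<otimes> z [^] i = b' \<otimes> z [^] j" for b b'
    and i j :: nat
    using layers_separated[of B z 12 b b' i j] BG sep that by auto
  let ?D = "{\<one>, z, z [^] (3::nat)}"
  have YI: "q \<otimes> s \<otimes> t \<in> Y" if "q \<in> Q" "s \<in> {\<one>, k \<otimes> z [^] (2::nat)}" "t \<in> {\<one>, k' \<otimes> z [^] (3::nat)}" for q s t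
    unfolding Y by (rule set_multI[OF set_multI[OF that(1,2) refl] that(3) refl])
  have YR: "x \<in> Y \<longleftrightarrow> (\<exists>i. \<exists>b\<in>R i. x = b \<otimes> z [^] i)" for x
  proof
    assume "x \<in> Y"
    then obtain q s t where q: "q \<in> Q" and s: "s \<in> {\<one>, k \<otimes> z [^] (2::nat)}"
      and t: "t \<in> {\<one>, k' \<otimes> z [^] (3::nat)}" and x: "x = q \<otimes> s \<otimes> t"
      unfolding Y by (elim set_multE) blast
    have [simp]: "q \<in> carrier G" using q Q by auto
    have z5: "z [^] (2::nat) \<otimes> z [^] (3::nat) = z [^] (5::nat)" by (simp add: nat_pow_mult)
    consider "s = \<one>" "t = \<one>" | "s = k \<otimes> z [^] (2::nat)" "t = \<one>" | "s = \<one>" "t = k' \<otimes> z [^] (3::nat)"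
      | "s = k \<otimes> z [^] (2::nat)" "t = k' \<otimes> z [^] (3::nat)" using s t by auto
    then have "(q \<in> R 0 \<and> x = q \<otimes> z [^] (0::nat)) \<or> (k \<otimes> q \<in> R 2 \<and> x = (k \<otimes> q) \<otimes> z [^] (2::nat))
      \<or> (k' \<otimes> q \<in> R 3 \<and> x = (k' \<otimes> q) \<otimes> z [^] (3::nat))
      \<or> (k \<otimes> k' \<otimes> q \<in> R 5 \<and> x = (k \<otimes> k' \<otimes> q) \<otimes> z [^] (5::nat))"
    proof cases
      case 1 then show ?thesis using q x by (simp add: R_def)
    next
      case 2
      then have "x = (k \<otimes> q) \<otimes> z [^] (2::nat)" using x by (simp add: m_ac)
      moreover have "k \<otimes> q \<in> R 2" using q by (simp add: R_def mem_set_mult_iff) blast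
      ultimately show ?thesis by blast
    next
      case 3
      then have "x = (k' \<otimes> q) \<otimes> z [^] (3::nat)" using x by (simp add: m_ac)
      moreover have "k' \<otimes> q \<in> R 3" using q by (simp add: R_def mem_set_mult_iff) blast
      ultimately show ?thesis by blast
    next
      case 4
      have "x = (k \<otimes> k' \<otimes> q) \<otimes> z [^] (5::nat)" using x 4 by (simp add: z5[symmetric] m_ac)
      moreover have "k \<otimes> k' \<otimes> q \<in> R 5" using q by (simp add: R_def mem_set_mult_iff) blast
      ultimately show ?thesis by blast
    qed
    then show "\<exists>i. \<exists>b\<in>R i. x = b \<otimes> z [^] i" by blast
  next
    assume "\<exists>i. \<exists>b\<in>R i. x = b \<otimes> z [^] i"
    then obtain i b where b: "b \<in> R i" "x = b \<otimes> z [^] i" by auto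
    have z5: "z [^] (2::nat) \<otimes> z [^] (3::nat) = z [^] (5::nat)" by (simp add: nat_pow_mult)
    consider "i = 0" | "i = 2" | "i = 3" | "i = 5" using b by (auto simp: R_def split: if_splits)
    then show "x \<in> Y"
    proof cases
      case 1
      then have "b \<in> Q" using b by (simp add: R_def)
      then have [simp]: "b \<in> carrier G" using Q by auto
      have "x = b \<otimes> \<one> \<otimes> \<one>" using b 1 by simp
      then show ?thesis using YI[of b \<one> \<one>] \<open>b \<in> Q\<close> by simp
    next
      case 2
      then obtain q where q: "q \<in> Q" "b = k \<otimes> q" using b by (auto simp: R_def mem_set_mult_iff)
      then have [simp]: "q \<in> carrier G" using Q by auto
      have "x = q \<otimes> (k \<otimes> z [^] (2::nat)) \<otimes> \<one>" using q b 2 by (simp add: m_ac)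
      then show ?thesis using q YI[of q "k \<otimes> z [^] (2::nat)" \<one>] by simp
    next
      case 3
      then obtain q where q: "q \<in> Q" "b = k' \<otimes> q" using b by (auto simp: R_def mem_set_mult_iff)
      then have [simp]: "q \<in> carrier G" using Q by auto
      have "x = q \<otimes> \<one> \<otimes> (k' \<otimes> z [^] (3::nat))" using q b 3 by (simp add: m_ac)
      then show ?thesis using q YI[of q \<one> "k' \<otimes> z [^] (3::nat)"] by simp
    next
      case 4
      then obtain q where q: "q \<in> Q" "b = k \<otimes> k' \<otimes> q" using b by (auto simp: R_def mem_set_mult_iff)
      then have [simp]: "q \<in> carrier G" using Q by auto
      have "x = q \<otimes> (k \<otimes> z [^] (2::nat)) \<otimes> (k' \<otimes> z [^] (3::nat))" using q b 4 by (simp add: m_ac flip: z5)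
      then show ?thesis using q YI[of q "k \<otimes> z [^] (2::nat)" "k' \<otimes> z [^] (3::nat)"] by simp
    qed
  qed
  have R8: "i \<le> 8" if "b \<in> R i" for b i using that by (auto simp: R_def split: if_splits)
  have YG: "Y \<subseteq> carrier G"
  proof
    fix x assume "x \<in> Y"
    then obtain i b where "b \<in> R i" "x = b \<otimes> z [^] i" using YR by blast
    then show "x \<in> carrier G" using BG RB[of i] by auto
  qed
  have Ylay: "\<exists>b\<in>B. \<exists>i\<le>(5::nat). y = b \<otimes> z [^] i" if "y \<in> Y" for y
    proof -
    obtain i b where b: "b \<in> R i" "y = b \<otimes> z [^] i" using \<open>y \<in> Y\<close> YR by blast
    then have "i \<le> 5" by (auto simp: R_def split: if_splits)
    then show ?thesis using b RB by blast
  qed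
  have DYlay: "\<exists>b\<in>B. \<exists>i\<le>(8::nat). y = b \<otimes> z [^] i" if "y \<in> ?D <#> Y" for y
  proof -
    from that obtain d u where "d \<in> ?D" "u \<in> Y" "y = d \<otimes> u" by (rule set_multE)
    obtain b and i :: nat where b: "b \<in> B" "i \<le> 5" "u = b \<otimes> z [^] i" using Ylay \<open>u \<in> Y\<close> by blast
    have [simp]: "b \<in> carrier G" using b BG by auto
    obtain j :: nat where "j \<le> 3" "d = z [^] (j::nat)"
      using \<open>d \<in> ?D\<close> by (auto intro: that[of 0] that[of 1] that[of 3])
    then have "y = b \<otimes> z [^] (i + j)" using b \<open>y = d \<otimes> u\<close> by (simp add: m_ac flip: nat_pow_mult)
    moreover have "i + j \<le> 8" using b \<open>j \<le> 3\<close> by simp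
    ultimately show ?thesis using b by blast
  qed
  \<comment> \<open>Degrees up to 8 shifted by at most 3 reach 11, so separation up to 12 makes
    every degree and coefficient in the product unambiguous.\<close>
  have mem: "b \<otimes> z [^] i \<in> ?D <#> W \<longleftrightarrow> b \<otimes> z [^] i \<in> W \<or> (1 \<le> i \<and> b \<otimes> z [^] (i - 1) \<in> W)
      \<or> (3 \<le> i \<and> b \<otimes> z [^] (i - 3) \<in> W)"
    if W: "W \<subseteq> carrier G" "\<And>y. y \<in> W \<Longrightarrow> \<exists>b\<in>B. \<exists>i\<le>(8::nat). y = b \<otimes> z [^] i" and b: "b \<in> B"
      and i: "i \<le> 12" for W b and i :: nat
  proof
    have [simp]: "b \<in> carrier G" using b BG by auto
    assume "b \<otimes> z [^] i \<in> ?D <#> W"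
    then obtain d u where d: "d \<in> ?D" and u: "u \<in> W" "b \<otimes> z [^] i = d \<otimes> u" by (rule set_multE)
    obtain b' and i' :: nat where b': "b' \<in> B" "i' \<le> 8" "u = b' \<otimes> z [^] i'" using W u by blast
    have [simp]: "b' \<in> carrier G" using b' BG by auto
    obtain j :: nat where j: "j = 0 \<or> j = 1 \<or> j = 3" "d = z [^] (j::nat)"
      using d by (auto intro: that[of 0] that[of 1] that[of 3])
    then have "b \<otimes> z [^] i = b' \<otimes> z [^] (i' + j)" using b' u by (simp add: m_ac flip: nat_pow_mult)
    then have "b = b' \<and> i = i' + j" using b b' i j by (intro uniq) auto
    then show "b \<otimes> z [^] i \<in> W \<or> (1 \<le> i \<and> b \<otimes> z [^] (i - 1) \<in> W) \<or> (3 \<le> i \<and> b \<otimes> z [^] (i - 3) \<in> W)"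
      using j u b' by auto
  next
    have [simp]: "b \<in> carrier G" using b BG by auto
    have s: "b \<otimes> z [^] i = z [^] j \<otimes> (b \<otimes> z [^] (i - j))" if "j \<le> i" for j
      using nat_pow_mult[of z j "i - j"] that by (simp add: m_lcomm)
    assume "b \<otimes> z [^] i \<in> W \<or> (1 \<le> i \<and> b \<otimes> z [^] (i - 1) \<in> W) \<or> (3 \<le> i \<and> b \<otimes> z [^] (i - 3) \<in> W)"
    then show "b \<otimes> z [^] i \<in> ?D <#> W"
    proof (elim disjE conjE)
      assume "b \<otimes> z [^] i \<in> W"
      then show ?thesis unfolding mem_set_mult_iff by (intro bexI[of _ \<one>] bexI[of _ "b \<otimes> z [^] i"]) auto
    next
      assume "1 \<le> i" "b \<otimes> z [^] (i - 1) \<in> W"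
      then show ?thesis using s[of 1] unfolding mem_set_mult_iff
        by (intro bexI[of _ z] bexI[of _ "b \<otimes> z [^] (i - 1)"]) auto
    next
      assume "3 \<le> i" "b \<otimes> z [^] (i - 3) \<in> W"
      then show ?thesis using s[of 3] unfolding mem_set_mult_iff
        by (intro bexI[of _ "z [^] (3::nat)"] bexI[of _ "b \<otimes> z [^] (i - 3)"]) auto
    qed
  qed
  \<comment> \<open>Since \<open>\<one>\<close> lies in \<open>?D\<close>, the unknown
    \<open>Y'\<close> is contained in \<open>?D <#> Y\<close> and inherits its layers.\<close>
  have Y'lay: "\<exists>b\<in>B. \<exists>i\<le>(8::nat). y = b \<otimes> z [^] i" if "y \<in> Y'" for y
  proof -
    have "y \<in> ?D <#> Y'" unfolding mem_set_mult_iff using that Y' by (intro bexI[of _ \<one>] bexI[of _ y]) auto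
    then show ?thesis using DYlay eq by auto
  qed
  have Ylay8: "\<exists>b\<in>B. \<exists>i\<le>(8::nat). y = b \<otimes> z [^] i" if "y \<in> Y" for y
    proof -
    obtain b and i :: nat where "b \<in> B" "i \<le> 5" "y = b \<otimes> z [^] i" using Ylay[OF \<open>y \<in> Y\<close>] by blast
    moreover from this have "i \<le> 8" by simp
    ultimately show ?thesis by blast
  qed
  have memR: "b \<otimes> z [^] i \<in> Y \<longleftrightarrow> b \<in> R i" if "b \<in> B" "i \<le> 12" for b and i :: nat
  proof
    assume "b \<otimes> z [^] i \<in> Y"
    then obtain j b' where "b' \<in> R j" "b \<otimes> z [^] i = b' \<otimes> z [^] j" by (auto simp: YR)
    then show "b \<in> R i" using uniq[of b b' i j] that RB R8[of b' j] by auto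
  qed (auto simp: YR)
  have "b \<otimes> z [^] i \<in> Y' \<longleftrightarrow> b \<otimes> z [^] i \<in> Y" if b: "b \<in> B" and i: "i \<le> 8" for b and i :: nat
  proof -
    have e: "(b \<otimes> z [^] i \<in> Y' \<or> (1 \<le> i \<and> b \<otimes> z [^] (i - 1) \<in> Y') \<or> (3 \<le> i \<and> b \<otimes> z [^] (i - 3) \<in> Y'))
      \<longleftrightarrow> (b \<otimes> z [^] i \<in> Y \<or> (1 \<le> i \<and> b \<otimes> z [^] (i - 1) \<in> Y) \<or> (3 \<le> i \<and> b \<otimes> z [^] (i - 3) \<in> Y))"
      if "i \<le> 12" for i :: nat
      using mem[OF Y' Y'lay b that] mem[OF YG Ylay8 b that] eq by simp
    define v where "v i = (b \<otimes> z [^] (i::nat) \<in> Y')" for i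
    define w where "w i = (b \<otimes> z [^] (i::nat) \<in> Y)" for i
    note e' = e[folded v_def w_def]
    have wR: "w i \<longleftrightarrow> b \<in> R i" if "i \<le> 12" for i
      using memR[OF b that] by (simp add: w_def)
    have w: "w 1 = False" "w 4 = False" "w 6 = False" "w 7 = False" "w 8 = False" "w 9 = False"
      by (simp_all add: wR R_def)
    have nn: "\<not> (w 0 \<and> w 2 \<and> w 3)"
    proof
      assume "w 0 \<and> w 2 \<and> w 3"
      then have "b \<in> Q" "b \<in> {k} <#> Q" "b \<in> {k'} <#> Q" by (simp_all add: wR R_def)
      then show False using no by (auto simp: mem_set_mult_iff)
    qed
    \<comment> \<open>The products agree in each degree. Degrees 7 and 9 clear \<open>v 4\<close>,
      \<open>v 6\<close>, \<open>v 7\<close> and \<open>v 8\<close>; degrees 0 and 8 then give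
      \<open>v 0\<close> and \<open>v 5\<close>. If \<open>v 1\<close> held, degrees 1, 2 and 4
      would force \<open>w 0\<close>, \<open>w 2\<close> and \<open>w 3\<close>, against
      \<open>nn\<close>; without it, degrees 2 and 4 give \<open>v 2\<close> and
      \<open>v 3\<close>.\<close>
    have "v 0 = w 0 \<and> v 1 = w 1 \<and> v 2 = w 2 \<and> v 3 = w 3 \<and> v 4 = w 4 \<and> v 5 = w 5 \<and> v 6 = w 6 \<and> v 7 = w 7 \<and>
      v 8 = w 8"
      using e'[of 0] e'[of 1] e'[of 2] e'[of 3] e'[of 4] e'[of 5] e'[of 6] e'[of 7] e'[of 8] e'[of 9] w nn
      by simp blast
    moreover have "i = 0 \<or> i = 1 \<or> i = 2 \<or> i = 3 \<or> i = 4 \<or> i = 5 \<or> i = 6 \<or> i = 7 \<or> i = 8" using i by auto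
    ultimately show ?thesis unfolding v_def[symmetric] w_def[symmetric] by auto
  qed
  then have "Y' = Y" using Y'lay Ylay8 by blast
  then show False using neq by simp
qed

end

section \<open>Aperiodic and independent elements\<close>

definition aperiodic :: "('a, 'm) monoid_scheme \<Rightarrow> 'a \<Rightarrow> bool" where
  "aperiodic G x \<longleftrightarrow> (\<forall>n>0. x [^]\<^bsub>G\<^esub> (n::nat) \<noteq> \<one>\<^bsub>G\<^esub>)"

definition cubic :: "('a, 'm) monoid_scheme \<Rightarrow> 'a \<Rightarrow> 'a set" where
  "cubic G x = {\<one>\<^bsub>G\<^esub>, x, x [^]\<^bsub>G\<^esub> (3::nat)}"

context comm_group
begin

section \<open>Setwise products and translates\<close>

lemma set_mult_one_left: "X \<subseteq> carrier G \<Longrightarrow> {\<one>} <#> X = X"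
  by (force simp: mem_set_mult_iff)

lemma set_mult_one_right: "X \<subseteq> carrier G \<Longrightarrow> X <#> {\<one>} = X"
  by (force simp: mem_set_mult_iff)

lemma set_mult_singletons: "{a} <#> {b} = {a \<otimes> b}"
  by (auto simp: mem_set_mult_iff)

lemma set_mult_comm: "X \<subseteq> carrier G \<Longrightarrow> Y \<subseteq> carrier G \<Longrightarrow> X <#> Y = Y <#> X"
  by (auto simp: mem_set_mult_iff) (metis m_comm subsetD)+

lemma set_mult_left_commute:
  "X \<subseteq> carrier G \<Longrightarrow> Y \<subseteq> carrier G \<Longrightarrow> Z \<subseteq> carrier G \<Longrightarrow> X <#> (Y <#> Z) = Y <#> (X <#> Z)"
  by (metis set_mult_assoc set_mult_comm)

lemmas set_mult_ac = set_mult_assoc set_mult_comm set_mult_left_commute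

lemma translate_cancel:
  assumes "s \<in> carrier G" "X \<subseteq> carrier G" "Y \<subseteq> carrier G"
  shows "{s} <#> X = {s} <#> Y \<longleftrightarrow> X = Y"
proof
  assume "{s} <#> X = {s} <#> Y"
  then have "{inv s} <#> ({s} <#> X) = {inv s} <#> ({s} <#> Y)" by simp
  then show "X = Y"
    using assms by (simp add: set_mult_assoc[symmetric] set_mult_singletons set_mult_one_left)
qed simp

text \<open>The images of pairs and of cubic sets under \<open>f\<close> are controlled only up to
  translation; the unknown translations \<open>s\<close> and \<open>t\<close> are cancelled
  here.\<close>

lemma graded_rigidity_translate:
  assumes Q: "Q \<subseteq> carrier G" and k[simp]: "k \<in> carrier G" "k' \<in> carrier G" "z \<in> carrier G"
    and [simp]: "s \<in> carrier G" "t \<in> carrier G"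
    and B: "B = Q \<union> ({k} <#> Q) \<union> ({k'} <#> Q) \<union> ({k \<otimes> k'} <#> Q)"
    and sep: "\<And>b b' i. b \<in> B \<Longrightarrow> b' \<in> B \<Longrightarrow> 0 < i \<Longrightarrow> i \<le> 12 \<Longrightarrow> b \<otimes> z [^] (i::nat) \<noteq> b'"
    and Y: "Y = {s} <#> ((Q <#> {\<one>, k \<otimes> z [^] (2::nat)}) <#> {\<one>, k' \<otimes> z [^] (3::nat)})"
    and Y': "Y' \<subseteq> carrier G"
    and eq: "({t} <#> cubic G z) <#> Y' = ({t} <#> cubic G z) <#> Y"
    and neq: "Y' \<noteq> Y"
  shows "\<exists>p\<in>Q. \<exists>q\<in>Q. \<exists>r\<in>Q. p = k \<otimes> q \<and> p = k' \<otimes> r"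
proof -
  define W where "W = (Q <#> {\<one>, k \<otimes> z [^] (2::nat)}) <#> {\<one>, k' \<otimes> z [^] (3::nat)}"
  have WG: "W \<subseteq> carrier G" unfolding W_def using Q by (intro setmult_subset_G) auto
  have cG: "cubic G z \<subseteq> carrier G" by (simp add: cubic_def)
  define W' where "W' = {inv s} <#> Y'"
  have W'G: "W' \<subseteq> carrier G" unfolding W'_def using Y' by (intro setmult_subset_G) auto
  have Y'W: "Y' = {s} <#> W'" using Y'
    by (simp add: W'_def set_mult_assoc[symmetric] set_mult_singletons set_mult_one_left)
  have "{t} <#> ({s} <#> (cubic G z <#> W')) = {t} <#> ({s} <#> (cubic G z <#> W))"
    using eq WG W'G cG unfolding Y Y'W W_def[symmetric]
    by (simp add: set_mult_assoc set_mult_left_commute setmult_subset_G)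
  then have "cubic G z <#> W' = cubic G z <#> W"
    using WG W'G cG by (simp add: translate_cancel setmult_subset_G)
  moreover have "W' \<noteq> W" using neq Y'W Y W_def by auto
  ultimately show ?thesis
    using graded_rigidity[OF Q k B sep W_def W'G] by (auto simp: cubic_def)
qed

section \<open>Powers of elements of infinite order\<close>

lemma aperiodic_nat_pow_eq:
  assumes "aperiodic G x" "x \<in> carrier G" "x [^] (m::nat) = x [^] (n::nat)"
  shows "m = n"
proof -
  have *: "\<not> m < n" if "x [^] (m::nat) = x [^] (n::nat)" for m n
  proof
    assume "m < n"
    then have "x [^] m \<otimes> x [^] (n - m) = x [^] m" using assms that by (subst nat_pow_mult) auto
    then have "x [^] (n - m) = \<one>" using assms by simp
    then show False using \<open>m < n\<close> assms by (auto simp: aperiodic_def)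
  qed
  show ?thesis using *[of m n] *[of n m] assms by auto
qed

lemma aperiodic_int_pow_one:
  assumes "aperiodic G x" "x \<in> carrier G" "x [^] (i::int) = \<one>"
  shows "i = 0"
proof (rule ccontr)
  assume "i \<noteq> 0"
  then obtain n where n: "n > 0" "i = int n \<or> i = - int n"
    by (intro that[of "nat \<bar>i\<bar>"]) auto
  then have "x [^] n = \<one>" using assms by (auto simp: int_pow_int int_pow_neg)
  then show False using assms n by (auto simp: aperiodic_def)
qed

lemma aperiodic_pow:
  assumes "aperiodic G x" "x \<in> carrier G" "n > 0"
  shows "aperiodic G (x [^] (n::nat))"
  using assms by (auto simp: aperiodic_def nat_pow_pow)

lemma aperiodic_inv:
  assumes "aperiodic G x" "x \<in> carrier G"
  shows "aperiodic G (inv x)"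
  using assms by (auto simp: aperiodic_def nat_pow_inv)

lemma aperiodic_not_one: "aperiodic G x \<Longrightarrow> x \<noteq> \<one>"
  by (auto simp: aperiodic_def)

section \<open>Monomials in two elements, and independence up to a bound\<close>

definition mon :: "'a \<Rightarrow> 'a \<Rightarrow> int \<Rightarrow> int \<Rightarrow> 'a" where
  "mon a b i j = a [^] i \<otimes> b [^] j"

text \<open>The bound \<open>L\<close> is essential: in an infinite cyclic group no two elements are
  independent without it, whereas every bounded version is met by \<open>x e^n\<close> for all large
  \<open>n\<close>, see \<open>eventually_indep\<close>.\<close>

definition indep :: "int \<Rightarrow> 'a \<Rightarrow> 'a \<Rightarrow> bool" where
  "indep L a b \<longleftrightarrow> (\<forall>i j. \<bar>i\<bar> \<le> L \<longrightarrow> \<bar>j\<bar> \<le> L \<longrightarrow> mon a b i j = \<one> \<longrightarrow> i = 0 \<and> j = 0)"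

lemma mon_closed [simp]: "a \<in> carrier G \<Longrightarrow> b \<in> carrier G \<Longrightarrow> mon a b i j \<in> carrier G"
  by (simp add: mon_def)

lemma mon_mult: "a \<in> carrier G \<Longrightarrow> b \<in> carrier G \<Longrightarrow> mon a b i j \<otimes> mon a b k l = mon a b (i + k) (j + l)"
  by (simp add: mon_def int_pow_mult m_ac)

lemma mon_inv: "a \<in> carrier G \<Longrightarrow> b \<in> carrier G \<Longrightarrow> inv (mon a b i j) = mon a b (- i) (- j)"
  by (simp add: mon_def int_pow_neg inv_mult)

lemma mon_div: "a \<in> carrier G \<Longrightarrow> b \<in> carrier G \<Longrightarrow> mon a b i j \<otimes> inv (mon a b k l) = mon a b (i - k) (j - l)"
  by (simp add: mon_inv mon_mult)

lemma mon_pow: "a \<in> carrier G \<Longrightarrow> b \<in> carrier G \<Longrightarrow> mon a b i j [^] (k::int) = mon a b (i * k) (j * k)"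
  by (simp add: mon_def int_pow_distrib int_pow_pow mult.commute)

lemma mon_pow_nat: "a \<in> carrier G \<Longrightarrow> b \<in> carrier G \<Longrightarrow>
  mon a b i j [^] (k::nat) = mon a b (i * int k) (j * int k)"
  using mon_pow[of a b i j "int k"] by (simp add: int_pow_int)

lemma mon_one: "mon a b 0 0 = \<one>" by (simp add: mon_def)
lemma mon_fst: "a \<in> carrier G \<Longrightarrow> mon a b 1 0 = a" by (simp add: mon_def)
lemma mon_snd: "b \<in> carrier G \<Longrightarrow> mon a b 0 1 = b" by (simp add: mon_def)

lemma mon_eqD:
  assumes "indep L a b" "a \<in> carrier G" "b \<in> carrier G" "mon a b i j = mon a b k l" "\<bar>i - k\<bar> \<le> L" "\<bar>j - l\<bar> \<le> L"
  shows "i = k \<and> j = l"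
proof -
  have "mon a b (i - k) (j - l) = \<one>" using assms mon_div[of a b i j k l] by simp
  then show ?thesis using assms unfolding indep_def by fastforce
qed

lemma indep_mono: "indep L a b \<Longrightarrow> L' \<le> L \<Longrightarrow> indep L' a b"
  unfolding indep_def by (meson order_trans)

definition monset :: "'a \<Rightarrow> 'a \<Rightarrow> (int \<times> int) set \<Rightarrow> 'a set" where
  "monset a b A = (\<lambda>(i, j). mon a b i j) ` A"

text \<open>Equations between explicit sets thereby reduce to sums of finite sets of integer
  pairs.\<close>

lemma monset_mult:
  assumes "a \<in> carrier G" "b \<in> carrier G"
  shows "monset a b A <#> monset a b B = monset a b ((\<lambda>((i, j), (k, l)). (i + k, j + l)) ` (A \<times> B))"
  unfolding set_eq_iff
proof (intro allI iffI)
  fix x assume "x \<in> monset a b A <#> monset a b B"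
  then obtain i j k l where "(i, j) \<in> A" "(k, l) \<in> B" "x = mon a b i j \<otimes> mon a b k l"
    by (auto simp: mem_set_mult_iff monset_def)
  then show "x \<in> monset a b ((\<lambda>((i, j), (k, l)). (i + k, j + l)) ` (A \<times> B))"
    using assms by (force simp: monset_def mon_mult)
next
  fix x assume "x \<in> monset a b ((\<lambda>((i, j), (k, l)). (i + k, j + l)) ` (A \<times> B))"
  then obtain i j k l where "(i, j) \<in> A" "(k, l) \<in> B" "x = mon a b (i + k) (j + l)"
    by (auto simp: monset_def)
  then show "x \<in> monset a b A <#> monset a b B"
    using assms by (intro set_multI[of "mon a b i j" _ "mon a b k l"]) (auto simp: monset_def mon_mult)
qed

lemma mem_monset: "x \<in> monset a b A \<longleftrightarrow> (\<exists>i j. (i, j) \<in> A \<and> x = mon a b i j)"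
  by (auto simp: monset_def)

text \<open>In exponents, \<open>Y\<close> consists of the corners of a square of side 2,
  \<open>P\<close> is the unit square, and \<open>Y <#> P\<close> fills the 4 by 4 grid. Hence
  \<open>Y'\<close> lies in the 3 by 3 grid and keeps the four corners; an additional point must be
  the midpoint of two corners, with step \<open>c\<close>.\<close>

lemma square_hole:
  assumes ab[simp]: "a \<in> carrier G" "b \<in> carrier G" and c[simp]: "c \<in> carrier G" and ind: "indep 6 a b"
    and Y: "Y = {\<one>, a [^] (2::nat)} <#> {\<one>, b [^] (2::nat)}" and P: "P = {\<one>, a} <#> {\<one>, b}"
    and Y': "Y' \<subseteq> carrier G" "Y' <#> P = Y <#> P" "{\<one>, c} <#> Y' = {\<one>, c} <#> Y" "Y' \<noteq> Y"
  shows "\<exists>k\<in>{-1,0,1}. \<exists>l\<in>{-1,0,1}. c = mon a b k l"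
proof -
  note meq = mon_eqD[OF ind ab]
  have a2: "a [^] (2::nat) = mon a b 2 0" "b [^] (2::nat) = mon a b 0 2"
    by (simp_all add: mon_def flip: int_pow_int)
  have "{\<one>, a [^] (2::nat)} = monset a b {(0,0),(2,0)}" "{\<one>, b [^] (2::nat)} = monset a b {(0,0),(0,2)}"
    "{\<one>, a} = monset a b {(0,0),(1,0)}" "{\<one>, b} = monset a b {(0,0),(0,1)}"
    by (simp_all add: monset_def mon_one mon_fst mon_snd a2)
  moreover have "(\<lambda>((i, j), (k, l)). (i + k, j + l)) ` ({(0,0),(2,0)} \<times> {(0,0),(0,2)}) = {0,2::int} \<times> {0,2::int}"
    "(\<lambda>((i, j), (k, l)). (i + k, j + l)) ` ({(0,0),(1,0)} \<times> {(0,0),(0,1)}) = {0,1::int} \<times> {0,1::int}"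
    by auto
  ultimately have Ym: "Y = monset a b ({0,2} \<times> {0,2})" and Pm: "P = monset a b ({0,1} \<times> {0,1})"
    unfolding Y P by (simp_all only: monset_mult[OF ab])
  have Ymem: "y \<in> Y \<longleftrightarrow> (\<exists>s\<in>{0,2}. \<exists>t\<in>{0,2}. y = mon a b s t)" for y
    unfolding Ym mem_monset by blast
  have Pmem: "y \<in> P \<longleftrightarrow> (\<exists>s\<in>{0,1}. \<exists>t\<in>{0,1}. y = mon a b s t)" for y
    unfolding Pm mem_monset by blast
  have YG: "Y \<subseteq> carrier G" by (auto simp: Ym mem_monset)
  have YP: "y \<in> Y <#> P \<Longrightarrow> \<exists>s\<in>{0..3}. \<exists>t\<in>{0..3}. y = mon a b s t" for y
  proof -
    assume "y \<in> Y <#> P"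
    then obtain u v where "u \<in> Y" "v \<in> P" "y = u \<otimes> v" by (rule set_multE)
    moreover from this obtain s t where st: "s \<in> {0,2}" "t \<in> {0,2}" "u = mon a b s t"
      using Ymem[of u] by blast
    moreover obtain s' t' where st': "s' \<in> {0,1}" "t' \<in> {0,1}" "v = mon a b s' t'"
      using Pmem[of v] \<open>v \<in> P\<close> by blast
    ultimately have "y = mon a b (s + s') (t + t')" by (simp only: mon_mult[OF ab])
    moreover have "s + s' \<in> {0..3}" "t + t' \<in> {0..3}" using st st' by auto
    ultimately show ?thesis by blast
  qed
  have YPI: "mon a b (s + s') (t + t') \<in> Y <#> P" if "s \<in> {0,2}" "t \<in> {0,2}" "s' \<in> {0,1}" "t' \<in> {0,1}" for s t s' t'
    unfolding mon_mult[OF ab, symmetric] using that Ymem Pmem by (intro set_multI[OF _ _ refl]) blast+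
  have grid: "\<exists>i\<in>{0..2}. \<exists>j\<in>{0..2}. y = mon a b i j" if y: "y \<in> Y'" for y
  proof -
    have in3: "\<exists>i\<in>{0..3}. \<exists>j\<in>{0..3}. y \<otimes> mon a b s t = mon a b i j" if "s \<in> {0,1}" "t \<in> {0,1}" for s t
      proof (rule YP)
      have "mon a b s t \<in> P" using that Pmem by blast
      then show "y \<otimes> mon a b s t \<in> Y <#> P" using y Y'(2) set_multI[OF y _ refl] by blast
    qed
    have [simp]: "y \<in> carrier G" using y Y' by auto
    obtain i j where ij: "i \<in> {0..3}" "j \<in> {0..3}" "y = mon a b i j"
      using in3[of 0 0] by (auto simp: mon_one)
    obtain i' j' where "i' \<in> {0..3}" "j' \<in> {0..3}" "mon a b (i + 1) (j + 1) = mon a b i' j'"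
      using in3[of 1 1] by (auto simp: ij mon_mult)
    then have "i + 1 = i' \<and> j + 1 = j'" using ij by (intro meq) auto
    then have "i \<in> {0..2}" "j \<in> {0..2}" using ij \<open>i' \<in> {0..3}\<close> \<open>j' \<in> {0..3}\<close> by auto
    then show ?thesis using ij by blast
  qed
  have "Y \<subseteq> Y'"
  proof
    fix y assume "y \<in> Y"
    then obtain s t where st: "s \<in> {0,2}" "t \<in> {0,2}" "y = mon a b s t" using Ymem[of y] by blast
    \<comment> \<open>The corner \<open>(s, t)\<close> is pushed outwards to a corner of the 4 by 4
      grid, with coordinates 0 or 3; within the 3 by 3 grid only \<open>(s, t)\<close> itself
      reaches it by a step of \<open>P\<close>.\<close>
    define s' :: int where "s' = (if s = 0 then 0 else 1)"
    define t' :: int where "t' = (if t = 0 then 0 else 1)"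
    have "mon a b (s + s') (t + t') \<in> Y' <#> P"
      unfolding Y'(2) using st by (intro YPI) (auto simp: s'_def t'_def)
    then obtain u v where uv: "u \<in> Y'" "v \<in> P" "mon a b (s + s') (t + t') = u \<otimes> v" by (rule set_multE)
    obtain i j where ij: "i \<in> {0..2}" "j \<in> {0..2}" "u = mon a b i j" using grid[OF uv(1)] by blast
    obtain k l where kl: "k \<in> {0,1}" "l \<in> {0,1}" "v = mon a b k l" using uv(2) Pmem[of v] by blast
    have "mon a b (s + s') (t + t') = mon a b (i + k) (j + l)" using uv ij kl by (simp add: mon_mult)
    then have "s + s' = i + k \<and> t + t' = j + l" using st ij kl by (intro meq) (auto simp: s'_def t'_def)
    then have "i = s \<and> j = t" using st ij kl by (auto simp: s'_def t'_def split: if_splits)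
    then show "y \<in> Y'" using st ij uv by simp
  qed
  then obtain w where w: "w \<in> Y'" "w \<notin> Y" using Y' by auto
  have [simp]: "w \<in> carrier G" using w Y' by auto
  obtain i j where ij: "i \<in> {0..2}" "j \<in> {0..2}" "w = mon a b i j" using grid[OF w(1)] by blast
  have "w \<in> {\<one>, c} <#> Y" unfolding Y'(3)[symmetric] using w by (intro set_multI[of \<one> _ w]) auto
  then obtain c' y where y: "c' \<in> {\<one>, c}" "y \<in> Y" "w = c' \<otimes> y" by (rule set_multE)
  moreover have "\<one> \<otimes> y = y" using YG y by auto
  ultimately have y: "y \<in> Y" "w = c \<otimes> y" using w by auto
  have [simp]: "y \<in> carrier G" using y YG by auto
  \<comment> \<open>\<open>c w\<close> can come from \<open>Y\<close> only through the factor 1,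
    since \<open>c w = c v\<close> would put \<open>w\<close> into \<open>Y\<close>. So
    \<open>y\<close>, \<open>w = c y\<close> and \<open>v = c w\<close> form a progression with both
    ends in \<open>Y\<close>.\<close>
  have "c \<otimes> w \<in> {\<one>, c} <#> Y" unfolding Y'(3)[symmetric] using w by (intro set_multI[of c _ w]) auto
  then obtain u v where uv: "u \<in> {\<one>, c}" "v \<in> Y" "c \<otimes> w = u \<otimes> v" by (rule set_multE)
  have [simp]: "v \<in> carrier G" using uv YG by auto
  have "u \<noteq> c" using uv w by auto
  then have v: "c \<otimes> w = v" using uv by auto
  obtain s t where st: "s \<in> {0,2}" "t \<in> {0,2}" "y = mon a b s t" using y Ymem[of y] by blast
  obtain s' t' where st': "s' \<in> {0,2}" "t' \<in> {0,2}" "v = mon a b s' t'" using uv Ymem[of v] by blast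
  have cc: "c = mon a b (i - s) (j - t)"
    using y(2) ij(3) st(3) eq_div_iff[of w y c] mon_div[OF ab, of i j s t] by simp
  have "mon a b (i - s + i) (j - t + j) = mon a b s' t'"
    using v unfolding cc st' ij by (simp add: mon_mult)
  then have "i - s + i = s' \<and> j - t + j = t'" using ij st st' by (intro meq) auto
  then have "i - s \<in> {-1,0,1}" "j - t \<in> {-1,0,1}" using st st' by auto
  then show ?thesis using cc by blast
qed

end

section \<open>Pairs in the power monoid\<close>

text \<open>The carrier of the power monoid of \<open>M\<close>, with \<open>M\<close> a subset of
  an ambient group \<open>G\<close>, so that translates and inverses are at hand.\<close>

definition Pset :: "('a, 'm) monoid_scheme \<Rightarrow> 'a set \<Rightarrow> 'a set set" where
  "Pset G M = {X. finite X \<and> X \<subseteq> M \<and> \<one>\<^bsub>G\<^esub> \<in> X}"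

primrec spow :: "('a, 'm) monoid_scheme \<Rightarrow> 'a set \<Rightarrow> nat \<Rightarrow> 'a set" where
  "spow G X 0 = {\<one>\<^bsub>G\<^esub>}"
| "spow G X (Suc n) = X <#>\<^bsub>G\<^esub> spow G X n"

lemma subset_of_four:
  assumes "Z \<subseteq> {p, q, r, s}" "p \<in> Z" "s \<in> Z"
  shows "Z = {p, s} \<or> Z = {p, q, s} \<or> Z = {p, r, s} \<or> Z = {p, q, r, s}"
proof -
  have "Z = {p, s} \<union> (Z \<inter> {q}) \<union> (Z \<inter> {r})" using assms by auto
  moreover have "Z \<inter> {q} = {} \<or> Z \<inter> {q} = {q}" "Z \<inter> {r} = {} \<or> Z \<inter> {r} = {r}" by auto
  ultimately show ?thesis by (elim disjE) (simp_all add: insert_commute)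
qed

lemma pigeonhole_two: "x = p \<or> x = q \<Longrightarrow> y = p \<or> y = q \<Longrightarrow> z = p \<or> z = q \<Longrightarrow> x = y \<or> x = z \<or> y = z"
  by blast

lemma finite_set_mult: "finite X \<Longrightarrow> finite Y \<Longrightarrow> finite (X <#>\<^bsub>G\<^esub> Y)"
  by (simp add: set_mult_def)

lemma (in comm_group) Pset_mult:
  assumes "submonoid M G" "X \<in> Pset G M" "Y \<in> Pset G M"
  shows "X <#> Y \<in> Pset G M"
proof -
  have "\<one> \<in> X <#> Y" using assms by (intro set_multI[of \<one> _ \<one>]) (auto simp: Pset_def)
  moreover have "X <#> Y \<subseteq> M"
    using assms submonoid.m_closed[OF assms(1)] by (auto simp: Pset_def mem_set_mult_iff subset_eq)
  ultimately show ?thesis using assms finite_set_mult by (auto simp: Pset_def)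
qed

lemma (in comm_group) Pset_spow:
  assumes "submonoid M G" "X \<in> Pset G M"
  shows "spow G X n \<in> Pset G M"
proof (induction n)
  case 0 show ?case using submonoid.one_closed[OF assms(1)] by (auto simp: Pset_def)
next
  case (Suc n) then show ?case using assms by (simp add: Pset_mult)
qed

context comm_group
begin

lemma pair_set_mult: "S \<subseteq> carrier G \<Longrightarrow> x \<in> {\<one>, a} <#> S \<longleftrightarrow> x \<in> S \<or> (\<exists>s\<in>S. x = a \<otimes> s)"
  by (simp add: mem_set_mult_iff) (metis l_one subsetD)

lemma set_mult_pair: "S \<subseteq> carrier G \<Longrightarrow> x \<in> S <#> {\<one>, a} \<longleftrightarrow> x \<in> S \<or> (\<exists>s\<in>S. x = s \<otimes> a)"
  by (simp add: mem_set_mult_iff) (metis r_one subsetD)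

lemma spow_pair:
  assumes [simp]: "a \<in> carrier G"
  shows "spow G {\<one>, a} n = (\<lambda>i. a [^] (i::nat)) ` {..n}"
proof (induction n)
  case 0 show ?case by simp
next
  case (Suc n)
  have sub: "(\<lambda>i. a [^] (i::nat)) ` {..n} \<subseteq> carrier G" by auto
  let ?T = "\<lambda>n. (\<lambda>i. a [^] (i::nat)) ` {..n}"
  have shift: "a \<otimes> a [^] i = a [^] Suc i" for i :: nat by (simp add: m_comm)
  have "{\<one>, a} <#> ?T n = ?T (Suc n)"
  proof (intro equalityI subsetI)
    fix x assume "x \<in> {\<one>, a} <#> ?T n"
    then consider "x \<in> ?T n" | s where "s \<in> ?T n" "x = a \<otimes> s" unfolding pair_set_mult[OF sub] by blast
    then show "x \<in> ?T (Suc n)"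
    proof cases
      case 1 then show ?thesis by auto
    next
      case 2
      then obtain i where "i \<le> n" "x = a [^] Suc i" using shift by auto
      then show ?thesis by (intro image_eqI[of _ _ "Suc i"]) auto
    qed
  next
    fix x assume "x \<in> ?T (Suc n)"
    then obtain i where i: "i \<le> Suc n" "x = a [^] i" by blast
    show "x \<in> {\<one>, a} <#> ?T n"
    proof (cases i)
      case 0
      then have "x \<in> ?T n" using i by blast
      then show ?thesis unfolding pair_set_mult[OF sub] by blast
    next
      case (Suc k)
      then have "x = a \<otimes> a [^] k" "k \<le> n" using i shift by simp_all
      then show ?thesis unfolding pair_set_mult[OF sub] by blast
    qed
  qed
  then show ?case using Suc by simp
qed

text \<open>Both \<open>z\<close> and \<open>z a\<close> are powers of \<open>a\<close> with
  exponent at most 3, so \<open>z\<close> has exponent at most 2, and \<open>a^3\<close> can only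
  come from \<open>a^2\<close>. The element \<open>a\<close> alone remains optional.\<close>

lemma two_solutions:
  assumes a: "a \<in> carrier G" "aperiodic G a" and Z: "Z \<subseteq> carrier G" "\<one> \<in> Z" "Z <#> {\<one>, a} = spow G {\<one>, a} 3"
  shows "Z = {\<one>, a [^] (2::nat)} \<or> Z = {\<one>, a, a [^] (2::nat)}"
proof -
  note inj = aperiodic_nat_pow_eq[OF a(2,1)]
  have S: "x \<in> spow G {\<one>, a} 3 \<longleftrightarrow> (\<exists>i\<le>3. x = a [^] (i::nat))" for x
    using a by (auto simp: spow_pair simp del: nat_pow_Suc)
  have sub: "\<exists>i\<le>2. z = a [^] (i::nat)" if z: "z \<in> Z" for z
  proof -
    have "z \<in> Z <#> {\<one>, a}" "z \<otimes> a \<in> Z <#> {\<one>, a}" using z set_mult_pair[OF Z(1)] by blast+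
    then obtain i j where ij: "i \<le> 3" "z = a [^] (i::nat)" "j \<le> 3" "z \<otimes> a = a [^] (j::nat)"
      unfolding Z S by blast
    then have "a [^] Suc i = a [^] j" by simp
    then have "Suc i = j" by (rule inj)
    then show ?thesis using ij by (intro exI[of _ i]) auto
  qed
  have "a [^] (3::nat) \<in> Z <#> {\<one>, a}" unfolding Z S by blast
  then consider "a [^] (3::nat) \<in> Z" | z where "z \<in> Z" "a [^] (3::nat) = z \<otimes> a"
    using set_mult_pair[OF Z(1)] by blast
  then have a2: "a [^] (2::nat) \<in> Z"
  proof cases
    case 1
    then obtain i where i: "i \<le> 2" "a [^] (3::nat) = a [^] (i::nat)" using sub by blast
    then have "3 = i" by (intro inj)
    then show ?thesis using i by simp
  next
    case 2
    then obtain i where i: "z = a [^] (i::nat)" using sub by blast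
    then have "a [^] (3::nat) = a [^] Suc i" using 2 by simp
    then have "3 = Suc i" by (rule inj)
    then have "i = 2" by simp
    then show ?thesis using 2 i by simp
  qed
  have "z = \<one> \<or> z = a \<or> z = a [^] (2::nat)" if z: "z \<in> Z" for z
  proof -
    obtain i where "i \<le> 2" "z = a [^] (i::nat)" using sub[OF z] by blast
    moreover have "i = 0 \<or> i = 1 \<or> i = 2" using \<open>i \<le> 2\<close> by auto
    ultimately show ?thesis using a by auto
  qed
  then show ?thesis using a2 Z by blast
qed

text \<open>The exponents in \<open>Z\<close> are at most 3, with 0 and 3 forced. The two optional
  inner points give four sets; the second and third are mirror images, which no count of this kind
  separates.\<close>

lemma cubic_solutions:
  assumes a: "a \<in> carrier G" "aperiodic G a"
    and Z: "Z \<subseteq> carrier G" "\<one> \<in> Z" "Z <#> spow G {\<one>, a} 2 = spow G {\<one>, a} 5"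
  shows "Z = {\<one>, a [^] (3::nat)} \<or> Z = cubic G a \<or> Z = {\<one>, a [^] (2::nat), a [^] (3::nat)} \<or>
    Z = spow G {\<one>, a} 3"
proof -
  note inj = aperiodic_nat_pow_eq[OF a(2,1)]
  have S: "x \<in> spow G {\<one>, a} n \<longleftrightarrow> (\<exists>i\<le>n. x = a [^] (i::nat))" for x n
    using a by (auto simp: spow_pair simp del: nat_pow_Suc)
  have sub: "\<exists>i\<le>3. z = a [^] (i::nat)" if z: "z \<in> Z" for z
  proof -
    have "z \<otimes> a [^] (0::nat) \<in> Z <#> spow G {\<one>, a} 2" "z \<otimes> a [^] (2::nat) \<in> Z <#> spow G {\<one>, a} 2"
      using z S by (blast intro: set_multI)+
    then obtain i j
      where ij: "i \<le> 5" "z \<otimes> a [^] (0::nat) = a [^] (i::nat)" "j \<le> 5" "z \<otimes> a [^] (2::nat) = a [^] (j::nat)"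
      unfolding Z S by blast
    have "z = a [^] i" using ij z Z by auto
    then have "a [^] (i + 2) = a [^] j" using ij a by (simp add: nat_pow_mult)
    then have "i + 2 = j" by (rule inj)
    then show ?thesis using ij \<open>z = a [^] i\<close> by (intro exI[of _ i]) auto
  qed
  have "a [^] (5::nat) \<in> Z <#> spow G {\<one>, a} 2" unfolding Z S by blast
  then obtain z s where zs: "z \<in> Z" "s \<in> spow G {\<one>, a} 2" "a [^] (5::nat) = z \<otimes> s" by (rule set_multE)
  obtain i where i: "i \<le> 3" "z = a [^] (i::nat)" using sub zs by blast
  obtain j where j: "j \<le> 2" "s = a [^] (j::nat)" using zs S by blast
  have "a [^] (5::nat) = a [^] (i + j)" using zs i j a by (simp add: nat_pow_mult)
  then have "5 = i + j" by (rule inj)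
  then have "i = 3" using i j by simp
  then have a3: "a [^] (3::nat) \<in> Z" using i zs by simp
  have el: "z = \<one> \<or> z = a \<or> z = a [^] (2::nat) \<or> z = a [^] (3::nat)" if z: "z \<in> Z" for z
  proof -
    obtain i where "i \<le> 3" "z = a [^] (i::nat)" using sub[OF z] by blast
    moreover have "i = 0 \<or> i = 1 \<or> i = 2 \<or> i = 3" using \<open>i \<le> 3\<close> by auto
    ultimately show ?thesis using a by auto
  qed
  have "{..3::nat} = {0,1,2,3}" by auto
  then have "spow G {\<one>, a} 3 = {\<one>, a, a [^] (2::nat), a [^] (3::nat)}" using a by (simp add: spow_pair)
  moreover have "Z \<subseteq> {\<one>, a, a [^] (2::nat), a [^] (3::nat)}" using el by blast
  note subset_of_four[OF this Z(2) a3]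
  ultimately show ?thesis unfolding cubic_def by argo
qed

text \<open>Multiplication by \<open>spow G {\<one>, a} 2\<close> covers three consecutive
  exponents, so the ends 0 and 3 already produce all exponents up to 5.\<close>

lemma cubic_solution:
  assumes a: "a \<in> carrier G"
  shows "cubic G a <#> spow G {\<one>, a} 2 = spow G {\<one>, a} 5" "{\<one>, a [^] (3::nat)} <#> spow G {\<one>, a} 2 = spow G {\<one>, a} 5"
proof -
  have S: "x \<in> spow G {\<one>, a} n \<longleftrightarrow> (\<exists>i\<le>n. x = a [^] (i::nat))" for x n
    using a by (auto simp: spow_pair simp del: nat_pow_Suc)
  have c: "x \<in> cubic G a \<Longrightarrow> \<exists>i\<le>3. x = a [^] (i::nat)" for x
    using a by (auto simp: cubic_def intro: exI[of _ "0::nat"] exI[of _ "1::nat"] exI[of _ "3::nat"])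
  have sub1: "cubic G a <#> spow G {\<one>, a} 2 \<subseteq> spow G {\<one>, a} 5"
  proof
    fix x assume "x \<in> cubic G a <#> spow G {\<one>, a} 2"
    then obtain u v where uv: "u \<in> cubic G a" "v \<in> spow G {\<one>, a} 2" "x = u \<otimes> v" by (rule set_multE)
    obtain i where "i \<le> 3" "u = a [^] (i::nat)" using c uv by blast
    moreover obtain j where "j \<le> 2" "v = a [^] (j::nat)" using S uv by blast
    ultimately have "x = a [^] (i + j)" "i + j \<le> 5" using uv a by (simp_all add: nat_pow_mult)
    then show "x \<in> spow G {\<one>, a} 5" using S by blast
  qed
  have sub2: "spow G {\<one>, a} 5 \<subseteq> {\<one>, a [^] (3::nat)} <#> spow G {\<one>, a} 2"
  proof
    fix x assume "x \<in> spow G {\<one>, a} 5"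
    then obtain i where i: "i \<le> 5" "x = a [^] (i::nat)" using S by blast
    show "x \<in> {\<one>, a [^] (3::nat)} <#> spow G {\<one>, a} 2"
    proof (cases "i \<le> 2")
      case True then show ?thesis using i S a by (intro set_multI[of \<one> _ x]) auto
    next
      case False
      then have "x = a [^] (3::nat) \<otimes> a [^] (i - 3)" "i - 3 \<le> 2" using i a by (simp_all add: nat_pow_mult)
      then show ?thesis using S by (blast intro: set_multI)
    qed
  qed
  have sub3: "{\<one>, a [^] (3::nat)} <#> spow G {\<one>, a} 2 \<subseteq> cubic G a <#> spow G {\<one>, a} 2"
    by (intro mono_set_mult) (auto simp: cubic_def)
  show "cubic G a <#> spow G {\<one>, a} 2 = spow G {\<one>, a} 5" "{\<one>, a [^] (3::nat)} <#> spow G {\<one>, a} 2 = spow G {\<one>, a} 5"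
    using sub1 sub2 sub3 by auto
qed

text \<open>Everything on the right is phrased through products, so that \<open>f\<close> preserves
  it. The bound on the number of solutions excludes two elements \<open>a\<close>, \<open>y\<close>
  other than 1 in \<open>X\<close>: then \<open>X X\<close>, and \<open>X X\<close> without
  \<open>a\<close> or without \<open>y\<close>, would be three solutions. The condition on powers
  excludes \<open>X = {1}\<close> and finite order of \<open>a\<close>.\<close>

lemma pair_iff:
  assumes M: "submonoid M G" and X: "X \<in> Pset G M"
  shows "(\<exists>a\<in>M. aperiodic G a \<and> X = {\<one>, a}) \<longleftrightarrow>
    (\<forall>n. spow G X (Suc n) \<noteq> spow G X n) \<and>
    (\<forall>Z1\<in>Pset G M. \<forall>Z2\<in>Pset G M. \<forall>Z3\<in>Pset G M. Z1 <#> X = spow G X 3 \<longrightarrow> Z2 <#> X = spow G X 3 \<longrightarrow>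
      Z3 <#> X = spow G X 3 \<longrightarrow> Z1 = Z2 \<or> Z1 = Z3 \<or> Z2 = Z3)" (is "?L \<longleftrightarrow> ?R1 \<and> ?R2")
proof
  interpret M: submonoid M G by fact
  assume ?L
  then obtain a where a: "a \<in> M" "aperiodic G a" and Xa: "X = {\<one>, a}" by blast
  have [simp]: "a \<in> carrier G" using a by simp
  show "?R1 \<and> ?R2"
  proof (intro conjI allI ballI impI)
    fix n
    have "a [^] Suc n \<in> spow G X (Suc n)" unfolding Xa
      by (subst spow_pair) (auto intro!: image_eqI[of _ _ "Suc n"])
    moreover have "a [^] Suc n \<notin> spow G X n"
    proof
      assume "a [^] Suc n \<in> spow G X n"
      then obtain i where "i \<le> n" "a [^] Suc n = a [^] (i::nat)"
        unfolding Xa by (subst (asm) spow_pair) auto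
      then show False using aperiodic_nat_pow_eq[of a "Suc n" i] a by auto
    qed
    ultimately show "spow G X (Suc n) \<noteq> spow G X n" by blast
  next
    fix Z1 Z2 Z3 assume Z: "Z1 \<in> Pset G M" "Z2 \<in> Pset G M" "Z3 \<in> Pset G M"
      and "Z1 <#> X = spow G X 3" "Z2 <#> X = spow G X 3" "Z3 <#> X = spow G X 3"
    then have sol: "Z = {\<one>, a [^] (2::nat)} \<or> Z = {\<one>, a, a [^] (2::nat)}" if "Z \<in> {Z1, Z2, Z3}" for Z
      using that a M.subset by (intro two_solutions) (auto simp: Pset_def Xa)
    show "Z1 = Z2 \<or> Z1 = Z3 \<or> Z2 = Z3"
      by (rule pigeonhole_two[OF sol sol sol]) simp_all
  qed
next
  interpret M: submonoid M G by fact
  assume R: "?R1 \<and> ?R2"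
  have XM: "X \<subseteq> M" "\<one> \<in> X" "finite X" using X by (auto simp: Pset_def)
  have XG: "X \<subseteq> carrier G" using XM M.subset by blast
  have "spow G {\<one>} (Suc 0) = spow G {\<one>} 0" by (simp add: set_mult_singletons)
  then have "X \<noteq> {\<one>}" using R by metis
  then obtain a where a: "a \<in> X" "a \<noteq> \<one>" using XM by blast
  have "y = a" if y: "y \<in> X" "y \<noteq> \<one>" for y
  proof (rule ccontr)
    assume "y \<noteq> a"
    have P2: "X <#> X \<in> Pset G M" using M X by (rule Pset_mult[OF _ _ X])
    have sp3: "spow G X 3 = (X <#> X) <#> X"
      using XG by (simp add: numeral_3_eq_3 set_mult_one_right set_mult_assoc)
    have inXX: "x \<in> X <#> X" if "x \<in> X" for x using that XM XG by (intro set_multI[of x _ \<one>]) auto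
    \<comment> \<open>Every product \<open>x v\<close> that used the removed \<open>x\<close> is
      still reached: as \<open>1 x\<close> if \<open>v = 1\<close>, and otherwise as
      \<open>(x v) 1\<close>, where \<open>x v\<close> differs from \<open>x\<close>.\<close>
    have del: "((X <#> X) - {x}) \<in> Pset G M \<and>
      ((X <#> X) - {x}) <#> X = spow G X 3" if x: "x \<in> X" "x \<noteq> \<one>" for x
    proof
      show "((X <#> X) - {x}) \<in> Pset G M" using P2 x by (auto simp: Pset_def)
      show "((X <#> X) - {x}) <#> X = spow G X 3"
      proof
        show "((X <#> X) - {x}) <#> X \<subseteq> spow G X 3" unfolding sp3 by (intro mono_set_mult) auto
        show "spow G X 3 \<subseteq> ((X <#> X) - {x}) <#> X"
        proof
          fix w assume "w \<in> spow G X 3"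
          then obtain u v where uv: "u \<in> X <#> X" "v \<in> X" "w = u \<otimes> v" unfolding sp3 by (rule set_multE)
          show "w \<in> ((X <#> X) - {x}) <#> X"
          proof (cases "u = x")
            case False then show ?thesis using uv by (intro set_multI[of u _ v]) auto
          next
            case True
            show ?thesis
            proof (cases "v = \<one>")
              case True
              then have "w = \<one> \<otimes> x" using uv \<open>u = x\<close> x XG by auto
              then show ?thesis using x inXX XM by (intro set_multI[of \<one> _ x]) auto
            next
              case False
              have "x \<in> carrier G" "v \<in> carrier G" using x uv XG by auto
              then have "x \<otimes> v \<noteq> x" "w = (x \<otimes> v) \<otimes> \<one>" using False uv \<open>u = x\<close> by auto
              moreover have "x \<otimes> v \<in> X <#> X" using x uv by (intro set_multI) auto
              ultimately show ?thesis using XM by (intro set_multI[of "x \<otimes> v" _ \<one>]) auto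
            qed
          qed
        qed
      qed
    qed
    have "X <#> X = (X <#> X) - {a} \<or> X <#> X = (X <#> X) - {y} \<or> (X <#> X) - {a} = (X <#> X) - {y}"
      using R P2 del[OF a] del[OF y] sp3 by blast
    then show False using inXX[OF a(1)] inXX[OF y(1)] \<open>y \<noteq> a\<close> by blast
  qed
  then have Xa: "X = {\<one>, a}" using a XM by blast
  have [simp]: "a \<in> carrier G" using a XG by auto
  have "aperiodic G a"
  proof (rule ccontr)
    assume "\<not> ?thesis"
    then obtain n where "n > 0" and an: "a [^] (n::nat) = \<one>" by (auto simp: aperiodic_def)
    then obtain m where m: "n = Suc m" by (cases n) auto
    have "a [^] (0::nat) \<in> (\<lambda>i. a [^] (i::nat)) ` {..m}" by (rule imageI) simp
    then have "(\<lambda>i. a [^] (i::nat)) ` {..Suc m} = (\<lambda>i. a [^] (i::nat)) ` {..m}"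
      using an m unfolding atMost_Suc image_insert by auto
    then have "spow G X (Suc m) = spow G X m" unfolding Xa spow_pair[OF \<open>a \<in> carrier G\<close>] .
    then show False using R by blast
  qed
  then show ?L using Xa a XM by blast
qed

end

section \<open>Isomorphisms of power monoids\<close>

text \<open>The inverse \<open>f'\<close> is a parameter so that the hypotheses are symmetric in the
  two sides; \<open>swap\<close> then yields each result for \<open>f'\<close> as well.\<close>

locale power_iso = A: comm_group A + B: comm_group B
  for A :: "('a, 'm) monoid_scheme" (structure) and B :: "('b, 'n) monoid_scheme" +
  fixes M N f f'
  assumes subM: "submonoid M A" and subN: "submonoid N B"
    and genM: "fractions A M = carrier A" and genN: "fractions B N = carrier B"
    and exM: "\<exists>e\<in>M. aperiodic A e" and exN: "\<exists>e\<in>N. aperiodic B e"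
    and f_in: "X \<in> Pset A M \<Longrightarrow> f X \<in> Pset B N"
    and f'_in: "Y \<in> Pset B N \<Longrightarrow> f' Y \<in> Pset A M"
    and f'_f: "X \<in> Pset A M \<Longrightarrow> f' (f X) = X"
    and f_f': "Y \<in> Pset B N \<Longrightarrow> f (f' Y) = Y"
    and f_mult: "X \<in> Pset A M \<Longrightarrow> X' \<in> Pset A M \<Longrightarrow> f (X <#> X') = f X <#>\<^bsub>B\<^esub> f X'"
begin

sublocale M: submonoid M A by (rule subM)
sublocale N: submonoid N B by (rule subN)

lemma f'_mult:
  assumes "Y \<in> Pset B N" "Y' \<in> Pset B N"
  shows "f' (Y <#>\<^bsub>B\<^esub> Y') = f' Y <#> f' Y'"
proof -
  have "f' (f (f' Y <#> f' Y')) = f' Y <#> f' Y'"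
    using assms by (intro f'_f A.Pset_mult subM f'_in)
  then show ?thesis using assms by (simp add: f_mult f'_in f_f')
qed

lemma swap: "power_iso B A N M f' f"
  using f_in f'_in f'_f f_f' f'_mult genM genN exM exN subM subN
  by unfold_locales auto

lemma f_inj: "X \<in> Pset A M \<Longrightarrow> X' \<in> Pset A M \<Longrightarrow> f X = f X' \<longleftrightarrow> X = X'"
  using f'_f by metis

lemma Pset_B_carrier: "X \<in> Pset A M \<Longrightarrow> f X \<subseteq> carrier B"
  using f_in[of X] N.subset by (auto simp: Pset_def)

lemma Pset_A_carrier: "X \<in> Pset A M \<Longrightarrow> X \<subseteq> carrier A"
  using M.subset by (auto simp: Pset_def)

lemma one_in_f: "X \<in> Pset A M \<Longrightarrow> \<one>\<^bsub>B\<^esub> \<in> f X"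
  using f_in[of X] by (auto simp: Pset_def)

lemma f_one: "f {\<one>} = {\<one>\<^bsub>B\<^esub>}"
proof -
  have 1: "{\<one>} \<in> Pset A M" "{\<one>\<^bsub>B\<^esub>} \<in> Pset B N" by (simp_all add: Pset_def)
  have "f {\<one>} = f {\<one>} <#>\<^bsub>B\<^esub> {\<one>\<^bsub>B\<^esub>}"
    using Pset_B_carrier[OF 1(1)] by (simp add: B.set_mult_one_right)
  also have "\<dots> = f ({\<one>} <#> f' {\<one>\<^bsub>B\<^esub>})" using 1 by (simp add: f_mult f'_in f_f')
  also have "\<dots> = {\<one>\<^bsub>B\<^esub>}"
    using 1 Pset_A_carrier[OF f'_in[OF 1(2)]] by (simp add: A.set_mult_one_left f_f')
  finally show ?thesis .
qed

lemma f_spow: "X \<in> Pset A M \<Longrightarrow> f (spow A X n) = spow B (f X) n"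
  by (induction n) (simp_all add: f_one f_mult A.Pset_spow subM)

section \<open>The correspondence of pairs and its multiplicative relations\<close>

definition rel :: "'a \<Rightarrow> 'b \<Rightarrow> bool" where
  "rel a b \<longleftrightarrow> a \<in> M \<and> aperiodic A a \<and> b \<in> N \<and> aperiodic B b \<and> f {\<one>, a} = {\<one>\<^bsub>B\<^esub>, b}"

lemma pair_in: "a \<in> M \<Longrightarrow> {\<one>, a} \<in> Pset A M"
  by (simp add: Pset_def)

lemma relD: "rel a b \<Longrightarrow> a \<in> M \<and> a \<in> carrier A \<and> aperiodic A a \<and> b \<in> N \<and> b \<in> carrier B \<and> aperiodic B b"
  by (auto simp: rel_def)

text \<open>The criterion of \<open>pair_iff\<close> is checked for the image by pulling solutions
  back along \<open>f'\<close>.\<close>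

lemma rel_ex:
  assumes a: "a \<in> M" "aperiodic A a"
  shows "\<exists>b. rel a b"
proof -
  interpret S: power_iso B A N M f' f by (rule swap)
  let ?X = "{\<one>, a}"
  have X: "?X \<in> Pset A M" using a by (simp add: pair_in)
  have "\<exists>b\<in>N. aperiodic B b \<and> f ?X = {\<one>\<^bsub>B\<^esub>, b}"
    unfolding B.pair_iff[OF subN f_in[OF X]]
  proof (intro conjI allI ballI impI)
    have X2: "(\<exists>a\<in>M. aperiodic A a \<and> ?X = {\<one>, a})" using a by blast
    note X3 = A.pair_iff[OF subM X, THEN iffD1, OF X2]
    show "spow B (f ?X) (Suc n) \<noteq> spow B (f ?X) n" for n
      unfolding f_spow[OF X, symmetric] f_inj[OF A.Pset_spow[OF subM X] A.Pset_spow[OF subM X]]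
      using X3[THEN conjunct1] by simp
    fix Z1 Z2 Z3 assume Z: "Z1 \<in> Pset B N" "Z2 \<in> Pset B N" "Z3 \<in> Pset B N"
      and *: "Z1 <#>\<^bsub>B\<^esub> f ?X = spow B (f ?X) 3" "Z2 <#>\<^bsub>B\<^esub> f ?X = spow B (f ?X) 3" "Z3 <#>\<^bsub>B\<^esub> f ?X = spow B (f ?X) 3"
    have sol: "f' Z <#> ?X = spow A ?X 3" if "Z \<in> Pset B N" "Z <#>\<^bsub>B\<^esub> f ?X = spow B (f ?X) 3" for Z
    proof -
      have "f' Z <#> ?X = f' (Z <#>\<^bsub>B\<^esub> f ?X)" using S.f_mult[OF that(1) f_in[OF X]] f'_f[OF X] by simp
      also have "\<dots> = spow A ?X 3" unfolding that(2) S.f_spow[OF f_in[OF X]] f'_f[OF X] ..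
      finally show ?thesis .
    qed
    have "f' Z1 = f' Z2 \<or> f' Z1 = f' Z3 \<or> f' Z2 = f' Z3"
      by (rule X3[THEN conjunct2, rule_format, OF f'_in[OF Z(1)] f'_in[OF Z(2)] f'_in[OF Z(3)]])
        (rule sol[OF Z(1) *(1)] sol[OF Z(2) *(2)] sol[OF Z(3) *(3)])+
    then show "Z1 = Z2 \<or> Z1 = Z3 \<or> Z2 = Z3" using S.f_inj Z by blast
  qed
  then show ?thesis using a by (auto simp: rel_def)
qed

lemma pair_eqD: "{p, x} = {p, y} \<Longrightarrow> x = y"
  by (auto simp: doubleton_eq_iff)

lemma rel_right_unique: "rel a b \<Longrightarrow> rel a c \<Longrightarrow> b = c"
  using pair_eqD by (fastforce simp: rel_def)

lemma rel_left_unique: "rel a c \<Longrightarrow> rel b c \<Longrightarrow> a = b"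
  using pair_eqD f_inj pair_in by (metis rel_def)

lemma rel_swap: "power_iso.rel B A N M f' b a \<longleftrightarrow> rel a b"
proof -
  interpret S: power_iso B A N M f' f by (rule swap)
  show ?thesis unfolding rel_def S.rel_def using f'_f f_f' pair_in S.pair_in by metis
qed

text \<open>With \<open>X = {1, a}\<close>, the identity \<open>{1, a^n} X^(n-1) = X^(2n-1)\<close>
  is transferred to \<open>{1, c}\<close> and \<open>{1, b}\<close>. There \<open>c = b^j\<close>
  with \<open>j\<close> at most \<open>n\<close>, as otherwise \<open>c b^(n-1)\<close> leaves the
  range of exponents, and at least \<open>n\<close>, as otherwise the top power is missed.\<close>

lemma rel_pow:
  assumes "rel a b" "n > 0"
  shows "rel (a [^] (n::nat)) (b [^]\<^bsub>B\<^esub> n)"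
proof -
  note ab = relD[OF assms(1)]
  have [simp]: "a \<in> carrier A" "b \<in> carrier B" using ab by auto
  have anM: "a [^] k \<in> M" for k :: nat by (induction k) (use ab in auto)
  have ap: "aperiodic A (a [^] n)" using ab assms(2) by (intro A.aperiodic_pow) auto
  obtain c where c: "rel (a [^] n) c" using rel_ex[OF anM ap] by blast
  have [simp]: "c \<in> carrier B" using relD[OF c] by simp
  have fa: "f {\<one>, a} = {\<one>\<^bsub>B\<^esub>, b}" and fc: "f {\<one>, a [^] n} = {\<one>\<^bsub>B\<^esub>, c}"
    using assms c by (simp_all add: rel_def)
  \<comment> \<open>\<open>n - 1\<close> is the least value for which the blocks of exponents
    \<open>0..m\<close> and \<open>n..n + m\<close> leave no gap.\<close>
  obtain m where m: "n = Suc m" using assms(2) by (cases n) auto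
  let ?X = "{\<one>, a}" let ?X' = "{\<one>\<^bsub>B\<^esub>, b}"
  have eqA: "{\<one>, a [^] n} <#> spow A ?X m = spow A ?X (n + m)"
  proof (intro equalityI subsetI)
    fix x assume "x \<in> {\<one>, a [^] n} <#> spow A ?X m"
    then obtain i where "i \<le> m" "x = a [^] i \<or> x = a [^] (n + i)"
      by (auto simp: A.spow_pair mem_set_mult_iff A.nat_pow_mult)
    then have "x = a [^] i \<and> i \<le> n + m \<or> x = a [^] (n + i) \<and> n + i \<le> n + m" by auto
    then show "x \<in> spow A ?X (n + m)" by (auto simp: A.spow_pair)
  next
    fix x assume "x \<in> spow A ?X (n + m)"
    then obtain i where i: "i \<le> n + m" "x = a [^] i" by (auto simp: A.spow_pair)
    show "x \<in> {\<one>, a [^] n} <#> spow A ?X m"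
    proof (cases "i \<le> m")
      case True
      then show ?thesis using i by (intro set_multI[of "\<one>" _ x]) (auto simp: A.spow_pair)
    next
      case False
      then have "n \<le> i" "i - n \<le> m" using i m by simp_all
      moreover from this have "x = a [^] n \<otimes> a [^] (i - n)" using i by (simp add: A.nat_pow_mult)
      ultimately have "x = a [^] n \<otimes> a [^] (i - n)" "i - n \<le> m" by simp_all
      then show ?thesis by (intro set_multI[of "a [^] n" _ "a [^] (i - n)"]) (auto simp: A.spow_pair)
    qed
  qed
  have "f ({\<one>, a [^] n} <#> spow A ?X m) = {\<one>\<^bsub>B\<^esub>, c} <#>\<^bsub>B\<^esub> spow B ?X' m"
    using ab anM by (simp add: f_mult pair_in A.Pset_spow subM fa fc f_spow)
  moreover have "f (spow A ?X (n + m)) = spow B ?X' (n + m)" using ab by (simp add: f_spow pair_in fa)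
  ultimately have eqB: "{\<one>\<^bsub>B\<^esub>, c} <#>\<^bsub>B\<^esub> spow B ?X' m = spow B ?X' (n + m)" using eqA by simp
  have sB: "x \<in> spow B ?X' k \<longleftrightarrow> (\<exists>i\<le>k. x = b [^]\<^bsub>B\<^esub> i)" for x k
    by (auto simp: B.spow_pair)
  note inj = B.aperiodic_nat_pow_eq[of b]
  have mem: "x \<in> spow B ?X' (n + m)" if "x = u \<otimes>\<^bsub>B\<^esub> v" "u \<in> {\<one>\<^bsub>B\<^esub>, c}" "v \<in> spow B ?X' m" for x u v
    using eqB set_multI[OF that(2,3,1)] by simp
  have "c \<otimes>\<^bsub>B\<^esub> b [^]\<^bsub>B\<^esub> (0::nat) \<in> spow B ?X' (n + m)" by (rule mem[OF refl]) (use sB in blast)+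
  then obtain j where j: "j \<le> n + m" "c = b [^]\<^bsub>B\<^esub> j" using sB by auto
  have "c \<otimes>\<^bsub>B\<^esub> b [^]\<^bsub>B\<^esub> m \<in> spow B ?X' (n + m)" by (rule mem[OF refl]) (use sB in blast)+
  then obtain k where k: "k \<le> n + m" "c \<otimes>\<^bsub>B\<^esub> b [^]\<^bsub>B\<^esub> m = b [^]\<^bsub>B\<^esub> k" using sB by auto
  then have "b [^]\<^bsub>B\<^esub> (j + m) = b [^]\<^bsub>B\<^esub> k" using j by (simp add: B.nat_pow_mult)
  then have "j + m = k" using inj ab by blast
  then have "j \<le> n" using k by simp
  have "b [^]\<^bsub>B\<^esub> (n + m) \<in> {\<one>\<^bsub>B\<^esub>, c} <#>\<^bsub>B\<^esub> spow B ?X' m" unfolding eqB using sB by blast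
  then obtain u v
    where uv: "u \<in> {\<one>\<^bsub>B\<^esub>, c}" "v \<in> spow B ?X' m" "b [^]\<^bsub>B\<^esub> (n + m) = u \<otimes>\<^bsub>B\<^esub> v"
    by (rule set_multE)
  obtain i where i: "i \<le> m" "v = b [^]\<^bsub>B\<^esub> i" using uv sB by blast
  have "n \<le> j"
  proof (cases "u = c")
    case True
    then have "b [^]\<^bsub>B\<^esub> (n + m) = b [^]\<^bsub>B\<^esub> (j + i)" using uv i j by (simp add: B.nat_pow_mult)
    then have "n + m = j + i" using inj ab by blast
    then show ?thesis using i by simp
  next
    case False
    then have "b [^]\<^bsub>B\<^esub> (n + m) = b [^]\<^bsub>B\<^esub> i" using uv i by simp
    then have "n + m = i" using inj ab by blast
    then show ?thesis using i assms(2) by simp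
  qed
  then have "j = n" using \<open>j \<le> n\<close> by simp
  then show ?thesis using c j by simp
qed

text \<open>Both \<open>{1, a^-1}^2 {1, a^2}\<close> and \<open>{1, a}^2 {1, a^-2}\<close> consist
  of the powers of \<open>a\<close> from -2 to 2. If \<open>{1, d}\<close> is the image of
  \<open>{1, a^-1}\<close>, the transferred identity is symmetric in \<open>b\<close> and
  \<open>d\<close> and leaves only \<open>d = b^-1\<close>.\<close>

lemma rel_inv:
  assumes "rel a b" "inv a \<in> M"
  shows "rel (inv a) (inv\<^bsub>B\<^esub> b)"
proof -
  note ab = relD[OF assms(1)]
  have [simp]: "a \<in> carrier A" "b \<in> carrier B" using ab by auto
  let ?a = "inv a"
  obtain d where d: "rel ?a d" using rel_ex[OF assms(2)] ab A.aperiodic_inv by blast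
  note d' = relD[OF d]
  have [simp]: "d \<in> carrier B" using d' by auto
  have fs: "f {\<one>, a} = {\<one>\<^bsub>B\<^esub>, b}" "f {\<one>, ?a} = {\<one>\<^bsub>B\<^esub>, d}"
    "f {\<one>, a [^] (2::nat)} = {\<one>\<^bsub>B\<^esub>, b [^]\<^bsub>B\<^esub> (2::nat)}" "f {\<one>, ?a [^] (2::nat)} = {\<one>\<^bsub>B\<^esub>, d [^]\<^bsub>B\<^esub> (2::nat)}"
    using assms d rel_pow[OF assms(1), of 2] rel_pow[OF d, of 2] by (simp_all add: rel_def)
  have a2M: "a [^] (2::nat) \<in> M" "?a [^] (2::nat) \<in> M"
    using relD[OF rel_pow[OF assms(1), of 2]] relD[OF rel_pow[OF d, of 2]] by auto
  have in2: "{..2::nat} = {0,1,2}" by auto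
  have p2: "a [^] (2::nat) = a \<otimes> a" "?a [^] (2::nat) = ?a \<otimes> ?a" by (simp_all add: numeral_2_eq_2)
  have cx: "a \<otimes> (?a \<otimes> ?a) = ?a" "?a \<otimes> (a \<otimes> a) = a"
    "?a \<otimes> ?a \<otimes> (a \<otimes> a) = \<one>" "a \<otimes> a \<otimes> (?a \<otimes> ?a) = \<one>"
    by (simp_all add: A.m_assoc[symmetric]) (simp_all add: A.m_assoc)
  have "spow A {\<one>, ?a} 2 <#> {\<one>, a [^] (2::nat)} = {\<one>, a, ?a, a \<otimes> a, ?a \<otimes> ?a}"
    unfolding p2 A.spow_pair[OF A.inv_closed, OF \<open>a \<in> carrier A\<close>] in2 by (auto simp: mem_set_mult_iff p2 cx)
  moreover have "spow A {\<one>, a} 2 <#> {\<one>, ?a [^] (2::nat)} = {\<one>, a, ?a, a \<otimes> a, ?a \<otimes> ?a}"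
    unfolding p2 A.spow_pair[OF \<open>a \<in> carrier A\<close>] in2 by (auto simp: mem_set_mult_iff p2 cx)
  ultimately have "f (spow A {\<one>, ?a} 2 <#> {\<one>, a [^] (2::nat)}) = f (spow A {\<one>, a} 2 <#> {\<one>, ?a [^] (2::nat)})" by simp
  then have eq: "spow B {\<one>\<^bsub>B\<^esub>, d} 2 <#>\<^bsub>B\<^esub> {\<one>\<^bsub>B\<^esub>, b [^]\<^bsub>B\<^esub> (2::nat)} = spow B {\<one>\<^bsub>B\<^esub>, b} 2 <#>\<^bsub>B\<^esub> {\<one>\<^bsub>B\<^esub>, d [^]\<^bsub>B\<^esub> (2::nat)}"
    using ab assms(2) a2M by (simp add: f_mult f_spow fs pair_in A.Pset_spow subM)
  define E where "E b d = {\<one>\<^bsub>B\<^esub>, d, d [^]\<^bsub>B\<^esub> (2::nat), b [^]\<^bsub>B\<^esub> (2::nat), d \<otimes>\<^bsub>B\<^esub> b [^]\<^bsub>B\<^esub> (2::nat), d [^]\<^bsub>B\<^esub> (2::nat) \<otimes>\<^bsub>B\<^esub> b [^]\<^bsub>B\<^esub> (2::nat)}" for b d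
  have E: "spow B {\<one>\<^bsub>B\<^esub>, d} 2 <#>\<^bsub>B\<^esub> {\<one>\<^bsub>B\<^esub>, b [^]\<^bsub>B\<^esub> (2::nat)} = E b d" if "b \<in> carrier B" "d \<in> carrier B" for b d
    unfolding B.spow_pair[OF that(2)] in2 E_def using that by (auto simp: mem_set_mult_iff)
  have EE: "E b d = E d b" using eq E by simp
  have "b \<in> E d b" "d \<in> E b d" by (simp_all add: E_def)
  then have b: "b \<in> E b d" and d: "d \<in> E d b" using EE by simp_all
  have sq: "x [^]\<^bsub>B\<^esub> (2::nat) = x \<otimes>\<^bsub>B\<^esub> x" if "x \<in> carrier B" for x
    using that by (simp add: numeral_2_eq_2)
  have "a \<noteq> ?a"
  proof
    assume "a = ?a"
    then have "a [^] (2::nat) = \<one>" unfolding p2 by (metis A.r_inv \<open>a \<in> carrier A\<close>)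
    then show False using ab by (auto simp: aperiodic_def)
  qed
  then have "b \<noteq> d" using assms d rel_left_unique \<open>rel ?a d\<close> by blast
  have ne: "b \<noteq> \<one>\<^bsub>B\<^esub>" "d \<noteq> \<one>\<^bsub>B\<^esub>" using ab d' B.aperiodic_not_one by auto
  have canc: "x = y \<otimes>\<^bsub>B\<^esub> x \<longleftrightarrow> y = \<one>\<^bsub>B\<^esub>" "x = x \<otimes>\<^bsub>B\<^esub> y \<longleftrightarrow> y = \<one>\<^bsub>B\<^esub>"
    if "x \<in> carrier B" "y \<in> carrier B" for x y using that by simp_all
  have key: "b = d \<otimes>\<^bsub>B\<^esub> d \<or> d \<otimes>\<^bsub>B\<^esub> b = \<one>\<^bsub>B\<^esub> \<or> d \<otimes>\<^bsub>B\<^esub> d \<otimes>\<^bsub>B\<^esub> b = \<one>\<^bsub>B\<^esub>"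
    if "b \<in> E b d" "b \<in> carrier B" "d \<in> carrier B" "b \<noteq> \<one>\<^bsub>B\<^esub>" "b \<noteq> d" for b d
  proof -
    have "b = d \<otimes>\<^bsub>B\<^esub> d \<or> b = b \<otimes>\<^bsub>B\<^esub> b \<or> b = (d \<otimes>\<^bsub>B\<^esub> b) \<otimes>\<^bsub>B\<^esub> b \<or>
      b = (d \<otimes>\<^bsub>B\<^esub> d \<otimes>\<^bsub>B\<^esub> b) \<otimes>\<^bsub>B\<^esub> b"
      using that by (simp add: E_def sq B.m_assoc)
    then show ?thesis using that canc by (metis B.m_closed)
  qed
  have p3: "d [^]\<^bsub>B\<^esub> (3::nat) = d \<otimes>\<^bsub>B\<^esub> d \<otimes>\<^bsub>B\<^esub> d" by (simp add: numeral_3_eq_3)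
  have p5: "x [^]\<^bsub>B\<^esub> (5::nat) = (x \<otimes>\<^bsub>B\<^esub> x) \<otimes>\<^bsub>B\<^esub> (x \<otimes>\<^bsub>B\<^esub> x) \<otimes>\<^bsub>B\<^esub> x" if "x \<in> carrier B" for x
    using that by (simp add: eval_nat_numeral B.m_assoc)
  have "d \<otimes>\<^bsub>B\<^esub> b = \<one>\<^bsub>B\<^esub>"
  proof (rule ccontr)
    assume db: "d \<otimes>\<^bsub>B\<^esub> b \<noteq> \<one>\<^bsub>B\<^esub>"
    then have bd: "b \<otimes>\<^bsub>B\<^esub> d \<noteq> \<one>\<^bsub>B\<^esub>" by (simp add: B.m_comm)
    have 1: "b = d \<otimes>\<^bsub>B\<^esub> d \<or> d \<otimes>\<^bsub>B\<^esub> d \<otimes>\<^bsub>B\<^esub> b = \<one>\<^bsub>B\<^esub>"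
      using key[OF b] ne \<open>b \<noteq> d\<close> db by auto
    have 2: "d = b \<otimes>\<^bsub>B\<^esub> b \<or> b \<otimes>\<^bsub>B\<^esub> b \<otimes>\<^bsub>B\<^esub> d = \<one>\<^bsub>B\<^esub>"
      using key[OF d] ne \<open>b \<noteq> d\<close> bd by auto
    have d3: "d [^]\<^bsub>B\<^esub> (3::nat) \<noteq> \<one>\<^bsub>B\<^esub>" and d5: "d [^]\<^bsub>B\<^esub> (5::nat) \<noteq> \<one>\<^bsub>B\<^esub>"
      and b5: "b [^]\<^bsub>B\<^esub> (5::nat) \<noteq> \<one>\<^bsub>B\<^esub>"
      using ab d' by (simp_all add: aperiodic_def)
    \<comment> \<open>The four combinations yield in turn \<open>d^3 = 1\<close>,
      \<open>d^5 = 1\<close>, \<open>b^5 = 1\<close> and \<open>b = d\<close>.\<close>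
    from 1 2 show False
    proof (elim disjE)
      assume "b = d \<otimes>\<^bsub>B\<^esub> d" "d = b \<otimes>\<^bsub>B\<^esub> b"
      then have "d = (d \<otimes>\<^bsub>B\<^esub> d \<otimes>\<^bsub>B\<^esub> d) \<otimes>\<^bsub>B\<^esub> d" by (simp add: B.m_assoc)
      then show False using d3 p3 canc(1)[of d "d \<otimes>\<^bsub>B\<^esub> d \<otimes>\<^bsub>B\<^esub> d"] by simp
    next
      assume "b = d \<otimes>\<^bsub>B\<^esub> d" "b \<otimes>\<^bsub>B\<^esub> b \<otimes>\<^bsub>B\<^esub> d = \<one>\<^bsub>B\<^esub>"
      then show False using d5 p5[of d] by simp
    next
      assume "d \<otimes>\<^bsub>B\<^esub> d \<otimes>\<^bsub>B\<^esub> b = \<one>\<^bsub>B\<^esub>" "d = b \<otimes>\<^bsub>B\<^esub> b"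
      then show False using b5 p5[of b] by simp
    next
      assume "d \<otimes>\<^bsub>B\<^esub> d \<otimes>\<^bsub>B\<^esub> b = \<one>\<^bsub>B\<^esub>" "b \<otimes>\<^bsub>B\<^esub> b \<otimes>\<^bsub>B\<^esub> d = \<one>\<^bsub>B\<^esub>"
      then have "d \<otimes>\<^bsub>B\<^esub> (d \<otimes>\<^bsub>B\<^esub> b) = b \<otimes>\<^bsub>B\<^esub> (d \<otimes>\<^bsub>B\<^esub> b)"
        by (simp add: B.m_assoc B.m_comm[of d b])
      then show False using \<open>b \<noteq> d\<close> by simp
    qed
  qed
  then have "d = inv\<^bsub>B\<^esub> b" using B.inv_equality[of d b] by simp
  then show ?thesis using \<open>rel ?a d\<close> by simp
qed

text \<open>After moving terms, a relation reads \<open>a^m = b^n\<close> or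
  \<open>a^m = b^-n\<close> with positive exponents. In the second case the inverse of
  \<open>b^n\<close> lies in \<open>M\<close>, so \<open>rel_inv\<close> applies.\<close>

lemma rel_mon_one:
  assumes a: "rel a a1" and b: "rel b b1" and one: "A.mon a b i j = \<one>"
  shows "B.mon a1 b1 i j = \<one>\<^bsub>B\<^esub>"
proof -
  have *: "B.mon a1 b1 (int m) j = \<one>\<^bsub>B\<^esub>" if m: "m > 0" and one: "A.mon a b (int m) j = \<one>"
    and j: "j \<noteq> 0" for m :: nat and j
  proof (cases "j < 0")
    case True
    define n where "n = nat (- j)"
    have n: "n > 0" "j = - int n" using True by (auto simp: n_def)
    have "a [^] m \<otimes> inv (b [^] n) = \<one>"
      using one relD[OF b] n by (simp add: A.mon_def int_pow_int A.int_pow_neg)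
    then have "a [^] m = b [^] n" using relD[OF a] relD[OF b] by (simp add: A.div_eq_iff)
    then have "a1 [^]\<^bsub>B\<^esub> m = b1 [^]\<^bsub>B\<^esub> n"
      using rel_right_unique rel_pow[OF a m] rel_pow[OF b n(1)] by simp
    then show ?thesis using relD[OF a] relD[OF b] n by (simp add: B.mon_def int_pow_int B.int_pow_neg)
  next
    case False
    define n where "n = nat j"
    have n: "n > 0" "j = int n" using False j by (auto simp: n_def)
    have "a [^] m \<otimes> b [^] n = \<one>"
      using one n by (simp add: A.mon_def int_pow_int)
    then have e: "inv (b [^] n) = a [^] m" using relD[OF a] relD[OF b] by (intro A.inv_equality) auto
    have "rel (inv (b [^] n)) (inv\<^bsub>B\<^esub> (b1 [^]\<^bsub>B\<^esub> n))"
      using rel_pow[OF a m] by (intro rel_inv rel_pow[OF b n(1)]) (simp add: e relD)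
    then have "a1 [^]\<^bsub>B\<^esub> m = inv\<^bsub>B\<^esub> (b1 [^]\<^bsub>B\<^esub> n)"
      using rel_right_unique rel_pow[OF a m] e by simp
    then show ?thesis using relD[OF a] relD[OF b] n by (simp add: B.mon_def int_pow_int)
  qed
  have ca: "a \<in> carrier A" "b \<in> carrier A" "a1 \<in> carrier B" "b1 \<in> carrier B"
    using relD[OF a] relD[OF b] by auto
  show ?thesis
  proof (cases "i = 0 \<or> j = 0")
    case True
    then have "i = 0 \<and> j = 0"
      using one A.aperiodic_int_pow_one[of a i] A.aperiodic_int_pow_one[of b j] relD[OF a] relD[OF b]
      by (auto simp: A.mon_def)
    then show ?thesis by (simp add: B.mon_one)
  next
    case False
    show ?thesis
    proof (cases "i > 0")
      case True
      then show ?thesis using *[of "nat i" j] one False by simp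
    next
      case neg: False
      have "A.mon a b (int (nat (- i))) (- j) = \<one>" using one neg A.mon_inv[of a b i j] ca by simp
      then have "B.mon a1 b1 (int (nat (- i))) (- j) = \<one>\<^bsub>B\<^esub>"
        using *[of "nat (- i)" "- j"] neg False by simp
      then show ?thesis using B.mon_inv[of a1 b1 "- i" "- j"] ca neg by simp
    qed
  qed
qed

lemma rel_indep:
  assumes a: "rel a a1" and b: "rel b b1" and ind: "A.indep L a b"
  shows "B.indep L a1 b1"
proof -
  interpret S: power_iso B A N M f' f by (rule swap)
  show ?thesis using S.rel_mon_one[of a1 a b1 b] ind a b by (simp add: rel_swap A.indep_def B.indep_def)
qed

text \<open>Of the four sets in \<open>cubic_solutions\<close>, two are already taken:
  \<open>{1, b^3}\<close> is the image of \<open>{1, a^3}\<close>, and the third power of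
  \<open>{1, b}\<close> that of the third power of \<open>{1, a}\<close>. Injectivity leaves the two
  mirror images.\<close>

lemma f_cubic:
  assumes ab: "rel a b"
  shows "f (cubic A a) = cubic B b \<or>
    f (cubic A a) = {\<one>\<^bsub>B\<^esub>, b [^]\<^bsub>B\<^esub> (2::nat), b [^]\<^bsub>B\<^esub> (3::nat)}"
proof -
  note abD = relD[OF ab]
  have anM: "a [^] k \<in> M" for k :: nat by (induction k) (use abD in auto)
  have cub: "cubic A a \<in> Pset A M" using anM abD by (simp add: cubic_def Pset_def)
  have sp: "spow A {\<one>, a} n \<in> Pset A M" for n using abD by (simp add: A.Pset_spow subM pair_in)
  have fa: "f (spow A {\<one>, a} n) = spow B {\<one>\<^bsub>B\<^esub>, b} n" for n
    using abD ab by (simp add: f_spow pair_in rel_def)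
  have f3: "f {\<one>, a [^] (3::nat)} = {\<one>\<^bsub>B\<^esub>, b [^]\<^bsub>B\<^esub> (3::nat)}"
    using rel_pow[OF ab, of 3] by (simp add: rel_def)
  have "f (cubic A a) <#>\<^bsub>B\<^esub> spow B {\<one>\<^bsub>B\<^esub>, b} 2 = spow B {\<one>\<^bsub>B\<^esub>, b} 5"
    using A.cubic_solution(1)[of a] abD f_mult[OF cub sp[of 2]] fa by simp
  then have "f (cubic A a) = {\<one>\<^bsub>B\<^esub>, b [^]\<^bsub>B\<^esub> (3::nat)} \<or> f (cubic A a) = cubic B b \<or>
      f (cubic A a) = {\<one>\<^bsub>B\<^esub>, b [^]\<^bsub>B\<^esub> (2::nat), b [^]\<^bsub>B\<^esub> (3::nat)} \<or> f (cubic A a) = spow B {\<one>\<^bsub>B\<^esub>, b} 3"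
    using abD Pset_B_carrier[OF cub] one_in_f[OF cub] by (intro B.cubic_solutions) auto
  moreover have "f (cubic A a) \<noteq> {\<one>\<^bsub>B\<^esub>, b [^]\<^bsub>B\<^esub> (3::nat)}"
  proof
    assume "f (cubic A a) = {\<one>\<^bsub>B\<^esub>, b [^]\<^bsub>B\<^esub> (3::nat)}"
    then have "cubic A a = {\<one>, a [^] (3::nat)}" using f3 f_inj[OF cub pair_in[OF anM]] by metis
    then have "a = \<one> \<or> a = a [^] (3::nat)" by (auto simp: cubic_def)
    then show False using A.aperiodic_nat_pow_eq[of a 1 3] A.aperiodic_not_one[of a] abD by auto
  qed
  moreover have "f (cubic A a) \<noteq> spow B {\<one>\<^bsub>B\<^esub>, b} 3"
  proof
    assume "f (cubic A a) = spow B {\<one>\<^bsub>B\<^esub>, b} 3"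
    then have "cubic A a = spow A {\<one>, a} 3" using fa f_inj[OF cub sp] by metis
    moreover have "a [^] (2::nat) \<in> spow A {\<one>, a} 3" using abD by (auto simp: A.spow_pair)
    ultimately consider "a [^] (2::nat) = a [^] (0::nat)" | "a [^] (2::nat) = a [^] (1::nat)" | "a [^] (2::nat) = a [^] (3::nat)"
      using abD unfolding cubic_def by auto
    then show False using A.aperiodic_nat_pow_eq[of a 2] abD by cases fastforce+
  qed
  ultimately show ?thesis by blast
qed

end

section \<open>The induced map up to sign\<close>

lemma set_mult_insert_absorb:
  assumes "\<And>d. d \<in> D \<Longrightarrow> d \<otimes>\<^bsub>G\<^esub> w \<in> D <#>\<^bsub>G\<^esub> Y"
  shows "D <#>\<^bsub>G\<^esub> insert w Y = D <#>\<^bsub>G\<^esub> Y"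
proof (intro equalityI subsetI)
  fix x assume "x \<in> D <#>\<^bsub>G\<^esub> insert w Y"
  then obtain d y where "d \<in> D" "y = w \<or> y \<in> Y" "x = d \<otimes>\<^bsub>G\<^esub> y" unfolding mem_set_mult_iff by blast
  then show "x \<in> D <#>\<^bsub>G\<^esub> Y" using assms set_multI by metis
next
  fix x assume "x \<in> D <#>\<^bsub>G\<^esub> Y"
  then show "x \<in> D <#>\<^bsub>G\<^esub> insert w Y" by (auto simp: mem_set_mult_iff)
qed

context comm_group
begin

lemma indepD: "indep L a b \<Longrightarrow> mon a b i j = \<one> \<Longrightarrow> \<bar>i\<bar> \<le> L \<Longrightarrow> \<bar>j\<bar> \<le> L \<Longrightarrow> i = 0 \<and> j = 0"
  by (auto simp: indep_def)

lemma mon_inv_fst: "a \<in> carrier G \<Longrightarrow> b \<in> carrier G \<Longrightarrow> mon (inv a) b i j = mon a b (- i) j"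
  by (simp add: mon_def int_pow_neg int_pow_inv)

lemma mon_inv_snd: "a \<in> carrier G \<Longrightarrow> b \<in> carrier G \<Longrightarrow> mon a (inv b) i j = mon a b i (- j)"
  by (simp add: mon_def int_pow_neg int_pow_inv)

lemma indep_inv_fst: "a \<in> carrier G \<Longrightarrow> b \<in> carrier G \<Longrightarrow> indep L a b \<Longrightarrow> indep L (inv a) b"
  unfolding indep_def by (metis mon_inv_fst abs_minus_cancel neg_equal_0_iff_equal)

lemma indep_inv_snd: "a \<in> carrier G \<Longrightarrow> b \<in> carrier G \<Longrightarrow> indep L a b \<Longrightarrow> indep L a (inv b)"
  unfolding indep_def by (metis mon_inv_snd abs_minus_cancel neg_equal_0_iff_equal)

text \<open>The added point is the centre \<open>(1, 1)\<close> of the square of exponents. It is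
  invisible to \<open>P\<close> because the grid is already filled, and invisible to
  \<open>{1, a b}\<close> because it is the midpoint of the corners \<open>(0, 0)\<close> and
  \<open>(2, 2)\<close>.\<close>

lemma square_hole_exists:
  assumes ab: "a \<in> carrier G" "b \<in> carrier G" and ind: "indep 6 a b"
    and Y: "Y = {\<one>, a [^] (2::nat)} <#> {\<one>, b [^] (2::nat)}" and P: "P = {\<one>, a} <#> {\<one>, b}"
  shows "insert (a \<otimes> b) Y <#> P = Y <#> P" "{\<one>, a \<otimes> b} <#> insert (a \<otimes> b) Y = {\<one>, a \<otimes> b} <#> Y"
    "insert (a \<otimes> b) Y \<noteq> Y"
proof -
  have a2: "a [^] (2::nat) = mon a b 2 0" "b [^] (2::nat) = mon a b 0 2"
    using ab by (simp_all add: mon_def flip: int_pow_int)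
  have c: "a \<otimes> b = mon a b 1 1" using ab by (simp add: mon_def)
  have Pp: "{\<one>, a [^] (2::nat)} = monset a b {(0,0),(2,0)}" "{\<one>, b [^] (2::nat)} = monset a b {(0,0),(0,2)}"
    "{\<one>, a} = monset a b {(0,0),(1,0)}" "{\<one>, b} = monset a b {(0,0),(0,1)}" "{\<one>, a \<otimes> b} = monset a b {(0,0),(1,1)}"
    using ab by (simp_all add: monset_def mon_one mon_fst mon_snd a2 c)
  have Ym: "Y = monset a b {(0,0),(2,0),(0,2),(2,2)}" and Pm: "P = monset a b {(0,0),(1,0),(0,1),(1,1)}"
    unfolding Y P Pp monset_mult[OF ab] by (simp_all add: insert_commute)
  have iY: "insert (a \<otimes> b) Y = monset a b {(1,1),(0,0),(2,0),(0,2),(2,2)}"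
    unfolding Ym c by (simp add: monset_def)
  show "insert (a \<otimes> b) Y <#> P = Y <#> P"
    unfolding iY unfolding Ym Pm monset_mult[OF ab] by (simp add: insert_commute)
  show "{\<one>, a \<otimes> b} <#> insert (a \<otimes> b) Y = {\<one>, a \<otimes> b} <#> Y"
    unfolding iY unfolding Pp Ym monset_mult[OF ab] by (simp add: insert_commute)
  have "a \<otimes> b \<notin> Y" unfolding Ym c mem_monset using mon_eqD[OF ind ab] by force
  then show "insert (a \<otimes> b) Y \<noteq> Y" by auto
qed

text \<open>The instance \<open>Q = cubic G a\<close>, \<open>z = b\<close>, \<open>k = a^2\<close>,
  \<open>k' = a^3\<close> of the rigid equation. The coincidence is \<open>a^3 = k a = k' 1\<close>,
  so the hole is \<open>a^3\<close> in degree 1 of \<open>b\<close>.\<close>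

lemma cubic_hole_exists:
  assumes ab: "a \<in> carrier G" "b \<in> carrier G" and ind: "indep 6 a b"
    and Y: "Y = (cubic G a <#> {\<one>, (a \<otimes> b) [^] (2::nat)}) <#> {\<one>, (a \<otimes> b) [^] (3::nat)}"
  shows "cubic G b <#> insert (a [^] (3::nat) \<otimes> b) Y = cubic G b <#> Y" "a [^] (3::nat) \<otimes> b \<notin> Y"
proof -
  have c: "a \<otimes> b = mon a b 1 1" using ab by (simp add: mon_def)
  have w: "a [^] (3::nat) \<otimes> b = mon a b 3 1" using ab by (simp add: mon_def flip: int_pow_int)
  have a3: "a [^] (3::nat) = mon a b 3 0" "b [^] (3::nat) = mon a b 0 3"
    using ab by (simp_all add: mon_def flip: int_pow_int)
  have Ca: "cubic G a = monset a b {(0,0),(1,0),(3,0)}" and Cb: "cubic G b = monset a b {(0,0),(0,1),(0,3)}"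
    using ab by (simp_all add: cubic_def monset_def mon_one mon_fst mon_snd a3)
  have C2: "{\<one>, (a \<otimes> b) [^] (2::nat)} = monset a b {(0,0),(2,2)}" "{\<one>, (a \<otimes> b) [^] (3::nat)} = monset a b {(0,0),(3,3)}"
    using ab by (simp_all add: c mon_pow_nat monset_def mon_one)
  have Ym: "Y = monset a b {(0,0),(1,0),(3,0),(2,2),(3,2),(5,2),(3,3),(4,3),(6,3),(5,5),(6,5),(8,5)}"
    unfolding Y Ca C2 monset_mult[OF ab] by (simp add: insert_commute)
  have mem: "mon a b i j \<in> cubic G b <#> Y" if "(i, j) = (p + r, q + s)" "(p, q) \<in> {(0,0),(0,1),(0,3)}"
    "(r, s) \<in> {(0,0),(1,0),(3,0),(2,2),(3,2),(5,2),(3,3),(4,3),(6,3),(5,5),(6,5),(8,5)}" for i j p q r s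
    using that unfolding Cb Ym
      by (intro set_multI[of "mon a b p q" _ "mon a b r s"]) (auto simp: mon_mult[OF ab] mem_monset)
  show "cubic G b <#> insert (a [^] (3::nat) \<otimes> b) Y = cubic G b <#> Y"
  proof (rule set_mult_insert_absorb)
    fix d assume "d \<in> cubic G b"
    then consider "d = mon a b 0 0" | "d = mon a b 0 1" | "d = mon a b 0 3"
      unfolding Cb by (auto simp: mem_monset)
    then show "d \<otimes> (a [^] (3::nat) \<otimes> b) \<in> cubic G b <#> Y"
    proof cases
      case 1 then show ?thesis using mem[of 3 1 0 3 1 0] ab by (simp add: w mon_mult)
    next
      case 2 then show ?thesis using mem[of 3 2 0 3 0 2] ab by (simp add: w mon_mult)
    next
      case 3 then show ?thesis using mem[of 3 4 0 3 1 3] ab by (simp add: w mon_mult)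
    qed
  qed
  show "a [^] (3::nat) \<otimes> b \<notin> Y"
    unfolding Ym w mem_monset using mon_eqD[OF ind ab, of 3 1] by fastforce
qed

text \<open>The situation of \<open>cubic_hole_exists\<close> with one sign reversed:
  \<open>k = a^-2\<close> and \<open>k' = a^-3\<close>. Since \<open>{0, 1, 3}\<close> contains no
  \<open>i\<close> for which both \<open>i + 2\<close> and \<open>i + 3\<close> belong to it, there
  is no coincidence and rigidity applies.\<close>

lemma cubic_no_hole:
  assumes ab: "a \<in> carrier G" "b \<in> carrier G" and ind: "indep 12 a b"
    and st[simp]: "s \<in> carrier G" "t \<in> carrier G"
    and Y: "Y = {s} <#> ((cubic G a <#> {\<one>, mon a b (-2) 2}) <#> {\<one>, mon a b (-3) 3})"
    and Y': "Y' \<subseteq> carrier G" "({t} <#> cubic G b) <#> Y' = ({t} <#> cubic G b) <#> Y"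
  shows "Y' = Y"
proof (rule ccontr)
  assume neq: "Y' \<noteq> Y"
  let ?k = "mon a b (-2) 0" let ?k' = "mon a b (-3) 0"
  have m2: "mon a b (-2) 2 = ?k \<otimes> b [^] (2::nat)" "mon a b (-3) 3 = ?k' \<otimes> b [^] (3::nat)"
    using ab by (simp_all add: mon_def flip: int_pow_int)
  have a3: "a [^] (3::nat) = mon a b 3 0"
    using ab by (simp_all add: mon_def flip: int_pow_int)
  have Ca: "cubic G a = monset a b {(0,0),(1,0),(3,0)}"
    using ab by (simp_all add: cubic_def monset_def mon_one mon_fst mon_snd a3)
  have sing: "{mon a b i j} = monset a b {(i, j)}" for i j by (simp add: monset_def)
  have kk: "?k \<otimes> ?k' = mon a b (-5) 0" using ab by (simp add: mon_mult)
  let ?B = "cubic G a \<union> ({?k} <#> cubic G a) \<union> ({?k'} <#> cubic G a) \<union> ({?k \<otimes> ?k'} <#> cubic G a)"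
  have Bm: "\<exists>i\<in>{-5..3}. x = mon a b i 0" if "x \<in> ?B" for x
    using that unfolding kk sing Ca monset_mult[OF ab] by (auto simp: monset_def)
  have "\<exists>p\<in>cubic G a. \<exists>q\<in>cubic G a. \<exists>r\<in>cubic G a. p = ?k \<otimes> q \<and> p = ?k' \<otimes> r"
  proof (rule graded_rigidity_translate[OF _ _ _ _ st refl _ Y[unfolded m2] Y' neq])
    show "cubic G a \<subseteq> carrier G" using ab by (auto simp: cubic_def)
    fix x y i assume "x \<in> ?B" "y \<in> ?B" "0 < i" "i \<le> (12::nat)"
    obtain l m where "l \<in> {-5..3}" "x = mon a b l 0" "m \<in> {-5..3}" "y = mon a b m 0"
      using Bm \<open>x \<in> ?B\<close> \<open>y \<in> ?B\<close> by blast
    moreover from this have "\<bar>l - m\<bar> \<le> 12" by auto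
    moreover have "b [^] i = mon a b 0 (int i)" using ab by (simp add: mon_def int_pow_int)
    ultimately show "x \<otimes> b [^] i \<noteq> y"
      using mon_eqD[OF ind ab, of l "int i" m 0] ab \<open>0 < i\<close> \<open>i \<le> 12\<close> by (auto simp: mon_mult)
  qed (use ab in simp_all)
  then obtain p q r where "p \<in> cubic G a" "q \<in> cubic G a" "r \<in> cubic G a" and e: "p = ?k \<otimes> q" "p = ?k' \<otimes> r"
    by blast
  then obtain i j l
    where "i \<in> {0,1,3}" "j \<in> {0,1,3}" "l \<in> {0,1,3}" "p = mon a b i 0" "q = mon a b j 0" "r = mon a b l 0"
    unfolding Ca mem_monset by blast
  \<comment> \<open>In exponents, \<open>i = j - 2 = l - 3\<close> with all three in
    \<open>{0, 1, 3}\<close>; the first equation forces \<open>i = 1\<close>, the second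
    \<open>i = 0\<close>.\<close>
  then show False using e mon_eqD[OF ind ab, of i 0 "j - 2" 0] mon_eqD[OF ind ab, of i 0 "l - 3" 0] ab
    by (auto simp: mon_mult)
qed

end

context power_iso
begin

section \<open>Images of aperiodic elements and their signs\<close>

definition img :: "'a \<Rightarrow> 'b" where
  "img a = (THE b. rel a b)"

text \<open>The sign records whether \<open>f\<close> preserves or reverses the orientation of \<open>{1, a, a\<^sup>3}\<close>.\<close>
definition psi :: "'a \<Rightarrow> 'b" where
  "psi a = (if f (cubic A a) = cubic B (img a) then img a else inv\<^bsub>B\<^esub> (img a))"

lemma img_eq: "rel a b \<Longrightarrow> img a = b"
  unfolding img_def using rel_right_unique by blast

lemma rel_img: "a \<in> M \<Longrightarrow> aperiodic A a \<Longrightarrow> rel a (img a)"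
  using rel_ex img_eq by metis

lemma psi_cases: "rel a b \<Longrightarrow> psi a = b \<or> psi a = inv\<^bsub>B\<^esub> b"
  by (auto simp: psi_def img_eq)

lemma psi_closed [simp]: "a \<in> M \<Longrightarrow> aperiodic A a \<Longrightarrow> psi a \<in> carrier B"
  using psi_cases[OF rel_img] relD[OF rel_img] by fastforce

lemma psi_aperiodic: "a \<in> M \<Longrightarrow> aperiodic A a \<Longrightarrow> aperiodic B (psi a)"
  using psi_cases[OF rel_img] relD[OF rel_img] B.aperiodic_inv by metis

lemma pair_translate:
  assumes "c \<in> carrier B"
  shows "{\<one>\<^bsub>B\<^esub>, c} = {c} <#>\<^bsub>B\<^esub> {\<one>\<^bsub>B\<^esub>, inv\<^bsub>B\<^esub> c}"
  using assms by (auto simp: mem_set_mult_iff)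

lemma pair_translate_ex:
  assumes "c \<in> carrier B" "d = c \<or> d = inv\<^bsub>B\<^esub> c"
  shows "\<exists>t\<in>carrier B. {\<one>\<^bsub>B\<^esub>, c} = {t} <#>\<^bsub>B\<^esub> {\<one>\<^bsub>B\<^esub>, d}"
  using assms pair_translate[OF assms(1)] B.set_mult_one_left[of "{\<one>\<^bsub>B\<^esub>, c}"]
  by (metis B.one_closed empty_subsetI insert_subset)

lemma f_pair_psi: "rel a b \<Longrightarrow> \<exists>t\<in>carrier B. f {\<one>, a} = {t} <#>\<^bsub>B\<^esub> {\<one>\<^bsub>B\<^esub>, psi a}"
proof -
  assume ab: "rel a b"
  then have "b \<in> carrier B" "f {\<one>, a} = {\<one>\<^bsub>B\<^esub>, b}" using relD[OF ab] by (auto simp: rel_def)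
  then show ?thesis using pair_translate_ex psi_cases[OF ab] by metis
qed

text \<open>The reflected set \<open>{1, b^2, b^3}\<close> equals \<open>b^3\<close> times the cubic
  set of \<open>b^-1\<close>, so the choice of sign in \<open>psi\<close> removes the distinction of
  cases at the price of a translation.\<close>

lemma f_cubic_psi:
  assumes ab: "rel a b"
  shows "\<exists>t\<in>carrier B. f (cubic A a) = {t} <#>\<^bsub>B\<^esub> cubic B (psi a)"
proof (cases "f (cubic A a) = cubic B b")
  case True
  then have "f (cubic A a) = {\<one>\<^bsub>B\<^esub>} <#>\<^bsub>B\<^esub> cubic B (psi a)"
    using relD[OF ab] by (subst B.set_mult_one_left) (auto simp: psi_def img_eq[OF ab] cubic_def)
  then show ?thesis by blast
next
  case False
  have [simp]: "b \<in> carrier B" using relD[OF ab] by simp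
  have "f (cubic A a) = {\<one>\<^bsub>B\<^esub>, b [^]\<^bsub>B\<^esub> (2::nat), b [^]\<^bsub>B\<^esub> (3::nat)}"
    using f_cubic[OF ab] False by simp
  moreover have "psi a = inv\<^bsub>B\<^esub> b" using False by (simp add: psi_def img_eq[OF ab])
  moreover have "b [^]\<^bsub>B\<^esub> (3::nat) \<otimes>\<^bsub>B\<^esub> inv\<^bsub>B\<^esub> b = b [^]\<^bsub>B\<^esub> (2::nat)"
    by (simp add: B.div_eq_iff numeral_3_eq_3 numeral_2_eq_2)
  moreover have "{t} <#>\<^bsub>B\<^esub> {p, q, r} = {t \<otimes>\<^bsub>B\<^esub> p, t \<otimes>\<^bsub>B\<^esub> q, t \<otimes>\<^bsub>B\<^esub> r}" for t p q r
    by (auto simp: mem_set_mult_iff)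
  moreover have "b [^]\<^bsub>B\<^esub> (3::nat) \<otimes>\<^bsub>B\<^esub> (inv\<^bsub>B\<^esub> b) [^]\<^bsub>B\<^esub> (3::nat) = \<one>\<^bsub>B\<^esub>" 
    unfolding B.nat_pow_inv[OF \<open>b \<in> carrier B\<close>] by (simp only: B.r_inv B.nat_pow_closed \<open>b \<in> carrier B\<close>)
  ultimately have "f (cubic A a) = {b [^]\<^bsub>B\<^esub> (3::nat)} <#>\<^bsub>B\<^esub> cubic B (psi a)"
    by (simp only: cubic_def B.r_one B.nat_pow_closed \<open>b \<in> carrier B\<close>) (simp only: insert_commute)
  then show ?thesis by (metis B.nat_pow_closed \<open>b \<in> carrier B\<close>)
qed

lemma powM: "a \<in> M \<Longrightarrow> a [^] (k::nat) \<in> M"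
  by (induction k) auto

lemma cubic_in: "a \<in> M \<Longrightarrow> cubic A a \<in> Pset A M"
  using powM[of a 3] by (simp add: cubic_def Pset_def)

lemma insert_in: "X \<in> Pset A M \<Longrightarrow> w \<in> M \<Longrightarrow> insert w X \<in> Pset A M"
  by (simp add: Pset_def)

text \<open>The hole in the square confines \<open>c1\<close> to monomials with exponents -1, 0, 1;
  pulling relations back excludes the exponent 0; the cubic equation excludes opposite signs. The
  common sign stays open because \<open>a \<otimes> b\<close> enters these equations only through
  pairs.\<close>

lemma psi_mult_up_to_inv:
  assumes a: "rel a a1" and b: "rel b b1" and c: "rel (a \<otimes> b) c1" and ind: "A.indep 12 a b"
  shows "c1 = psi a \<otimes>\<^bsub>B\<^esub> psi b \<or> c1 = inv\<^bsub>B\<^esub> (psi a \<otimes>\<^bsub>B\<^esub> psi b)"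
proof -
  note D = relD[OF a] relD[OF b] relD[OF c]
  have [simp]: "a \<in> carrier A" "b \<in> carrier A" "a1 \<in> carrier B" "b1 \<in> carrier B" "c1 \<in> carrier B" "a \<in> M" "b \<in> M" using D by auto
  let ?c = "a \<otimes> b"
  have ind6: "A.indep 6 a b" using A.indep_mono[OF ind, of 6] by simp
  have ind1: "B.indep 12 a1 b1" using rel_indep[OF a b ind] .
  have ind16: "B.indep 6 a1 b1" using B.indep_mono[OF ind1, of 6] by simp
  define Y where "Y = {\<one>, a [^] (2::nat)} <#> {\<one>, b [^] (2::nat)}"
  define P where "P = {\<one>, a} <#> {\<one>, b}"
  note hole = A.square_hole_exists[OF _ _ ind6 Y_def P_def, simplified]
  have YP: "Y \<in> Pset A M" "P \<in> Pset A M"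
    unfolding Y_def P_def by (intro A.Pset_mult subM pair_in powM; simp)+
  have iY: "insert ?c Y \<in> Pset A M" using YP by (intro insert_in) auto
  have fY: "f Y = {\<one>\<^bsub>B\<^esub>, a1 [^]\<^bsub>B\<^esub> (2::nat)} <#>\<^bsub>B\<^esub> {\<one>\<^bsub>B\<^esub>, b1 [^]\<^bsub>B\<^esub> (2::nat)}" "f P = {\<one>\<^bsub>B\<^esub>, a1} <#>\<^bsub>B\<^esub> {\<one>\<^bsub>B\<^esub>, b1}"
    using a b rel_pow[OF a, of 2] rel_pow[OF b, of 2]
    unfolding Y_def P_def by (simp_all add: f_mult pair_in powM rel_def)
  have "\<exists>k\<in>{-1,0,1}. \<exists>l\<in>{-1,0,1}. c1 = B.mon a1 b1 k l"
  proof (rule B.square_hole[OF _ _ _ ind16 fY])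
    show "f (insert ?c Y) \<subseteq> carrier B" using Pset_B_carrier iY by simp
    show "f (insert ?c Y) <#>\<^bsub>B\<^esub> f P = f Y <#>\<^bsub>B\<^esub> f P" using hole(1) f_mult iY YP by metis
    show "{\<one>\<^bsub>B\<^esub>, c1} <#>\<^bsub>B\<^esub> f (insert ?c Y) = {\<one>\<^bsub>B\<^esub>, c1} <#>\<^bsub>B\<^esub> f Y"
      using hole(2) f_mult[OF pair_in iY, of ?c] f_mult[OF pair_in YP(1), of ?c] c D by (simp add: rel_def)
    show "f (insert ?c Y) \<noteq> f Y" using hole(3) f_inj[OF iY YP(1)] by simp
  qed simp_all
  then obtain k l where kl: "k \<in> {-1,0,1}" "l \<in> {-1,0,1}" and c1: "c1 = B.mon a1 b1 k l" by blast
  interpret S: power_iso B A N M f' f by (rule swap)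
  note one' = S.rel_mon_one[unfolded rel_swap]
  \<comment> \<open>Otherwise \<open>c1\<close> would be a power of \<open>a1\<close>, and this
    relation would pull back to \<open>a^(1-k) b = 1\<close>.\<close>
  have "l \<noteq> 0"
  proof
    assume "l = 0"
    then have "c1 = a1 [^]\<^bsub>B\<^esub> k" by (simp add: c1 B.mon_def)
    then have "B.mon c1 a1 1 (- k) = \<one>\<^bsub>B\<^esub>" by (simp add: B.mon_def B.int_pow_neg)
    then have "A.mon ?c a 1 (- k) = \<one>" by (rule one'[OF c a])
    then have "A.mon a b (1 - k) 1 = \<one>" using A.mon_mult[of a b 1 1 "- k" 0] by (simp add: A.mon_def)
    then show False using A.indepD[OF ind, of "1 - k" 1] kl by auto
  qed
  moreover have "k \<noteq> 0"
  proof
    assume "k = 0"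
    then have "c1 = b1 [^]\<^bsub>B\<^esub> l" by (simp add: c1 B.mon_def)
    then have "B.mon c1 b1 1 (- l) = \<one>\<^bsub>B\<^esub>" by (simp add: B.mon_def B.int_pow_neg)
    then have "A.mon ?c b 1 (- l) = \<one>" by (rule one'[OF c b])
    then have "A.mon a b 1 (1 - l) = \<one>" using A.mon_mult[of a b 1 1 0 "- l"] by (simp add: A.mon_def)
    then show False using A.indepD[OF ind, of 1 "1 - l"] kl by auto
  qed
  ultimately have kl: "k \<in> {-1,1}" "l \<in> {-1,1}" using kl by auto
  define x where "x = psi a" define y where "y = psi b"
  have x: "x = a1 \<or> x = inv\<^bsub>B\<^esub> a1" and y: "y = b1 \<or> y = inv\<^bsub>B\<^esub> b1"
    using psi_cases a b by (simp_all add: x_def y_def)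
  have xy[simp]: "x \<in> carrier B" "y \<in> carrier B" using x y by auto
  have indxy: "B.indep 12 x y" using x y ind1 B.indep_inv_fst B.indep_inv_snd
    by (metis \<open>a1 \<in> carrier B\<close> \<open>b1 \<in> carrier B\<close> B.inv_closed)
  have "\<exists>k\<in>{-1,1}. \<exists>l\<in>{-1,1}. c1 = B.mon x y k l"
    using x y kl unfolding c1 by (elim disjE) (auto simp: B.mon_inv_fst B.mon_inv_snd)
  then obtain k l where kl: "k \<in> {-1,1}" "l \<in> {-1,1}" and c1: "c1 = B.mon x y k l" by blast
  \<comment> \<open>With opposite signs, \<open>c1\<close> is \<open>x^-1 y\<close> up to inversion,
    so the pairs of \<open>c1^2\<close> and \<open>c1^3\<close> are translates of those in
    \<open>cubic_no_hole\<close>. On the side of \<open>A\<close> the same equation has a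
    hole.\<close>
  have "k = l"
  proof (rule ccontr)
    assume "k \<noteq> l"
    then have cc: "B.mon x y (-1) 1 = c1 \<or> B.mon x y (-1) 1 = inv\<^bsub>B\<^esub> c1"
      using kl by (auto simp: c1 B.mon_inv)
    have c2: "B.mon x y (-2) 2 = c1 [^]\<^bsub>B\<^esub> (2::nat) \<or>
      B.mon x y (-2) 2 = inv\<^bsub>B\<^esub> (c1 [^]\<^bsub>B\<^esub> (2::nat))"
      "B.mon x y (-3) 3 = c1 [^]\<^bsub>B\<^esub> (3::nat) \<or>
        B.mon x y (-3) 3 = inv\<^bsub>B\<^esub> (c1 [^]\<^bsub>B\<^esub> (3::nat))"
      using cc B.mon_pow_nat[of x y "-1" 1 2] B.mon_pow_nat[of x y "-1" 1 3] by (auto simp: B.nat_pow_inv)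
    obtain u where u: "u \<in> carrier B" "{\<one>\<^bsub>B\<^esub>, c1 [^]\<^bsub>B\<^esub> (2::nat)} = {u} <#>\<^bsub>B\<^esub> {\<one>\<^bsub>B\<^esub>, B.mon x y (-2) 2}"
      using pair_translate_ex[OF _ c2(1)] by auto
    obtain v where v: "v \<in> carrier B" "{\<one>\<^bsub>B\<^esub>, c1 [^]\<^bsub>B\<^esub> (3::nat)} = {v} <#>\<^bsub>B\<^esub> {\<one>\<^bsub>B\<^esub>, B.mon x y (-3) 3}"
      using pair_translate_ex[OF _ c2(2)] by auto
    obtain s where s: "s \<in> carrier B" "f (cubic A a) = {s} <#>\<^bsub>B\<^esub> cubic B x"
      using f_cubic_psi[OF a] x_def by auto
    obtain t where t: "t \<in> carrier B" "f (cubic A b) = {t} <#>\<^bsub>B\<^esub> cubic B y"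
      using f_cubic_psi[OF b] y_def by auto
    define W where "W = (cubic A a <#> {\<one>, ?c [^] (2::nat)}) <#> {\<one>, ?c [^] (3::nat)}"
    define w where "w = a [^] (3::nat) \<otimes> b"
    note hole = A.cubic_hole_exists[OF _ _ ind6 W_def, simplified, folded w_def]
    have W1: "W \<in> Pset A M" unfolding W_def by (intro A.Pset_mult subM pair_in cubic_in powM; simp)
    have W2: "insert w W \<in> Pset A M" using W1 by (intro insert_in) (auto simp: w_def powM)
    have cx: "cubic B x \<subseteq> carrier B" by (simp add: cubic_def)
    have "f W = (({s} <#>\<^bsub>B\<^esub> cubic B x) <#>\<^bsub>B\<^esub> ({u} <#>\<^bsub>B\<^esub> {\<one>\<^bsub>B\<^esub>, B.mon x y (-2) 2})) <#>\<^bsub>B\<^esub> ({v} <#>\<^bsub>B\<^esub> {\<one>\<^bsub>B\<^esub>, B.mon x y (-3) 3})"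
      using rel_pow[OF c, of 2] rel_pow[OF c, of 3]
        unfolding W_def u(2)[symmetric] v(2)[symmetric] s(2)[symmetric]
      by (simp add: f_mult A.Pset_mult subM pair_in powM cubic_in rel_def)
    also have "\<dots> = {s \<otimes>\<^bsub>B\<^esub> u \<otimes>\<^bsub>B\<^esub> v} <#>\<^bsub>B\<^esub> ((cubic B x <#>\<^bsub>B\<^esub> {\<one>\<^bsub>B\<^esub>, B.mon x y (-2) 2}) <#>\<^bsub>B\<^esub> {\<one>\<^bsub>B\<^esub>, B.mon x y (-3) 3})"
      using s u v cx by (simp add: B.set_mult_ac B.setmult_subset_G flip: B.set_mult_singletons)
    finally have fW: "f W = \<dots>" .
    have "f (insert w W) = f W"
    proof (rule B.cubic_no_hole[OF xy indxy _ t(1) fW])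
      show "f (insert w W) \<subseteq> carrier B" using Pset_B_carrier W2 by simp
      show "({t} <#>\<^bsub>B\<^esub> cubic B y) <#>\<^bsub>B\<^esub> f (insert w W) = ({t} <#>\<^bsub>B\<^esub> cubic B y) <#>\<^bsub>B\<^esub> f W"
        unfolding t(2)[symmetric]
          using hole(1) f_mult[OF cubic_in W2, of b] f_mult[OF cubic_in W1, of b] by simp
    qed (use s u v in simp)
    then show False using hole(2) f_inj[OF W2 W1] by auto
  qed
  then show ?thesis
    using kl c1 by (auto simp: x_def[symmetric] y_def[symmetric] B.mon_def B.int_pow_neg B.inv_mult)
qed

end

section \<open>The induced isomorphism of quotient groups\<close>

text \<open>Each basic genericity condition below fails for at most one exponent \<open>n\<close>.
  Stated as eventual truth, finitely many of them can be met simultaneously.\<close>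

lemma eventually_of_at_most_one_failure:
  assumes "\<And>m n :: nat. \<not> P m \<Longrightarrow> \<not> P n \<Longrightarrow> m = n"
  shows "eventually P sequentially"
proof (cases "\<exists>m. \<not> P m")
  case True
  then obtain m where "\<not> P m" by blast
  then have "P n" if "n > m" for n using assms that by blast
  then show ?thesis unfolding eventually_sequentially by (meson Suc_le_eq)
next
  case False
  then show ?thesis by (intro always_eventually) blast
qed

context comm_group
begin

lemma eventually_pow_neq_one:
  assumes e: "e \<in> carrier G" "aperiodic G e" and x: "x \<in> carrier G" and k: "k \<noteq> 0"
  shows "eventually (\<lambda>n. x \<otimes> (e [^] (n::nat)) [^] (k::int) \<noteq> \<one>) sequentially"
proof (rule eventually_of_at_most_one_failure)
  fix m n :: nat
  have p: "(e [^] n) [^] k = e [^] (int n * k)" for n :: nat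
    using e by (simp add: int_pow_pow flip: int_pow_int)
  assume "\<not> x \<otimes> (e [^] m) [^] k \<noteq> \<one>" "\<not> x \<otimes> (e [^] n) [^] k \<noteq> \<one>"
  then have "x \<otimes> e [^] (int m * k) = x \<otimes> e [^] (int n * k)" using p by simp
  then have "e [^] (int m * k) = e [^] (int n * k)" using e x by simp
  then have "e [^] (int m * k - int n * k) = \<one>" using e by (simp add: int_pow_diff)
  then have "int m * k - int n * k = 0" by (rule aperiodic_int_pow_one[OF e(2,1)])
  then show "m = n" using k by simp
qed

text \<open>If \<open>x e^m\<close> and \<open>x e^n\<close> both have finite order, a common
  exponent kills both; cancelling the power of \<open>x\<close> leaves an equation between powers of
  \<open>e\<close>, which forces \<open>m = n\<close>.\<close>

lemma eventually_aperiodic: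
  assumes e: "e \<in> carrier G" "aperiodic G e" and x: "x \<in> carrier G"
  shows "eventually (\<lambda>n. aperiodic G (x \<otimes> e [^] (n::nat))) sequentially"
proof (rule eventually_of_at_most_one_failure)
  fix m n :: nat
  assume "\<not> aperiodic G (x \<otimes> e [^] m)" "\<not> aperiodic G (x \<otimes> e [^] n)"
  then obtain i j
    where ij: "i > 0" "j > 0" "(x \<otimes> e [^] m) [^] (i::nat) = \<one>" "(x \<otimes> e [^] n) [^] (j::nat) = \<one>"
    by (auto simp: aperiodic_def)
  have "(x \<otimes> e [^] m) [^] (i * j) = (x \<otimes> e [^] n) [^] (i * j)"
  proof -
    have "(x \<otimes> e [^] m) [^] (i * j) = \<one>"
      using e x ij nat_pow_pow[of "x \<otimes> e [^] m" i j] by (metis m_closed nat_pow_closed nat_pow_one)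
    moreover have "(x \<otimes> e [^] n) [^] (i * j) = \<one>"
      using e x ij nat_pow_pow[of "x \<otimes> e [^] n" j i]
        by (metis m_closed nat_pow_closed nat_pow_one mult.commute)
    ultimately show ?thesis by simp
  qed
  then have "x [^] (i * j) \<otimes> e [^] (m * (i * j)) = x [^] (i * j) \<otimes> e [^] (n * (i * j))"
    using e x by (simp add: nat_pow_distrib nat_pow_pow)
  then have "e [^] (m * (i * j)) = e [^] (n * (i * j))" using e x by simp
  then have "m * (i * j) = n * (i * j)" by (rule aperiodic_nat_pow_eq[OF e(2,1)])
  then show "m = n" using ij by simp
qed

text \<open>Exponents \<open>j\<close> other than 0 give finitely many conditions on
  \<open>n\<close>; for \<open>j = 0\<close> the relation is \<open>a^i = 1\<close>, which the
  aperiodicity of \<open>a\<close> settles.\<close>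

lemma eventually_indep:
  assumes e: "e \<in> carrier G" "aperiodic G e" and x: "x \<in> carrier G" and a: "a \<in> carrier G" "aperiodic G a"
  shows "eventually (\<lambda>n. indep L a (x \<otimes> e [^] (n::nat))) sequentially"
proof -
  have "eventually (\<lambda>n. \<forall>i\<in>{-L..L}. \<forall>j\<in>{-L..L} - {0}. mon a x i j \<otimes> (e [^] (n::nat)) [^] j \<noteq> \<one>) sequentially"
    using e x a by (intro eventually_ball_finite ballI eventually_pow_neq_one) auto
  then show ?thesis
  proof (rule eventually_mono)
    fix n :: nat assume n: "\<forall>i\<in>{-L..L}. \<forall>j\<in>{-L..L} - {0}. mon a x i j \<otimes> (e [^] n) [^] j \<noteq> \<one>"
    show "indep L a (x \<otimes> e [^] n)"
      unfolding indep_def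
    proof (intro allI impI)
      fix i j assume ij: "\<bar>i\<bar> \<le> L" "\<bar>j\<bar> \<le> L" and one: "mon a (x \<otimes> e [^] n) i j = \<one>"
      have "mon a (x \<otimes> e [^] n) i j = mon a x i j \<otimes> (e [^] n) [^] j"
        using e x a by (simp add: mon_def int_pow_distrib m_assoc)
      then have "j = 0" using n one ij by force
      then show "i = 0 \<and> j = 0" using one a aperiodic_int_pow_one[of a i] by (simp add: mon_def)
    qed
  qed
qed

lemma eventually_separated:
  assumes e: "e \<in> carrier G" "aperiodic G e" and c: "c \<in> carrier G" and S: "finite S" "S \<subseteq> carrier G"
  shows "eventually (\<lambda>n. \<forall>b\<in>S. \<forall>b'\<in>S. \<forall>i\<in>{1..12::nat}. b \<otimes> (c \<otimes> e [^] (n::nat)) [^] i \<noteq> b') sequentially"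
proof (intro eventually_ball_finite ballI S)
  fix b b' i assume b: "b \<in> S" "b' \<in> S" and i: "i \<in> {1..12::nat}"
  have [simp]: "b \<in> carrier G" "b' \<in> carrier G" "c \<in> carrier G" "e \<in> carrier G" using b S c e by auto
  have "eventually (\<lambda>n. (b \<otimes> c [^] i \<otimes> inv b') \<otimes> (e [^] (n::nat)) [^] int i \<noteq> \<one>) sequentially"
    using i e by (intro eventually_pow_neq_one) auto
  then show "eventually (\<lambda>n. b \<otimes> (c \<otimes> e [^] (n::nat)) [^] i \<noteq> b') sequentially"
  proof (rule eventually_mono)
    fix n :: nat assume ne: "(b \<otimes> c [^] i \<otimes> inv b') \<otimes> (e [^] n) [^] int i \<noteq> \<one>"
    show "b \<otimes> (c \<otimes> e [^] n) [^] i \<noteq> b'"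
    proof
      assume eq: "b \<otimes> (c \<otimes> e [^] n) [^] i = b'"
      have "(b \<otimes> c [^] i \<otimes> inv b') \<otimes> (e [^] n) [^] int i = (b \<otimes> (c \<otimes> e [^] n) [^] i) \<otimes> inv b'"
        by (simp add: int_pow_int nat_pow_distrib m_ac)
      then show False using ne eq by simp
    qed
  qed
qed simp_all

end

context power_iso
begin

definition Minf :: "'a set" where
  "Minf = {a \<in> M. aperiodic A a}"

lemma MinfD [simp]: "a \<in> Minf \<Longrightarrow> a \<in> M" "a \<in> Minf \<Longrightarrow> aperiodic A a" "a \<in> Minf \<Longrightarrow> a \<in> carrier A"
  by (auto simp: Minf_def)

text \<open>The open sign is settled by factoring \<open>a^2 b\<close> as \<open>a (a b)\<close> and
  as \<open>(a^2) b\<close>. With \<open>x = psi a\<close> and \<open>y = psi b\<close>, a wrong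
  sign at \<open>a b\<close> makes its image \<open>y\<close> up to inversion by the first
  factorization, but \<open>x^2 y\<close> or \<open>x^-2 y\<close> up to inversion by the
  second.\<close>

lemma psi_mult_indep:
  assumes a: "a \<in> Minf" and b: "b \<in> Minf" and c: "a \<otimes> b \<in> Minf" and d: "a \<otimes> (a \<otimes> b) \<in> Minf"
    and ind: "A.indep 24 a b"
  shows "psi (a \<otimes> b) = psi a \<otimes>\<^bsub>B\<^esub> psi b"
proof -
  let ?c = "a \<otimes> b" let ?d = "a \<otimes> ?c" let ?a2 = "a [^] (2::nat)"
  have [simp]: "a \<in> carrier A" "b \<in> carrier A" "?c \<in> carrier A" using a b c by auto
  obtain a1 b1 c1 d1 where ra: "rel a a1" and rb: "rel b b1" and rc: "rel ?c c1" and rd: "rel ?d d1"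
    using rel_img a b c d by (meson MinfD)
  have ra2: "rel ?a2 (a1 [^]\<^bsub>B\<^esub> (2::nat))" using rel_pow[OF ra] by simp
  have [simp]: "a1 \<in> carrier B" "b1 \<in> carrier B" "c1 \<in> carrier B" "d1 \<in> carrier B"
    using relD ra rb rc rd by blast+
  have ind12: "A.indep 12 a b" using A.indep_mono[OF ind, of 12] by simp
  have "A.mon a ?c i j = A.mon a b (i + j) j" for i j
    by (simp add: A.mon_def A.int_pow_distrib A.int_pow_mult A.m_assoc)
  note mc = this
  \<comment> \<open>The pairs \<open>(a, a b)\<close> and \<open>(a^2, b)\<close> have to be
    independent up to 12. Rewritten in \<open>a\<close> and \<open>b\<close>, the exponents are at
    most 24, hence the bound in \<open>ind\<close>.\<close>
  have indc: "A.indep 12 a ?c"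
    unfolding A.indep_def
  proof (intro allI impI)
    fix i j assume ij: "\<bar>i\<bar> \<le> 12" "\<bar>j\<bar> \<le> 12" and "A.mon a ?c i j = \<one>"
    moreover have "\<bar>i + j\<bar> \<le> 24" using ij by arith
    ultimately show "i = 0 \<and> j = 0" using A.indepD[OF ind, of "i + j" j] mc by auto
  qed
  have "A.mon ?a2 b i j = A.mon a b (2 * i) j" for i j
    using A.int_pow_pow[of a 2 i] by (simp add: A.mon_def flip: int_pow_int)
  note m2 = this
  have ind2: "A.indep 12 ?a2 b"
    unfolding A.indep_def
  proof (intro allI impI)
    fix i j assume ij: "\<bar>i\<bar> \<le> 12" "\<bar>j\<bar> \<le> 12" and "A.mon ?a2 b i j = \<one>"
    moreover have "\<bar>2 * i\<bar> \<le> 24" using ij by arith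
    ultimately show "i = 0 \<and> j = 0" using A.indepD[OF ind, of "2 * i" j] m2 by auto
  qed
  define x where "x = psi a" define y where "y = psi b"
  have x: "x = a1 \<or> x = inv\<^bsub>B\<^esub> a1" and y: "y = b1 \<or> y = inv\<^bsub>B\<^esub> b1"
    using psi_cases ra rb by (simp_all add: x_def y_def)
  have xy[simp]: "x \<in> carrier B" "y \<in> carrier B" using x y by auto
  have indxy: "B.indep 12 x y" using x y rel_indep[OF ra rb ind12] B.indep_inv_fst B.indep_inv_snd
    by (metis \<open>a1 \<in> carrier B\<close> \<open>b1 \<in> carrier B\<close> B.inv_closed)
  have pc: "psi ?c = x \<otimes>\<^bsub>B\<^esub> y \<or> psi ?c = inv\<^bsub>B\<^esub> (x \<otimes>\<^bsub>B\<^esub> y)"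
    using psi_mult_up_to_inv[OF ra rb rc ind12, folded x_def y_def] psi_cases[OF rc] xy
      by (metis B.inv_inv B.m_closed)
  have d1: "d1 = x \<otimes>\<^bsub>B\<^esub> psi ?c \<or> d1 = inv\<^bsub>B\<^esub> (x \<otimes>\<^bsub>B\<^esub> psi ?c)"
    using psi_mult_up_to_inv[OF ra rc rd indc] by (simp add: x_def)
  have "?d = ?a2 \<otimes> b" by (simp add: numeral_2_eq_2 A.m_assoc)
  then have d2: "d1 = psi ?a2 \<otimes>\<^bsub>B\<^esub> y \<or> d1 = inv\<^bsub>B\<^esub> (psi ?a2 \<otimes>\<^bsub>B\<^esub> y)"
    using psi_mult_up_to_inv[OF ra2 rb _ ind2] rd by (simp add: y_def)
  have "psi ?a2 = a1 [^]\<^bsub>B\<^esub> (2::nat) \<or> psi ?a2 = inv\<^bsub>B\<^esub> (a1 [^]\<^bsub>B\<^esub> (2::nat))"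
    using psi_cases[OF ra2] .
  then have a2: "psi ?a2 = B.mon x y 2 0 \<or> psi ?a2 = B.mon x y (-2) 0"
    using x by (auto simp: B.mon_def B.int_pow_neg B.int_pow_inv simp flip: int_pow_int)
  have my: "y = B.mon x y 0 1" "x = B.mon x y 1 0" by (simp_all add: B.mon_def)
  show ?thesis
  proof (rule ccontr)
    assume "psi ?c \<noteq> psi a \<otimes>\<^bsub>B\<^esub> psi b"
    then have pc: "psi ?c = inv\<^bsub>B\<^esub> (x \<otimes>\<^bsub>B\<^esub> y)" using pc by (simp add: x_def y_def)
    have "x \<otimes>\<^bsub>B\<^esub> y = B.mon x y 1 1" by (simp add: B.mon_def)
    then have "x \<otimes>\<^bsub>B\<^esub> psi ?c = B.mon x y 0 (-1)"
      using B.mon_mult[OF xy, of 1 0 "-1" "-1"] by (simp add: pc B.mon_inv flip: my)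
    then obtain k where k: "k \<in> {-1,1}" "d1 = B.mon x y 0 k"
      using d1 by (auto simp: B.mon_inv)
    have "\<exists>l\<in>{-2,2}. psi ?a2 \<otimes>\<^bsub>B\<^esub> y = B.mon x y l 1"
      using a2 B.mon_mult[OF xy, of _ 0 0 1] my(1) by (metis add.right_neutral add_0 insertCI)
    then obtain l where l: "l \<in> {-2,2}" "psi ?a2 \<otimes>\<^bsub>B\<^esub> y = B.mon x y l 1" by blast
    then have "\<exists>l\<in>{-2,2}. \<exists>m\<in>{-1,1}. d1 = B.mon x y l m"
      using d2 by (auto simp: B.mon_inv)
    then obtain l m where "l \<in> {-2,2}" "m \<in> {-1,1}" "d1 = B.mon x y l m" by blast
    then show False using k B.mon_eqD[OF indxy xy, of 0 k l m] by auto
  qed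
qed

lemma eventually_Minf:
  assumes "e \<in> Minf" "x \<in> M"
  shows "eventually (\<lambda>n. x \<otimes> e [^] (n::nat) \<in> Minf) sequentially"
proof -
  have "x \<otimes> e [^] (n::nat) \<in> M" for n using assms powM by simp
  moreover have "eventually (\<lambda>n. aperiodic A (x \<otimes> e [^] (n::nat))) sequentially"
    using assms by (intro A.eventually_aperiodic) auto
  ultimately show ?thesis unfolding Minf_def by (simp only: mem_Collect_eq simp_thms)
qed

text \<open>Multiplying by a high power of \<open>e\<close> puts all factors in general position.\<close>
lemma psi_mult:
  assumes a: "a \<in> Minf" and b: "b \<in> Minf" and c: "a \<otimes> b \<in> Minf"
  shows "psi (a \<otimes> b) = psi a \<otimes>\<^bsub>B\<^esub> psi b"
proof -
  obtain e where e: "e \<in> Minf" using exM unfolding Minf_def by blast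
  let ?c = "a \<otimes> b"
  have [simp]: "a \<in> carrier A" "b \<in> carrier A" "e \<in> carrier A" "a \<in> M" "b \<in> M" using a b e by auto
  let ?E = "\<lambda>n. e [^] (n::nat)"
  \<comment> \<open>These are the hypotheses of \<open>psi_mult_indep\<close> for the three products
    of \<open>?c\<close> and \<open>?E n\<close>, of \<open>b\<close> and \<open>?E n\<close>, and
    of \<open>a\<close> and \<open>b \<otimes> ?E n\<close>.\<close>
  have "eventually (\<lambda>n. \<one> \<otimes> ?E n \<in> Minf \<and> b \<otimes> ?E n \<in> Minf \<and> b \<otimes> b \<otimes> ?E n \<in> Minf \<and> ?c \<otimes> ?E n \<in> Minf
      \<and> ?c \<otimes> ?c \<otimes> ?E n \<in> Minf \<and> a \<otimes> ?c \<otimes> ?E n \<in> Minf \<and> A.indep 24 ?c (\<one> \<otimes> ?E n)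
      \<and> A.indep 24 b (\<one> \<otimes> ?E n) \<and> A.indep 24 a (b \<otimes> ?E n)) sequentially"
    using eventually_Minf[OF e] eventually_Minf[OF e M.one_closed] e MinfD(2)[OF c] MinfD(2)[OF a] MinfD(2)[OF b] MinfD(2)[OF e]
    by (intro eventually_conj A.eventually_indep) simp_all
  from eventually_happens'[OF sequentially_bot this] obtain n
    where "\<one> \<otimes> ?E n \<in> Minf \<and> b \<otimes> ?E n \<in> Minf \<and> b \<otimes> b \<otimes> ?E n \<in> Minf \<and> ?c \<otimes> ?E n \<in> Minf
      \<and> ?c \<otimes> ?c \<otimes> ?E n \<in> Minf \<and> a \<otimes> ?c \<otimes> ?E n \<in> Minf \<and> A.indep 24 ?c (\<one> \<otimes> ?E n)
      \<and> A.indep 24 b (\<one> \<otimes> ?E n) \<and> A.indep 24 a (b \<otimes> ?E n)" by blast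
  then have n: "?E n \<in> Minf" "b \<otimes> ?E n \<in> Minf" "b \<otimes> b \<otimes> ?E n \<in> Minf" "?c \<otimes> ?E n \<in> Minf"
      "?c \<otimes> ?c \<otimes> ?E n \<in> Minf" "a \<otimes> ?c \<otimes> ?E n \<in> Minf" "A.indep 24 ?c (?E n)" "A.indep 24 b (?E n)" "A.indep 24 a (b \<otimes> ?E n)"
    by simp_all
  have 1: "psi (?c \<otimes> ?E n) = psi ?c \<otimes>\<^bsub>B\<^esub> psi (?E n)"
    using n c by (intro psi_mult_indep) (simp_all add: A.m_assoc)
  have 2: "psi (b \<otimes> ?E n) = psi b \<otimes>\<^bsub>B\<^esub> psi (?E n)"
    using n b by (intro psi_mult_indep) (simp_all add: A.m_assoc)
  have 3: "psi (a \<otimes> (b \<otimes> ?E n)) = psi a \<otimes>\<^bsub>B\<^esub> psi (b \<otimes> ?E n)"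
    using n a by (intro psi_mult_indep) (simp_all add: A.m_assoc)
  have [simp]: "psi a \<in> carrier B" "psi b \<in> carrier B" "psi ?c \<in> carrier B" "psi (?E n) \<in> carrier B"
    using a b c n by (auto intro: psi_closed)
  have "psi ?c \<otimes>\<^bsub>B\<^esub> psi (?E n) = (psi a \<otimes>\<^bsub>B\<^esub> psi b) \<otimes>\<^bsub>B\<^esub> psi (?E n)"
    using 1 2 3 by (simp add: A.m_assoc B.m_assoc)
  then show ?thesis by simp
qed


text \<open>\<open>psi\<close> is meaningful on \<open>Minf\<close> only, so numerator and
  denominator are taken there. Such a fraction always exists, by multiplying both by a power of an
  aperiodic element, and by \<open>psi_cross\<close> the choice is immaterial.\<close>

definition ext :: "'a \<Rightarrow> 'b" where
  "ext x = (let (a, b) = (SOME p. fst p \<in> Minf \<and> snd p \<in> Minf \<and> x \<otimes> snd p = fst p)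
    in psi a \<otimes>\<^bsub>B\<^esub> inv\<^bsub>B\<^esub> (psi b))"

lemma Minf_ex: "\<exists>e. e \<in> Minf"
  using exM unfolding Minf_def by blast

text \<open>The product \<open>a b'\<close> may have finite order, so \<open>psi_mult\<close>
  becomes applicable only after multiplication by a power of \<open>e\<close>, which is cancelled at
  the end.\<close>

lemma psi_cross:
  assumes "a \<in> Minf" "b \<in> Minf" "a' \<in> Minf" "b' \<in> Minf" and eq: "a \<otimes> b' = a' \<otimes> b"
  shows "psi a \<otimes>\<^bsub>B\<^esub> psi b' = psi a' \<otimes>\<^bsub>B\<^esub> psi b"
proof -
  obtain e where e: "e \<in> Minf" using Minf_ex by blast
  let ?E = "\<lambda>n. e [^] (n::nat)"
  have "eventually (\<lambda>n. ?E n \<in> Minf \<and> b' \<otimes> ?E n \<in> Minf \<and> b \<otimes> ?E n \<in> Minf \<and>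
    (a \<otimes> b') \<otimes> ?E n \<in> Minf) sequentially"
    using eventually_Minf[OF e] eventually_Minf[OF e M.one_closed] e assms
    by (intro eventually_conj) simp_all
  from eventually_happens'[OF sequentially_bot this] obtain n where n: "?E n \<in> Minf" "b' \<otimes> ?E n \<in> Minf"
      "b \<otimes> ?E n \<in> Minf" "(a \<otimes> b') \<otimes> ?E n \<in> Minf" by blast
  have assoc: "a \<otimes> (b' \<otimes> ?E n) = (a \<otimes> b') \<otimes> ?E n" "a' \<otimes> (b \<otimes> ?E n) = (a \<otimes> b') \<otimes> ?E n"
    using assms n eq by (simp_all add: A.m_assoc[symmetric])
  have "psi a \<otimes>\<^bsub>B\<^esub> (psi b' \<otimes>\<^bsub>B\<^esub> psi (?E n)) = psi (a \<otimes> (b' \<otimes> ?E n))"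
    using assms(1-4) n psi_mult[of a "b' \<otimes> ?E n"] psi_mult[of b' "?E n"] by (simp add: assoc)
  also have "\<dots> = psi a' \<otimes>\<^bsub>B\<^esub> (psi b \<otimes>\<^bsub>B\<^esub> psi (?E n))"
    using assms n psi_mult[of a' "b \<otimes> ?E n"] psi_mult[of b "?E n"] by (simp add: assoc)
  finally have "(psi a \<otimes>\<^bsub>B\<^esub> psi b') \<otimes>\<^bsub>B\<^esub> psi (?E n) = (psi a' \<otimes>\<^bsub>B\<^esub> psi b) \<otimes>\<^bsub>B\<^esub> psi (?E n)"
    using assms n by (simp add: B.m_assoc)
  then show ?thesis using assms n by simp
qed

lemma ext_eq:
  assumes x: "x \<in> carrier A" and ab: "a \<in> Minf" "b \<in> Minf" "x \<otimes> b = a"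
  shows "ext x = psi a \<otimes>\<^bsub>B\<^esub> inv\<^bsub>B\<^esub> (psi b)"
proof -
  let ?P = "\<lambda>p. fst p \<in> Minf \<and> snd p \<in> Minf \<and> x \<otimes> snd p = fst p"
  obtain a0 b0 where p: "(SOME p. ?P p) = (a0, b0)" by fastforce
  have "?P (a, b)" using ab by simp
  then have "?P (a0, b0)" using someI[of ?P "(a, b)"] p by simp
  then have ab0: "a0 \<in> Minf" "b0 \<in> Minf" "x \<otimes> b0 = a0" by auto
  have "a0 \<otimes> b = x \<otimes> b0 \<otimes> b" using ab0 by simp
  also have "\<dots> = x \<otimes> b \<otimes> b0" using x ab(1,2) ab0(1,2) by (simp add: A.m_ac)
  also have "\<dots> = a \<otimes> b0" using ab by simp
  finally have "psi a0 \<otimes>\<^bsub>B\<^esub> psi b = psi a \<otimes>\<^bsub>B\<^esub> psi b0" using ab ab0 by (intro psi_cross)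
  then have "psi a0 \<otimes>\<^bsub>B\<^esub> inv\<^bsub>B\<^esub> psi b0 = psi a \<otimes>\<^bsub>B\<^esub> inv\<^bsub>B\<^esub> psi b"
    using ab ab0
      by (simp add: B.div_eq_iff B.m_assoc B.m_comm[of "inv\<^bsub>B\<^esub> psi b" "psi b0"]) (simp add: B.eq_div_iff flip: B.m_assoc)
  then show ?thesis by (simp add: ext_def p)
qed

lemma Minf_fraction:
  assumes "x \<in> carrier A"
  shows "\<exists>a\<in>Minf. \<exists>b\<in>Minf. x \<otimes> b = a"
proof -
  obtain p q where pq: "p \<in> M" "q \<in> M" "x = p \<otimes> inv q" 
    using assms unfolding genM[symmetric] fractions_def by blast
  obtain e where e: "e \<in> Minf" using Minf_ex by blast
  have "eventually (\<lambda>n. p \<otimes> e [^] (n::nat) \<in> Minf \<and> q \<otimes> e [^] n \<in> Minf) sequentially"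
    using eventually_Minf[OF e] pq by (intro eventually_conj) simp_all
  from eventually_happens'[OF sequentially_bot this] obtain n
    where n: "p \<otimes> e [^] (n::nat) \<in> Minf" "q \<otimes> e [^] n \<in> Minf" by blast
  have "x \<otimes> q = p" using pq assms A.eq_div_iff[of p q x] by simp
  then have "x \<otimes> (q \<otimes> e [^] n) = p \<otimes> e [^] n" using pq assms e by (simp add: A.m_assoc[symmetric])
  then show ?thesis using n by blast
qed

lemma ext_closed [simp]: "x \<in> carrier A \<Longrightarrow> ext x \<in> carrier B"
  using Minf_fraction[of x] ext_eq[of x] by fastforce

lemma ext_mult:
  assumes x: "x \<in> carrier A" and y: "y \<in> carrier A"
  shows "ext (x \<otimes> y) = ext x \<otimes>\<^bsub>B\<^esub> ext y"
proof -
  obtain a b where ab: "a \<in> Minf" "b \<in> Minf" "x \<otimes> b = a" using Minf_fraction[OF x] by blast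
  obtain c d where cd: "c \<in> Minf" "d \<in> Minf" "y \<otimes> d = c" using Minf_fraction[OF y] by blast
  obtain e where e: "e \<in> Minf" using Minf_ex by blast
  let ?E = "\<lambda>n. e [^] (n::nat)"
  have "eventually (\<lambda>n. ?E n \<in> Minf \<and> c \<otimes> ?E n \<in> Minf \<and> d \<otimes> ?E n \<in> Minf \<and> (a \<otimes> c) \<otimes> ?E n \<in> Minf
      \<and> (b \<otimes> d) \<otimes> ?E n \<in> Minf) sequentially"
    using eventually_Minf[OF e] eventually_Minf[OF e M.one_closed] e ab cd
    by (intro eventually_conj) simp_all
  from eventually_happens'[OF sequentially_bot this] obtain n where n: "?E n \<in> Minf" "c \<otimes> ?E n \<in> Minf"
      "d \<otimes> ?E n \<in> Minf" "a \<otimes> c \<otimes> ?E n \<in> Minf" "b \<otimes> d \<otimes> ?E n \<in> Minf" by blast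
  have [simp]: "a \<in> carrier A" "b \<in> carrier A" "c \<in> carrier A" "d \<in> carrier A" "e \<in> carrier A" "psi a \<in> carrier B" "psi b \<in> carrier B"
    "psi c \<in> carrier B" "psi d \<in> carrier B" "psi (?E n) \<in> carrier B" using ab cd e n by auto
  have pa: "psi (a \<otimes> c \<otimes> ?E n) = psi a \<otimes>\<^bsub>B\<^esub> (psi c \<otimes>\<^bsub>B\<^esub> psi (?E n))"
    using psi_mult[of a "c \<otimes> ?E n"] psi_mult[of c "?E n"] ab cd n by (simp add: A.m_assoc)
  have pb: "psi (b \<otimes> d \<otimes> ?E n) = psi b \<otimes>\<^bsub>B\<^esub> (psi d \<otimes>\<^bsub>B\<^esub> psi (?E n))"
    using psi_mult[of b "d \<otimes> ?E n"] psi_mult[of d "?E n"] ab cd n by (simp add: A.m_assoc)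
  have "x \<otimes> y \<otimes> (b \<otimes> d \<otimes> ?E n) = (x \<otimes> b) \<otimes> (y \<otimes> d) \<otimes> ?E n"
    using x y by (simp add: A.m_ac)
  then have "x \<otimes> y \<otimes> (b \<otimes> d \<otimes> ?E n) = a \<otimes> c \<otimes> ?E n" using ab cd by simp
  then have "ext (x \<otimes> y) = psi a \<otimes>\<^bsub>B\<^esub> (psi c \<otimes>\<^bsub>B\<^esub> psi (?E n)) \<otimes>\<^bsub>B\<^esub> inv\<^bsub>B\<^esub> (psi b \<otimes>\<^bsub>B\<^esub> (psi d \<otimes>\<^bsub>B\<^esub> psi (?E n)))"
    using ext_eq[of "x \<otimes> y"] x y n pa pb by simp
  also have "\<dots> = (psi a \<otimes>\<^bsub>B\<^esub> inv\<^bsub>B\<^esub> psi b) \<otimes>\<^bsub>B\<^esub> (psi c \<otimes>\<^bsub>B\<^esub> inv\<^bsub>B\<^esub> psi d) \<otimes>\<^bsub>B\<^esub> (psi (?E n) \<otimes>\<^bsub>B\<^esub> inv\<^bsub>B\<^esub> psi (?E n))"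
    by (simp add: B.inv_mult B.m_ac del: B.r_inv)
  also have "\<dots> = ext x \<otimes>\<^bsub>B\<^esub> ext y"
    using ext_eq[OF x ab] ext_eq[OF y cd] by simp
  finally show ?thesis .
qed

lemma ext_group_hom: "group_hom A B ext"
  by unfold_locales (auto simp: hom_def ext_mult)

sublocale ext: group_hom A B ext by (rule ext_group_hom)

lemma ext_psi:
  assumes a: "a \<in> Minf"
  shows "ext a = psi a"
proof -
  have "eventually (\<lambda>n. \<one> \<otimes> a [^] (n::nat) \<in> Minf \<and> a \<otimes> a [^] n \<in> Minf) sequentially"
    using eventually_Minf[OF a] eventually_Minf[OF a M.one_closed] a by (intro eventually_conj) simp_all
  from eventually_happens'[OF sequentially_bot this] obtain n
    where n: "a [^] (n::nat) \<in> Minf" "a \<otimes> a [^] n \<in> Minf" using a by auto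
  then have "ext a = psi (a \<otimes> a [^] n) \<otimes>\<^bsub>B\<^esub> inv\<^bsub>B\<^esub> psi (a [^] n)"
    using a by (intro ext_eq) auto
  also have "\<dots> = psi a" using psi_mult[of a "a [^] n"] a n by (simp add: B.m_assoc)
  finally show ?thesis .
qed

lemma ext_cases: "rel a b \<Longrightarrow> ext a = b \<or> ext a = inv\<^bsub>B\<^esub> b"
  using ext_psi[of a] psi_cases relD[of a b] unfolding Minf_def by auto

text \<open>For \<open>rel a b\<close>, the map \<open>f\<close> preserves the orientation of
  \<open>cubic A a\<close> exactly when \<open>f'\<close> preserves that of
  \<open>cubic B b\<close>. So the two signs agree and cancel on \<open>Minf\<close>; fractions give
  the rest.\<close>

lemma ext_swap:
  assumes "x \<in> carrier A"
  shows "power_iso.ext B A N M f' (ext x) = x"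
proof -
  interpret S: power_iso B A N M f' f by (rule swap)
  have *: "S.ext (ext a) = a" if a: "a \<in> Minf" for a
  proof -
    obtain b where ab: "rel a b" using rel_img a by (meson MinfD)
    have ba: "S.rel b a" using ab rel_swap by simp
    have [simp]: "a \<in> carrier A" "b \<in> carrier B" using relD[OF ab] by auto
    have bS: "b \<in> S.Minf" using relD[OF ab] unfolding S.Minf_def by simp
    have iff: "f' (cubic B b) = cubic A a \<longleftrightarrow> f (cubic A a) = cubic B b"
      using f'_f f_f' cubic_in S.cubic_in relD[OF ab] by metis
    show ?thesis
    proof (cases "f (cubic A a) = cubic B b")
      case True
      then have "ext a = b" "S.ext b = a"
        using iff ext_psi[OF a] S.ext_psi[OF bS]
          by (simp_all add: psi_def S.psi_def img_eq[OF ab] S.img_eq[OF ba])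
      then show ?thesis by simp
    next
      case False
      then have "ext a = inv\<^bsub>B\<^esub> b" "S.ext b = inv a"
        using iff ext_psi[OF a] S.ext_psi[OF bS]
          by (simp_all add: psi_def S.psi_def img_eq[OF ab] S.img_eq[OF ba])
      then show ?thesis by simp
    qed
  qed
  obtain a b where ab: "a \<in> Minf" "b \<in> Minf" "x \<otimes> b = a" using Minf_fraction[OF assms] by blast
  then have "S.ext (ext x) \<otimes> b = x \<otimes> b"
    using *[OF ab(1)] *[OF ab(2)] assms by (metis MinfD(3) ext.hom_closed ext.hom_mult S.ext.hom_mult)
  then show ?thesis using ab assms by (metis A.r_cancel MinfD(3) ext.hom_closed S.ext.hom_closed)
qed

lemma ext_inj: "x \<in> carrier A \<Longrightarrow> y \<in> carrier A \<Longrightarrow> ext x = ext y \<longleftrightarrow> x = y"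
  using ext_swap by metis

lemma eventually_Minf_mult:
  assumes "e \<in> Minf" "x \<in> M" "k > 0"
  shows "eventually (\<lambda>n. x \<otimes> (e [^] (n::nat)) [^] (k::nat) \<in> Minf) sequentially"
proof -
  have "e [^] k \<in> Minf" using assms A.aperiodic_pow[of e k] powM[of e k] unfolding Minf_def by auto
  moreover have "(e [^] n) [^] k = (e [^] k) [^] n" for n :: nat
    using assms by (simp add: A.nat_pow_pow mult.commute)
  ultimately show ?thesis using eventually_Minf[OF _ assms(2)] by simp
qed

text \<open>With \<open>k = q1 / q2\<close> and \<open>k' = q1 / q3\<close>, the triple is a
  coincidence \<open>q1 = k q2 = k' q3\<close> in \<open>X\<close>, so the equation of
  \<open>graded_rigidity\<close> with \<open>Q = X\<close> has a second solution in
  \<open>A\<close>. Its image is a second solution in \<open>B\<close>, where rigidity returns a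
  coincidence in \<open>f X\<close> for \<open>ext k\<close> and \<open>ext k'\<close>.\<close>

lemma triple_transfer:
  assumes X: "X \<in> Pset A M" and q: "q1 \<in> X" "q2 \<in> X" "q3 \<in> X"
  shows "\<exists>p1\<in>f X. \<exists>p2\<in>f X. \<exists>p3\<in>f X.
    p1 = ext (q1 \<otimes> inv q2) \<otimes>\<^bsub>B\<^esub> p2 \<and> p1 = ext (q1 \<otimes> inv q3) \<otimes>\<^bsub>B\<^esub> p3"
proof -
  obtain e where e: "e \<in> Minf" using Minf_ex by blast
  have [simp]: "e \<in> carrier A" using e by simp
  have XM: "finite X" "X \<subseteq> M" "\<one> \<in> X" and XA: "X \<subseteq> carrier A"
    using X Pset_A_carrier[OF X] by (auto simp: Pset_def)
  have qM: "q1 \<in> M" "q2 \<in> M" "q3 \<in> M" using q XM by auto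
  have qA[simp]: "q1 \<in> carrier A" "q2 \<in> carrier A" "q3 \<in> carrier A" using q XA by auto
  define k where "k = q1 \<otimes> inv q2"
  define k' where "k' = q1 \<otimes> inv q3"
  have kA[simp]: "k \<in> carrier A" "k' \<in> carrier A" by (simp_all add: k_def k'_def)
  define SA where "SA = X \<union> ({k} <#> X) \<union> ({k'} <#> X) \<union> ({k \<otimes> k'} <#> X)"
  define SB
    where "SB = f X \<union> ({ext k} <#>\<^bsub>B\<^esub> f X) \<union> ({ext k'} <#>\<^bsub>B\<^esub> f X) \<union>
    ({ext k \<otimes>\<^bsub>B\<^esub> ext k'} <#>\<^bsub>B\<^esub> f X)"
  have fX: "finite (f X)" "f X \<subseteq> carrier B" using f_in[OF X] Pset_B_carrier[OF X] by (auto simp: Pset_def)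
  have SA: "finite SA" "SA \<subseteq> carrier A" unfolding SA_def using XM XA
    by (auto intro!: finite_set_mult dest: subsetD[OF A.setmult_subset_G, rotated -1])
  have SB: "finite SB" "SB \<subseteq> carrier B" unfolding SB_def using fX
    by (auto intro!: finite_set_mult dest: subsetD[OF B.setmult_subset_G, rotated -1])
  define E where "E n = e [^] (n::nat)" for n
  have [simp]: "E n \<in> carrier A" for n by (simp add: E_def)
  have ee: "ext e \<in> carrier B" "aperiodic B (ext e)" using ext_psi[OF e] psi_aperiodic[of e] e by auto
  \<comment> \<open>The three elements placed in \<open>Minf\<close> become \<open>z\<close>,
    \<open>r\<close> and \<open>r'\<close> below. Separation is needed on both sides: in
    \<open>A\<close> to keep the new point outside \<open>Y\<close>, in \<open>B\<close> for
    rigidity.\<close>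
  have "eventually (\<lambda>n. ((q2 \<otimes> q3) \<otimes> E n [^] (1::nat) \<in> Minf) \<and>
    ((q1 \<otimes> q2 \<otimes> (q3 \<otimes> q3)) \<otimes> E n [^] (2::nat) \<in> Minf) \<and>
    ((q1 \<otimes> (q2 \<otimes> q2 \<otimes> q2) \<otimes> (q3 \<otimes> q3)) \<otimes> E n [^] (3::nat) \<in> Minf) \<and>
    (\<forall>b\<in>SA. \<forall>b'\<in>SA. \<forall>i\<in>{1..12::nat}. b \<otimes> ((q2 \<otimes> q3) \<otimes> E n) [^] i \<noteq> b') \<and>
    (\<forall>b\<in>SB. \<forall>b'\<in>SB. \<forall>i\<in>{1..12::nat}. b \<otimes>\<^bsub>B\<^esub> (ext (q2 \<otimes> q3) \<otimes>\<^bsub>B\<^esub> ext e [^]\<^bsub>B\<^esub> n) [^]\<^bsub>B\<^esub> i \<noteq> b')) sequentially"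
    unfolding E_def using e qM SA SB ee
    by (intro eventually_conj eventually_Minf_mult A.eventually_separated B.eventually_separated) auto
  from eventually_happens'[OF sequentially_bot this] obtain n where
    n1: "(q2 \<otimes> q3) \<otimes> E n [^] (1::nat) \<in> Minf"
    and n2: "(q1 \<otimes> q2 \<otimes> (q3 \<otimes> q3)) \<otimes> E n [^] (2::nat) \<in> Minf"
    and n3: "(q1 \<otimes> (q2 \<otimes> q2 \<otimes> q2) \<otimes> (q3 \<otimes> q3)) \<otimes> E n [^] (3::nat) \<in> Minf"
    and n4: "\<forall>b\<in>SA. \<forall>b'\<in>SA. \<forall>i\<in>{1..12::nat}. b \<otimes> ((q2 \<otimes> q3) \<otimes> E n) [^] i \<noteq> b'"
    and n5: "\<forall>b\<in>SB. \<forall>b'\<in>SB. \<forall>i\<in>{1..12::nat}. b \<otimes>\<^bsub>B\<^esub> (ext (q2 \<otimes> q3) \<otimes>\<^bsub>B\<^esub> ext e [^]\<^bsub>B\<^esub> n) [^]\<^bsub>B\<^esub> i \<noteq> b'"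
    by blast
  \<comment> \<open>The factor \<open>q2 q3\<close> clears the denominators of \<open>k\<close> and
    \<open>k'\<close>, so that \<open>r = k z^2\<close> and \<open>r' = k' z^3\<close> lie in
    \<open>M\<close>.\<close>
  define z where "z = q2 \<otimes> q3 \<otimes> E n"
  have zA[simp]: "z \<in> carrier A" by (simp add: z_def)
  define r where "r = k \<otimes> z [^] (2::nat)"
  define r' where "r' = k' \<otimes> z [^] (3::nat)"
  have kq: "k \<otimes> q2 = q1" "k' \<otimes> q3 = q1" by (simp_all add: k_def k'_def A.m_assoc)
  have pw: "x [^] (2::nat) = x \<otimes> x" "x [^] (3::nat) = x \<otimes> x \<otimes> x" if "x \<in> carrier A" for x
    using that by (simp_all add: numeral_2_eq_2 numeral_3_eq_3)
  have r: "r = (q1 \<otimes> q2 \<otimes> (q3 \<otimes> q3)) \<otimes> E n [^] (2::nat)"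
    unfolding r_def z_def kq(1)[symmetric] by (simp add: pw A.m_ac)
  have r': "r' = (q1 \<otimes> (q2 \<otimes> q2 \<otimes> q2) \<otimes> (q3 \<otimes> q3)) \<otimes> E n [^] (3::nat)"
    unfolding r'_def z_def kq(2)[symmetric] by (simp add: pw A.m_ac)
  have zr: "z \<in> Minf" "r \<in> Minf" "r' \<in> Minf" using n1 n2 n3 r r' by (simp_all add: z_def)
  \<comment> \<open>The hole in degree 1. Its products with 1, \<open>z\<close> and
    \<open>z^3\<close> are \<open>z q1\<close>, \<open>q2 r\<close> and \<open>z (q3 r')\<close>,
    all of them already present.\<close>
  define w where "w = q1 \<otimes> z"
  define Y where "Y = (X <#> {\<one>, r}) <#> {\<one>, r'}"
  have rA[simp]: "r \<in> carrier A" "r' \<in> carrier A" "w \<in> carrier A" using zr by (simp_all add: w_def)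
  have YI: "q \<otimes> s \<otimes> t \<in> Y" if "q \<in> X" "s \<in> {\<one>, r}" "t \<in> {\<one>, r'}" for q s t
    unfolding Y_def by (rule set_multI[OF set_multI[OF that(1,2) refl] that(3) refl])
  have YP: "Y \<in> Pset A M" unfolding Y_def using zr by (intro A.Pset_mult subM pair_in X) auto
  have wY: "insert w Y \<in> Pset A M" using YP qM zr by (intro insert_in) (auto simp: w_def)
  have cz: "cubic A z \<in> Pset A M" using zr by (intro cubic_in) auto
  have absorb: "cubic A z <#> insert w Y = cubic A z <#> Y"
  proof (rule set_mult_insert_absorb)
    fix d assume "d \<in> cubic A z"
    then consider "d = \<one>" | "d = z" | "d = z [^] (3::nat)" by (auto simp: cubic_def)
    then show "d \<otimes> w \<in> cubic A z <#> Y"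
    proof cases
      case 1
      then show ?thesis using YI[of q1 "\<one>" "\<one>"] q
        by (intro set_multI[of z _ q1]) (auto simp: cubic_def w_def A.m_comm)
    next
      case 2
      have "q2 \<otimes> r = (k \<otimes> q2) \<otimes> (z \<otimes> z)" unfolding r_def pw(1)[OF zA] by (simp add: A.m_ac)
      then have "d \<otimes> w = q2 \<otimes> r" using 2 by (simp add: kq w_def A.m_ac)
      then show ?thesis using YI[of q2 r "\<one>"] q
        by (intro set_multI[of "\<one>" _ "q2 \<otimes> r"]) (auto simp: cubic_def)
    next
      case 3
      have "q3 \<otimes> r' = (k' \<otimes> q3) \<otimes> z [^] (3::nat)" unfolding r'_def by (simp add: A.m_ac)
      then have "d \<otimes> w = z \<otimes> (q3 \<otimes> r')" using 3 by (simp add: kq w_def A.m_ac)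
      then show ?thesis using YI[of q3 "\<one>" r'] q
        by (intro set_multI[of z _ "q3 \<otimes> r'"]) (auto simp: cubic_def)
    qed
  qed
  have sepA: "b \<otimes> z [^] (i::nat) \<noteq> b'" if "b \<in> SA" "b' \<in> SA" "0 < i" "i \<le> 12" for b b' i
    using n4 that by (simp add: z_def)
  have lay: "b = b' \<and> i = j" if "b \<in> SA" "b' \<in> SA" "i \<le> 12" "j \<le> 12" "b \<otimes> z [^] i = b' \<otimes> z [^] j" for b b'
    and i j :: nat
    using A.layers_separated[of SA z 12 b b' i j] SA sepA that by auto
  have "w \<notin> Y"
  proof
    assume "w \<in> Y"
    then obtain q s t where qst: "q \<in> X" "s \<in> {\<one>, r}" "t \<in> {\<one>, r'}" "w = q \<otimes> s \<otimes> t"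
      unfolding Y_def by (elim set_multE) blast
    have [simp]: "q \<in> carrier A" using qst XA by auto
    have kqS: "k \<otimes> q \<in> SA" "k' \<otimes> q \<in> SA" "k \<otimes> k' \<otimes> q \<in> SA" "q \<in> SA" "q1 \<in> SA"
      using qst q by (auto simp: SA_def mem_set_mult_iff)
    have z5: "z [^] (2::nat) \<otimes> z [^] (3::nat) = z [^] (5::nat)" by (simp add: A.nat_pow_mult)
    have w1: "w = q1 \<otimes> z [^] (1::nat)" by (simp add: w_def)
    consider "s = \<one>" "t = \<one>" | "s = r" "t = \<one>" | "s = \<one>" "t = r'" | "s = r" "t = r'" using qst by blast
    then show False
    proof cases
      case 1
      then have "q1 \<otimes> z [^] (1::nat) = q \<otimes> z [^] (0::nat)" using qst w1 by simp
      then show False using lay[OF kqS(5,4), of 1 0] by simp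
    next
      case 2
      then have "q1 \<otimes> z [^] (1::nat) = (k \<otimes> q) \<otimes> z [^] (2::nat)" using qst w1 by (simp add: r_def A.m_ac)
      then show False using lay[OF kqS(5,1), of 1 2] by simp
    next
      case 3
      then have "q1 \<otimes> z [^] (1::nat) = (k' \<otimes> q) \<otimes> z [^] (3::nat)" using qst w1 by (simp add: r'_def A.m_ac)
      then show False using lay[OF kqS(5,2), of 1 3] by simp
    next
      case 4
      then have "q1 \<otimes> z [^] (1::nat) = (k \<otimes> k' \<otimes> q) \<otimes> z [^] (5::nat)"
        using qst w1 by (simp add: r_def r'_def A.m_ac flip: z5)
      then show False using lay[OF kqS(5,3), of 1 5] by simp
    qed
  qed
  define y where "y = ext z"
  have yB[simp]: "y \<in> carrier B" by (simp add: y_def)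
  have y: "y = ext (q2 \<otimes> q3) \<otimes>\<^bsub>B\<^esub> ext e [^]\<^bsub>B\<^esub> n"
    by (simp add: y_def z_def E_def ext.hom_nat_pow)
  have pr: "psi r = ext k \<otimes>\<^bsub>B\<^esub> y [^]\<^bsub>B\<^esub> (2::nat)" "psi r' = ext k' \<otimes>\<^bsub>B\<^esub> y [^]\<^bsub>B\<^esub> (3::nat)"
    using ext_psi[OF zr(2)] ext_psi[OF zr(3)] by (simp_all add: r_def r'_def y_def ext.hom_nat_pow)
  obtain u where u: "u \<in> carrier B" "f {\<one>, r} = {u} <#>\<^bsub>B\<^esub> {\<one>\<^bsub>B\<^esub>, ext k \<otimes>\<^bsub>B\<^esub> y [^]\<^bsub>B\<^esub> (2::nat)}"
    using f_pair_psi[OF rel_img[of r]] zr pr by auto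
  obtain v where v: "v \<in> carrier B" "f {\<one>, r'} = {v} <#>\<^bsub>B\<^esub> {\<one>\<^bsub>B\<^esub>, ext k' \<otimes>\<^bsub>B\<^esub> y [^]\<^bsub>B\<^esub> (3::nat)}"
    using f_pair_psi[OF rel_img[of r']] zr pr by auto
  obtain t where t: "t \<in> carrier B" "f (cubic A z) = {t} <#>\<^bsub>B\<^esub> cubic B y"
    using f_cubic_psi[OF rel_img[of z]] zr ext_psi[OF zr(1)] by (auto simp: y_def)
  have "f Y = (f X <#>\<^bsub>B\<^esub> ({u} <#>\<^bsub>B\<^esub> {\<one>\<^bsub>B\<^esub>, ext k \<otimes>\<^bsub>B\<^esub> y [^]\<^bsub>B\<^esub> (2::nat)})) <#>\<^bsub>B\<^esub> ({v} <#>\<^bsub>B\<^esub> {\<one>\<^bsub>B\<^esub>, ext k' \<otimes>\<^bsub>B\<^esub> y [^]\<^bsub>B\<^esub> (3::nat)})"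
    unfolding Y_def u(2)[symmetric] v(2)[symmetric]
      using X zr by (simp add: f_mult A.Pset_mult subM pair_in)
  also have "\<dots> = {u \<otimes>\<^bsub>B\<^esub> v} <#>\<^bsub>B\<^esub> ((f X <#>\<^bsub>B\<^esub> {\<one>\<^bsub>B\<^esub>, ext k \<otimes>\<^bsub>B\<^esub> y [^]\<^bsub>B\<^esub> (2::nat)}) <#>\<^bsub>B\<^esub> {\<one>\<^bsub>B\<^esub>, ext k' \<otimes>\<^bsub>B\<^esub> y [^]\<^bsub>B\<^esub> (3::nat)})"
    using u v fX by (simp add: B.set_mult_ac B.setmult_subset_G flip: B.set_mult_singletons)
  finally have fY: "f Y = \<dots>" .
  have "\<exists>p\<in>f X. \<exists>q\<in>f X. \<exists>r\<in>f X. p = ext k \<otimes>\<^bsub>B\<^esub> q \<and> p = ext k' \<otimes>\<^bsub>B\<^esub> r"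
  proof (rule B.graded_rigidity_translate[OF fX(2) _ _ yB _ t(1) SB_def _ fY])
    show "b \<otimes>\<^bsub>B\<^esub> y [^]\<^bsub>B\<^esub> (i::nat) \<noteq> b'" if "b \<in> SB" "b' \<in> SB" "0 < i" "i \<le> 12" for b b' i
      using n5 that by (simp add: y)
    show "f (insert w Y) \<subseteq> carrier B" using Pset_B_carrier wY by simp
    show "({t} <#>\<^bsub>B\<^esub> cubic B y) <#>\<^bsub>B\<^esub> f (insert w Y) = ({t} <#>\<^bsub>B\<^esub> cubic B y) <#>\<^bsub>B\<^esub> f Y"
      unfolding t(2)[symmetric] using absorb f_mult[OF cz wY] f_mult[OF cz YP] by simp
    show "f (insert w Y) \<noteq> f Y" using \<open>w \<notin> Y\<close> f_inj[OF wY YP] by auto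
  qed (use u v in simp_all)
  then show ?thesis by (simp add: k_def k'_def)
qed


subsection \<open>Images of the monoids\<close>

text \<open>By \<open>rel_inv\<close> both candidates for \<open>ext x\<close>, namely
  \<open>b\<close> and its inverse, lie in \<open>N\<close>, so the sign does not matter.\<close>

lemma unit_image:
  assumes "x \<in> Minf" "inv x \<in> M"
  shows "ext x \<in> N"
proof -
  obtain b where ab: "rel x b" using rel_img assms by (meson MinfD)
  have "inv\<^bsub>B\<^esub> b \<in> N" "b \<in> N" using relD[OF rel_inv[OF ab assms(2)]] relD[OF ab] by auto
  then show ?thesis using ext_cases[OF ab] by auto
qed

lemma aperiodic_if_not_unit:
  assumes "x \<in> M" "inv x \<notin> M"
  shows "x \<in> Minf"
proof (rule ccontr)
  assume "x \<notin> Minf"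
  then obtain n where n: "n > 0" "x [^] (n::nat) = \<one>"
    using assms by (auto simp: Minf_def aperiodic_def simp del: MinfD)
  then obtain k where "n = Suc k" by (cases n) auto
  then have "x [^] k \<otimes> x = \<one>" using n by simp
  then have "inv x = x [^] k" using assms by (intro A.inv_equality) auto
  then show False using assms powM by metis
qed

lemma inv_pow_in:
  assumes "x \<in> M" "n > 0" "inv (x [^] (n::nat)) \<in> M"
  shows "inv x \<in> M"
proof -
  obtain k where n: "n = Suc k" using assms(2) by (cases n) auto
  have [simp]: "x \<in> carrier A" using assms by simp
  have "inv (x [^] n) \<otimes> x [^] k \<otimes> x = \<one>" by (simp add: n A.m_assoc del: A.inv_mult_group)
  then have "inv x = inv (x [^] n) \<otimes> x [^] k" by (intro A.inv_equality) auto
  then show ?thesis using assms powM by simp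
qed

text \<open>\<open>triple_transfer\<close> for \<open>f'\<close>, read backwards. It locates an
  arbitrary element \<open>k\<close> of \<open>f X\<close> relative to the known elements
  \<open>m\<close> and \<open>ext x m\<close>, and so bounds \<open>f X\<close> from above, as
  \<open>triple_image\<close> does from below.\<close>

lemma triple_swap:
  assumes X: "X \<in> Pset A M" and k: "k \<in> f X" "m \<in> f X" "ext x \<otimes>\<^bsub>B\<^esub> m \<in> f X" and x: "x \<in> carrier A"
    and ne: "k \<noteq> m" "k \<noteq> ext x \<otimes>\<^bsub>B\<^esub> m"
  obtains q q' where "q \<in> X" "q' \<in> X" "x \<otimes> q' \<in> X" "q \<noteq> q'" "q \<noteq> x \<otimes> q'" "k = ext (q \<otimes> inv q') \<otimes>\<^bsub>B\<^esub> m"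
proof -
  interpret S: power_iso B A N M f' f by (rule swap)
  have [simp]: "k \<in> carrier B" "m \<in> carrier B" using k Pset_B_carrier[OF X] by auto
  define u where "u = S.ext (k \<otimes>\<^bsub>B\<^esub> inv\<^bsub>B\<^esub> m)"
  have u[simp]: "u \<in> carrier A" by (simp add: u_def)
  have eu: "ext u = k \<otimes>\<^bsub>B\<^esub> inv\<^bsub>B\<^esub> m"
    using S.ext_swap[of "k \<otimes>\<^bsub>B\<^esub> inv\<^bsub>B\<^esub> m"] by (simp add: u_def)
  have "k \<otimes>\<^bsub>B\<^esub> inv\<^bsub>B\<^esub> (ext x \<otimes>\<^bsub>B\<^esub> m) = ext (u \<otimes> inv x)"
    using x by (simp add: eu B.inv_mult B.m_ac)
  then have u2: "S.ext (k \<otimes>\<^bsub>B\<^esub> inv\<^bsub>B\<^esub> (ext x \<otimes>\<^bsub>B\<^esub> m)) = u \<otimes> inv x"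
    using x ext_swap by simp
  obtain q q' q'' where q: "q \<in> X" "q' \<in> X" "q'' \<in> X" "q = u \<otimes> q'" "q = u \<otimes> inv x \<otimes> q''"
    using S.triple_transfer[OF f_in[OF X] k] unfolding f'_f[OF X] u2 u_def[symmetric] by blast
  have [simp]: "q \<in> carrier A" "q' \<in> carrier A" "q'' \<in> carrier A" using q Pset_A_carrier[OF X] by auto
  have "u \<otimes> (inv x \<otimes> q'') = u \<otimes> q'" using q x by (simp add: A.m_assoc)
  then have "inv x \<otimes> q'' = q'" using x by simp
  then have q'': "q'' = x \<otimes> q'" using x A.inv_solve_left[of q' x q''] by auto
  have uq: "u = q \<otimes> inv q'" using q by (simp add: A.eq_div_iff)
  have ku: "k = ext u \<otimes>\<^bsub>B\<^esub> m" by (simp add: eu B.m_assoc)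
  have ne1: "q \<noteq> q'"
  proof
    assume "q = q'"
    then have "u = \<one>" using uq by simp
    then show False using ku ne by simp
  qed
  have ne2: "q \<noteq> x \<otimes> q'"
  proof
    assume "q = x \<otimes> q'"
    then have "u = x" using uq x by (simp add: A.m_assoc)
    then show False using ku ne by simp
  qed
  show ?thesis
    by (rule that[OF q(1,2) q(3)[unfolded q''] ne1 ne2 ku[unfolded uq]])
qed

text \<open>The choice \<open>q1 = 1\<close> in \<open>triple_transfer\<close> makes
  \<open>p1\<close> the base point \<open>m\<close> of the translate.\<close>

lemma triple_image:
  assumes "x \<in> M" "y \<in> M"
  obtains m where "m \<in> f {\<one>, x, y}" "ext x \<otimes>\<^bsub>B\<^esub> m \<in> f {\<one>, x, y}" "ext y \<otimes>\<^bsub>B\<^esub> m \<in> f {\<one>, x, y}"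
proof -
  have X: "{\<one>, x, y} \<in> Pset A M" using assms by (simp add: Pset_def)
  have [simp]: "x \<in> carrier A" "y \<in> carrier A" using assms by auto
  obtain p q r where p: "p \<in> f {\<one>, x, y}" "q \<in> f {\<one>, x, y}" "r \<in> f {\<one>, x, y}"
    "p = ext (\<one> \<otimes> inv x) \<otimes>\<^bsub>B\<^esub> q" "p = ext (\<one> \<otimes> inv y) \<otimes>\<^bsub>B\<^esub> r"
    using triple_transfer[OF X insertI1 insertI2[OF insertI1] insertI2[OF insertI2[OF insertI1]]] by blast
  have [simp]: "p \<in> carrier B" "q \<in> carrier B" "r \<in> carrier B" using p Pset_B_carrier[OF X] by auto
  have "ext x \<otimes>\<^bsub>B\<^esub> p = q" using p(4) by (simp add: B.m_assoc[symmetric])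
  moreover have "ext y \<otimes>\<^bsub>B\<^esub> p = r" using p(5) by (simp add: B.m_assoc[symmetric])
  ultimately show ?thesis using that[of p] p by simp
qed

text \<open>The image of \<open>{1, x, y}\<close> is exactly \<open>{m, ext x m, ext y m}\<close>.
  It contains 1, so \<open>m\<close> is 1 or the inverse of \<open>ext x\<close> or of
  \<open>ext y\<close>. In the last two cases \<open>y / x\<close> or \<open>x / y\<close> is sent
  into \<open>N\<close> and hence lies in \<open>M\<close> up to inversion, against incomparability.
  So \<open>m = 1\<close> and \<open>ext x\<close> belongs to the image.\<close>

lemma incomparable_image:
  assumes redM: "\<And>x. x \<in> M \<Longrightarrow> inv x \<in> M \<Longrightarrow> x = \<one>" and redN: "\<And>x. x \<in> N \<Longrightarrow> inv\<^bsub>B\<^esub> x \<in> N \<Longrightarrow> x = \<one>\<^bsub>B\<^esub>"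
    and xy: "x \<in> M" "y \<in> M" "x \<otimes> inv y \<notin> M" "y \<otimes> inv x \<notin> M"
  shows "ext x \<in> N"
proof (rule ccontr)
  assume nN: "ext x \<notin> N"
  interpret S: power_iso B A N M f' f by (rule swap)
  have [simp]: "x \<in> carrier A" "y \<in> carrier A" using xy by auto
  \<comment> \<open>If \<open>ext t\<close> is not 1, then \<open>f'\<close> sends
    \<open>{1, ext t}\<close> to some \<open>{1, h}\<close> with \<open>h\<close> in
    \<open>M\<close>, and \<open>t\<close> is \<open>h\<close> or its inverse.\<close>
  have comp: "t \<in> M \<or> inv t \<in> M" if t: "t \<in> carrier A" "ext t \<in> N" for t
  proof (cases "ext t = \<one>\<^bsub>B\<^esub>")
    case True
    then have "t = \<one>" using ext_inj[of t "\<one>"] t by simp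
    then show ?thesis by simp
  next
    case False
    then have "ext t \<in> S.Minf" using redN t S.aperiodic_if_not_unit by blast
    then obtain h where h: "S.rel (ext t) h" using S.rel_img by (meson S.MinfD)
    then have "t = h \<or> t = inv h" using S.ext_cases[OF h] ext_swap[OF t(1)] by simp
    then show ?thesis using S.relD[OF h] by auto
  qed
  let ?X = "{\<one>, x, y}"
  have X: "?X \<in> Pset A M" using xy by (simp add: Pset_def)
  obtain m where m: "m \<in> f ?X" "ext x \<otimes>\<^bsub>B\<^esub> m \<in> f ?X" "ext y \<otimes>\<^bsub>B\<^esub> m \<in> f ?X"
    by (rule triple_image[OF xy(1,2)])
  have [simp]: "m \<in> carrier B" using m Pset_B_carrier[OF X] by auto
  \<comment> \<open>\<open>x' q'\<close> has to lie in \<open>{1, x', y'}\<close> again. For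
    \<open>q' = x'\<close> or \<open>q' = y'\<close> this would give a nontrivial unit, or
    \<open>x' = 1\<close> or \<open>y' = 1\<close>, or divisibility of \<open>y'\<close> by
    \<open>x'\<close>; so \<open>q' = 1\<close>.\<close>
  have third: "k = ext y' \<otimes>\<^bsub>B\<^esub> m"
    if k: "k \<in> f ?X" "k \<noteq> m" "k \<noteq> ext x' \<otimes>\<^bsub>B\<^esub> m"
      and x'y': "(x', y') = (x, y) \<or> (x', y') = (y, x)" for k x' y'
  proof -
    have Xe: "?X = {\<one>, x', y'}" using x'y' by auto
    have c: "x' \<in> M" "y' \<in> M" "x' \<otimes> inv y' \<notin> M" "y' \<otimes> inv x' \<notin> M" using x'y' xy by auto
    have [simp]: "x' \<in> carrier A" "y' \<in> carrier A" using c by auto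
    have m': "ext x' \<otimes>\<^bsub>B\<^esub> m \<in> f ?X" using m x'y' by auto
    obtain q q' where q: "q \<in> ?X" "q' \<in> ?X" "x' \<otimes> q' \<in> ?X" "q \<noteq> q'" "q \<noteq> x' \<otimes> q'"
        "k = ext (q \<otimes> inv q') \<otimes>\<^bsub>B\<^esub> m"
      by (rule triple_swap[OF X k(1) m(1) m' _ k(2,3)]) auto
    have x1: "x' \<noteq> \<one>" "y' \<noteq> \<one>" using c by auto
    have "q' \<noteq> x'"
    proof
      assume "q' = x'"
      then have "x' \<otimes> x' = \<one> \<or> x' \<otimes> x' = x' \<or> x' \<otimes> x' = y'" using q(3) unfolding Xe by auto
      then show False
      proof (elim disjE)
        assume "x' \<otimes> x' = \<one>"
        then have "inv x' = x'" by (simp add: A.inv_equality)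
        then show False using redM[of x'] c x1 by simp
      next
        assume "x' \<otimes> x' = x'"
        then show False using x1 by simp
      next
        assume "x' \<otimes> x' = y'"
        then have "y' \<otimes> inv x' = x'" by (simp add: A.div_eq_iff)
        then show False using c by simp
      qed
    qed
    moreover have "q' \<noteq> y'"
    proof
      assume "q' = y'"
      then have "x' \<otimes> y' = \<one> \<or> x' \<otimes> y' = x' \<or> x' \<otimes> y' = y'" using q(3) unfolding Xe by auto
      then show False
      proof (elim disjE)
        assume "x' \<otimes> y' = \<one>"
        then have "inv y' = x'" by (simp add: A.inv_equality)
        then show False using redM[of y'] c x1 by simp
      qed (use x1 in simp_all)
    qed
    ultimately have "q' = \<one>" using q(2) unfolding Xe by auto
    then have "q = y'" using q unfolding Xe by auto
    then show ?thesis using q(6) \<open>q' = \<one>\<close> by simp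
  qed
  have "k \<in> {m, ext x \<otimes>\<^bsub>B\<^esub> m, ext y \<otimes>\<^bsub>B\<^esub> m}" if "k \<in> f ?X" for k
    using third[OF that, of x y] by auto
  then have "\<one>\<^bsub>B\<^esub> = m \<or> \<one>\<^bsub>B\<^esub> = ext x \<otimes>\<^bsub>B\<^esub> m \<or> \<one>\<^bsub>B\<^esub> = ext y \<otimes>\<^bsub>B\<^esub> m"
    using one_in_f[OF X] by blast
  moreover have fN: "f ?X \<subseteq> N" using f_in[OF X] by (auto simp: Pset_def)
  ultimately show False
  proof (elim disjE)
    assume "\<one>\<^bsub>B\<^esub> = m"
    then show False using m fN nN by auto
  next
    assume "\<one>\<^bsub>B\<^esub> = ext x \<otimes>\<^bsub>B\<^esub> m"
    then have "m = inv\<^bsub>B\<^esub> (ext x)" using B.inv_equality[of m "ext x"] by (simp add: B.m_comm)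
    then have "ext (y \<otimes> inv x) \<in> N" using m fN by auto
    then show False using comp[of "y \<otimes> inv x"] xy by (simp add: A.inv_mult A.m_comm)
  next
    assume "\<one>\<^bsub>B\<^esub> = ext y \<otimes>\<^bsub>B\<^esub> m"
    then have "m = inv\<^bsub>B\<^esub> (ext y)" using B.inv_equality[of m "ext y"] by (simp add: B.m_comm)
    then have "ext (x \<otimes> inv y) \<in> N" using m fN by auto
    then show False using comp[of "x \<otimes> inv y"] xy by (simp add: A.inv_mult A.m_comm)
  qed
qed

text \<open>Here \<open>x\<close> is a supposed element that is sent outside \<open>N\<close>. The
  image of \<open>{1, u, x}\<close> is \<open>{m, ext u m, ext x m}\<close> and contains 1. The
  choice \<open>m = 1\<close> would put \<open>ext x\<close>, and the inverse of
  \<open>ext u\<close> would put \<open>ext (x / u)\<close>, into \<open>N\<close>; so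
  \<open>m\<close> is the inverse of \<open>ext x\<close>.\<close>

lemma unit_triple_image:
  assumes u: "u \<in> M" "inv u \<in> M" "u \<noteq> \<one>" and x: "x \<in> Minf" "ext x \<notin> N"
  shows "ext (x \<otimes> inv u) \<notin> N" "f {\<one>, u, x} = {\<one>\<^bsub>B\<^esub>, ext (inv x), ext (u \<otimes> inv x)}"
proof -
  interpret S: power_iso B A N M f' f by (rule swap)
  have [simp]: "x \<in> carrier A" "u \<in> carrier A" "x \<in> M" using u x by auto
  have nu: "inv x \<notin> M" using unit_image[OF x(1)] x(2) by blast
  obtain x1 where xx: "rel x x1" using rel_img x(1) by (meson MinfD)
  have [simp]: "x1 \<in> carrier B" "x1 \<in> N" using relD[OF xx] by auto
  have ex: "ext x = inv\<^bsub>B\<^esub> x1" using ext_cases[OF xx] x(2) \<open>x1 \<in> N\<close> by metis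
  show n: "ext (x \<otimes> inv u) \<notin> N"
  proof
    assume "ext (x \<otimes> inv u) \<in> N"
    then have k: "inv\<^bsub>B\<^esub> x1 \<otimes>\<^bsub>B\<^esub> inv\<^bsub>B\<^esub> (ext u) \<in> N" by (simp add: ex)
    let ?k = "inv\<^bsub>B\<^esub> x1 \<otimes>\<^bsub>B\<^esub> inv\<^bsub>B\<^esub> (ext u)"
    show False
    proof (cases "u \<in> Minf")
      case True
      then have "?k \<otimes>\<^bsub>B\<^esub> ext u \<in> N" using unit_image[OF True u(2)] k by simp
      then show False using x(2) by (simp add: ex B.m_assoc)
    next
      case False
      \<comment> \<open>A unit of finite order disappears from the \<open>n\<close>-th power, and
        \<open>inv_pow_in\<close> recovers the inverse of \<open>x1\<close> from that of
        \<open>x1^n\<close>.\<close>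
      then obtain n where n: "n > 0" "u [^] (n::nat) = \<one>" using u unfolding Minf_def aperiodic_def by auto
      then have "ext u [^]\<^bsub>B\<^esub> n = \<one>\<^bsub>B\<^esub>" by (metis \<open>u \<in> carrier A\<close> ext.hom_nat_pow ext.hom_one)
      then have "?k [^]\<^bsub>B\<^esub> n = inv\<^bsub>B\<^esub> (x1 [^]\<^bsub>B\<^esub> n)"
        by (simp add: B.nat_pow_distrib B.nat_pow_inv)
      then have "inv\<^bsub>B\<^esub> (x1 [^]\<^bsub>B\<^esub> n) \<in> N" using S.powM[OF k] by metis
      then have "inv\<^bsub>B\<^esub> x1 \<in> N" using S.inv_pow_in n by simp
      then show False using x(2) ex by simp
    qed
  qed
  let ?X = "{\<one>, u, x}"
  have X: "?X \<in> Pset A M" using u x by (simp add: Pset_def)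
  obtain m where m: "m \<in> f ?X" "ext u \<otimes>\<^bsub>B\<^esub> m \<in> f ?X" "ext x \<otimes>\<^bsub>B\<^esub> m \<in> f ?X"
    by (rule triple_image[OF u(1) \<open>x \<in> M\<close>])
  have [simp]: "m \<in> carrier B" using m Pset_B_carrier[OF X] by auto
  have nu2: "\<not> (x \<otimes> t = s \<and> t \<in> M \<and> s \<in> M \<and> inv s \<in> M)" for s t
  proof
    assume a: "x \<otimes> t = s \<and> t \<in> M \<and> s \<in> M \<and> inv s \<in> M"
    then have "(inv s \<otimes> t) \<otimes> x = inv s \<otimes> (x \<otimes> t)"
      by (simp only: A.m_assoc A.inv_closed M.mem_carrier \<open>x \<in> carrier A\<close> A.m_comm[of t x])
    also have "\<dots> = \<one>" using a by simp
    finally have "inv x = inv s \<otimes> t" using a by (intro A.inv_equality) auto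
    then show False using a nu by simp
  qed
  have all: "k \<in> {m, ext u \<otimes>\<^bsub>B\<^esub> m, ext x \<otimes>\<^bsub>B\<^esub> m}" if kX: "k \<in> f ?X" for k
  proof (rule ccontr)
    assume k: "k \<notin> {m, ext u \<otimes>\<^bsub>B\<^esub> m, ext x \<otimes>\<^bsub>B\<^esub> m}"
    obtain q q' where q: "q \<in> ?X" "q' \<in> ?X" "x \<otimes> q' \<in> ?X" "q \<noteq> q'" "q \<noteq> x \<otimes> q'"
        "k = ext (q \<otimes> inv q') \<otimes>\<^bsub>B\<^esub> m"
      by (rule triple_swap[OF X kX m(1) m(3)]) (use k in auto)
    have q'M: "q' \<in> M" using q(2) u x by auto
    have "x \<otimes> q' \<noteq> \<one>" using nu2[of q' "\<one>"] q'M by auto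
    moreover have "x \<otimes> q' \<noteq> u" using nu2[of q' u] q'M u by auto
    ultimately have "x \<otimes> q' = x" using q(3) by auto
    then have "q' = \<one>" using q'M by simp
    then have "q = u" using q by auto
    then have "k = ext u \<otimes>\<^bsub>B\<^esub> m" using q(6) \<open>q' = \<one>\<close> by simp
    then show False using k by simp
  qed
  then have fX: "f ?X = {m, ext u \<otimes>\<^bsub>B\<^esub> m, ext x \<otimes>\<^bsub>B\<^esub> m}" using m by blast
  have fN: "f ?X \<subseteq> N" using f_in[OF X] by (auto simp: Pset_def)
  have "\<one>\<^bsub>B\<^esub> = m \<or> \<one>\<^bsub>B\<^esub> = ext u \<otimes>\<^bsub>B\<^esub> m \<or> \<one>\<^bsub>B\<^esub> = ext x \<otimes>\<^bsub>B\<^esub> m"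
    using all[OF one_in_f[OF X]] by blast
  then have "\<one>\<^bsub>B\<^esub> = ext x \<otimes>\<^bsub>B\<^esub> m"
  proof (elim disjE)
    assume "\<one>\<^bsub>B\<^esub> = m"
    then show ?thesis using m fN x(2) by auto
  next
    assume "\<one>\<^bsub>B\<^esub> = ext u \<otimes>\<^bsub>B\<^esub> m"
    then have "m = inv\<^bsub>B\<^esub> (ext u)" using B.inv_equality[of m "ext u"] by (simp add: B.m_comm)
    then have "ext (x \<otimes> inv u) \<in> N" using m fN by auto
    then show ?thesis using n by blast
  qed simp
  then have "m = inv\<^bsub>B\<^esub> (ext x)" using B.inv_equality[of m "ext x"] by (simp add: B.m_comm)
  then show "f ?X = {\<one>\<^bsub>B\<^esub>, ext (inv x), ext (u \<otimes> inv x)}" unfolding fX by auto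
qed

text \<open>\<open>unit_triple_image\<close> applies to \<open>(u, x)\<close> and again to
  \<open>(u^-1, x u^-1)\<close>, with the same image. By injectivity the two triples coincide, which
  a unit other than 1 does not allow.\<close>

lemma ext_in_if_unit:
  assumes u: "u \<in> M" "inv u \<in> M" "u \<noteq> \<one>" and x: "x \<in> Minf"
  shows "ext x \<in> N"
proof (rule ccontr)
  assume nN: "ext x \<notin> N"
  have [simp]: "x \<in> carrier A" "u \<in> carrier A" "x \<in> M" using u x by auto
  have nu: "inv x \<notin> M" using unit_image[OF x] nN by blast
  let ?x = "x \<otimes> inv u"
  note T = unit_triple_image[OF u x nN]
  have x'M: "?x \<in> M" using u x by simp
  have nu': "inv ?x \<notin> M"
  proof
    assume "inv ?x \<in> M"
    then have "inv ?x \<otimes> inv u \<in> M" using u by simp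
    then show False using nu by (simp add: A.inv_mult A.m_assoc)
  qed
  have x': "?x \<in> Minf" using aperiodic_if_not_unit x'M nu' by blast
  have "f {\<one>, inv u, ?x} = {\<one>\<^bsub>B\<^esub>, ext (inv ?x), ext (inv u \<otimes> inv ?x)}"
    using u by (intro unit_triple_image x' T(1)) auto
  also have "inv ?x = u \<otimes> inv x" by (simp add: A.inv_mult A.m_comm)
  also have "inv u \<otimes> (u \<otimes> inv x) = inv x" by (simp add: A.m_assoc[symmetric])
  finally have "f {\<one>, inv u, ?x} = f {\<one>, u, x}" using T(2) by (simp add: insert_commute)
  moreover have "{\<one>, inv u, ?x} \<in> Pset A M" "{\<one>, u, x} \<in> Pset A M" using u x x'M by (simp_all add: Pset_def)
  ultimately have "{\<one>, inv u, ?x} = {\<one>, u, x}" using f_inj by simp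
  then have "?x = \<one> \<or> ?x = u \<or> ?x = x" by blast
  then show False
  proof (elim disjE)
    assume "?x = \<one>" then show False using nu' by simp
  next
    assume "?x = u" then show False using nu' u by simp
  next
    assume "?x = x" then show False using u by simp
  qed
qed

text \<open>The powers of \<open>{1, t}\<close>, hence those of its image, become stationary. An
  element of the image without an inverse in \<open>N\<close> would have infinitely many powers in a
  finite set. So the image consists of units of \<open>N\<close>, and \<open>ext t\<close> is a
  quotient of two of them.\<close>

lemma ext_in_if_torsion:
  assumes t: "t \<in> M" "\<not> aperiodic A t"
  shows "ext t \<in> N"
proof -
  interpret S: power_iso B A N M f' f by (rule swap)
  have [simp]: "t \<in> carrier A" using t by simp
  let ?X = "{\<one>, t}"
  have X: "?X \<in> Pset A M" using t by (simp add: pair_in)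
  obtain n where n: "n > 0" "t [^] (n::nat) = \<one>" using t by (auto simp: aperiodic_def)
  then obtain m where m: "n = Suc m" by (cases n) auto
  have "t [^] (0::nat) \<in> (\<lambda>i. t [^] (i::nat)) ` {..m}" by (rule imageI) simp
  then have "spow A ?X (Suc m) = spow A ?X m"
    using n m unfolding A.spow_pair[OF \<open>t \<in> carrier A\<close>] atMost_Suc image_insert by auto
  then have W: "f ?X <#>\<^bsub>B\<^esub> spow B (f ?X) m = spow B (f ?X) m"
    using f_spow[OF X, of "Suc m"] f_spow[OF X, of m] by simp
  have WP: "spow B (f ?X) m \<in> Pset B N" by (rule B.Pset_spow[OF subN f_in[OF X]])
  have tors: "inv\<^bsub>B\<^esub> p \<in> N" if p: "p \<in> f ?X" for p
  proof (rule ccontr)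
    assume nN: "inv\<^bsub>B\<^esub> p \<notin> N"
    have pN: "p \<in> N" using p f_in[OF X] by (auto simp: Pset_def)
    then have ap: "p \<in> S.Minf" using S.aperiodic_if_not_unit nN by blast
    have "p [^]\<^bsub>B\<^esub> (i::nat) \<in> spow B (f ?X) m" for i
    proof (induction i)
      case 0 then show ?case using WP by (simp add: Pset_def)
    next
      case (Suc i)
      have "p \<otimes>\<^bsub>B\<^esub> p [^]\<^bsub>B\<^esub> i \<in> f ?X <#>\<^bsub>B\<^esub> spow B (f ?X) m"
        using p Suc by (intro set_multI) auto
      then show ?case using W pN by (simp add: B.m_comm)
    qed
    then have "range (\<lambda>i::nat. p [^]\<^bsub>B\<^esub> i) \<subseteq> spow B (f ?X) m" by blast
    then have "finite (range (\<lambda>i::nat. p [^]\<^bsub>B\<^esub> i))" using WP finite_subset by (auto simp: Pset_def)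
    moreover have "inj (\<lambda>i::nat. p [^]\<^bsub>B\<^esub> i)"
      using B.aperiodic_nat_pow_eq[of p] ap by (auto intro!: injI)
    ultimately show False using finite_imageD by blast
  qed
  obtain p q where p: "p \<in> f ?X" "q \<in> f ?X" "p = ext (t \<otimes> inv \<one>) \<otimes>\<^bsub>B\<^esub> q"
    using triple_transfer[OF X insertI2[OF insertI1] insertI1 insertI1] by blast
  have fN: "f ?X \<subseteq> N" using f_in[OF X] by (auto simp: Pset_def)
  have "p \<otimes>\<^bsub>B\<^esub> inv\<^bsub>B\<^esub> q \<in> N" using p tors fN by auto
  moreover have "q \<in> carrier B" using p fN by auto
  ultimately show ?thesis using p(3) by (simp add: B.m_assoc)
qed

lemma ext_in:
  assumes u: "u \<in> M" "inv u \<in> M" "u \<noteq> \<one>" and x: "x \<in> M"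
  shows "ext x \<in> N"
  using ext_in_if_torsion[OF x] ext_in_if_unit[OF u, of x] x unfolding Minf_def by blast

text \<open>\<open>ext u\<close> is again a nontrivial unit, now of \<open>N\<close>, so
  \<open>ext_in\<close> holds in the opposite direction as well.\<close>

lemma iso_if_unit:
  assumes u: "u \<in> M" "inv u \<in> M" "u \<noteq> \<one>"
  shows "ext \<in> iso (A\<lparr>carrier := M\<rparr>) (B\<lparr>carrier := N\<rparr>)"
proof -
  interpret S: power_iso B A N M f' f by (rule swap)
  have "ext u \<noteq> \<one>\<^bsub>B\<^esub>" using ext_inj[of u "\<one>"] u by auto
  moreover have "ext u \<in> N" "inv\<^bsub>B\<^esub> (ext u) \<in> N" using ext_in[OF u u(1)] ext_in[OF u u(2)] u by auto
  ultimately have "S.ext y \<in> M" if "y \<in> N" for y using S.ext_in that by blast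
  then have "y \<in> ext ` M" if "y \<in> N" for y using S.ext_swap[of y] that by (metis imageI N.mem_carrier)
  then have "ext ` M = N" using ext_in[OF u] by blast
  moreover have "inj_on ext M" using ext_inj by (auto intro!: inj_onI)
  ultimately show ?thesis by (auto simp: iso_def hom_def bij_betw_def)
qed

theorem power_iso_classification:
  "A\<lparr>carrier := M\<rparr> \<cong> B\<lparr>carrier := N\<rparr> \<or>
   (\<forall>x\<in>M. inv x \<in> M \<longrightarrow> x = \<one>) \<and> (\<forall>x\<in>N. inv\<^bsub>B\<^esub> x \<in> N \<longrightarrow> x = \<one>\<^bsub>B\<^esub>) \<and>
   (\<exists>K. submonoid K A \<and> B\<lparr>carrier := N\<rparr> \<cong> A\<lparr>carrier := K\<rparr> \<and> (\<forall>x\<in>K. inv x \<in> K \<longrightarrow> x = \<one>) \<and>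
      (\<forall>x\<in>M. x \<in> K \<or> inv x \<in> K) \<and> (\<forall>x\<in>K. x \<in> M \<or> inv x \<in> M) \<and>
      (\<forall>x\<in>M. \<forall>y\<in>M. x \<otimes> inv y \<notin> M \<longrightarrow> y \<otimes> inv x \<notin> M \<longrightarrow> x \<in> K))"
proof -
  interpret S: power_iso B A N M f' f by (rule swap)
  show ?thesis
  proof (cases "(\<exists>u\<in>M. inv u \<in> M \<and> u \<noteq> \<one>) \<or> (\<exists>u\<in>N. inv\<^bsub>B\<^esub> u \<in> N \<and> u \<noteq> \<one>\<^bsub>B\<^esub>)")
    case True
    then have "A\<lparr>carrier := M\<rparr> \<cong> B\<lparr>carrier := N\<rparr>"
    proof
      assume "\<exists>u\<in>M. inv u \<in> M \<and> u \<noteq> \<one>"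
      then show ?thesis using iso_if_unit unfolding is_iso_def by blast
    next
      assume "\<exists>u\<in>N. inv\<^bsub>B\<^esub> u \<in> N \<and> u \<noteq> \<one>\<^bsub>B\<^esub>"
      then have "S.ext \<in> iso (B\<lparr>carrier := N\<rparr>) (A\<lparr>carrier := M\<rparr>)" using S.iso_if_unit by blast
      then have im: "S.ext ` N = M" by (auto simp: iso_def bij_betw_def)
      have "ext (S.ext y) = y" if "y \<in> N" for y using S.ext_swap[of y] that by simp
      then have "(\<lambda>y. ext (S.ext y)) ` N = N" by simp
      then have "ext ` (S.ext ` N) = N" unfolding image_image .
      then have "ext ` M = N" unfolding im .
      moreover have "inj_on ext M" using ext_inj by (auto intro!: inj_onI)
      ultimately have "ext \<in> iso (A\<lparr>carrier := M\<rparr>) (B\<lparr>carrier := N\<rparr>)"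
        by (auto simp: iso_def hom_def bij_betw_def)
      then show ?thesis unfolding is_iso_def by blast
    qed
    then show ?thesis ..
  next
    case False
    then have redM: "\<And>x. x \<in> M \<Longrightarrow> inv x \<in> M \<Longrightarrow> x = \<one>"
      and redN: "\<And>x. x \<in> N \<Longrightarrow> inv\<^bsub>B\<^esub> x \<in> N \<Longrightarrow> x = \<one>\<^bsub>B\<^esub>" by blast+
    \<comment> \<open>A copy of \<open>N\<close> inside the quotient group of \<open>M\<close>,
      which agrees with \<open>M\<close> up to inverting elements.\<close>
    define K where "K = {x \<in> carrier A. ext x \<in> N}"
    have KS: "K = S.ext ` N"
    proof (intro equalityI subsetI)
      fix x assume "x \<in> K"
      then have "x = S.ext (ext x)" "ext x \<in> N" using ext_swap by (simp_all add: K_def)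
      then show "x \<in> S.ext ` N" by blast
    next
      fix x assume "x \<in> S.ext ` N"
      then obtain y where "y \<in> N" "x = S.ext y" by blast
      then show "x \<in> K" using S.ext_swap[of y] by (simp add: K_def)
    qed
    have "S.ext \<in> iso (B\<lparr>carrier := N\<rparr>) (A\<lparr>carrier := K\<rparr>)"
      using S.ext_inj by (auto simp: iso_def hom_def bij_betw_def KS intro!: inj_onI)
    then have K1: "B\<lparr>carrier := N\<rparr> \<cong> A\<lparr>carrier := K\<rparr>" unfolding is_iso_def by blast
    have K2: "submonoid K A" by (auto simp: K_def intro!: submonoid.intro)
    have K3: "x = \<one>" if "x \<in> K" "inv x \<in> K" for x
      using that redN[of "ext x"] ext_inj[of x "\<one>"] by (auto simp: K_def)
    have K4: "x \<in> K \<or> inv x \<in> K" if "x \<in> M" for x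
    proof (cases "x = \<one>")
      case False
      then have "x \<in> Minf" using aperiodic_if_not_unit redM that by blast
      then obtain b where b: "rel x b" using rel_img by (meson MinfD)
      then show ?thesis using ext_cases[OF b] relD[OF b] that by (auto simp: K_def)
    qed (simp add: K_def)
    have K5: "x \<in> M \<or> inv x \<in> M" if x: "x \<in> K" for x
    proof -
      obtain y where y: "y \<in> N" "x = S.ext y" using x KS by blast
      show ?thesis
      proof (cases "y = \<one>\<^bsub>B\<^esub>")
        case False
        then have "y \<in> S.Minf" using S.aperiodic_if_not_unit redN y by blast
        then obtain b where b: "S.rel y b" using S.rel_img by (meson S.MinfD)
        then show ?thesis using S.ext_cases[OF b] S.relD[OF b] y by auto
      qed (use y in simp)
    qed
    have K6: "x \<in> K" if "x \<in> M" "y \<in> M" "x \<otimes> inv y \<notin> M" "y \<otimes> inv x \<notin> M" for x y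
      using incomparable_image[OF redM redN that] that by (simp add: K_def)
    show ?thesis
    proof (rule disjI2, intro conjI exI[of _ K] ballI impI K1 K2)
      show "x = \<one>" if "x \<in> M" "inv x \<in> M" for x using redM that .
      show "x = \<one>\<^bsub>B\<^esub>" if "x \<in> N" "inv\<^bsub>B\<^esub> x \<in> N" for x using redN that .
      show "x = \<one>" if "x \<in> K" "inv x \<in> K" for x using K3 that .
      show "x \<in> K \<or> inv x \<in> K" if "x \<in> M" for x using K4 that .
      show "x \<in> M \<or> inv x \<in> M" if "x \<in> K" for x using K5 that .
      show "x \<in> K" if "x \<in> M" "y \<in> M" "x \<otimes> inv y \<notin> M" "y \<otimes> inv x \<notin> M" for x y
        using K6 that .
    qed
  qed
qed

end

section \<open>Pseudo-units and orders\<close>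

context comm_group
begin

definition pseudo :: "'a set \<Rightarrow> 'a set" where
  "pseudo M = {a \<in> M. \<forall>b\<in>M. a \<otimes> inv b \<in> M \<or> b \<otimes> inv a \<in> M}"

text \<open>Positive cones of the translation invariant total orders on \<open>L\<close>.\<close>
definition cone :: "'a set \<Rightarrow> 'a set \<Rightarrow> bool" where
  "cone L C \<longleftrightarrow> submonoid C G \<and> C \<subseteq> L \<and> (\<forall>x\<in>L. x \<in> C \<or> inv x \<in> C) \<and> (\<forall>x\<in>C. inv x \<in> C \<longrightarrow> x = \<one>)"

lemma fractions_subgroup:
  assumes "submonoid V G"
  shows "subgroup (fractions G V) G"
proof
  interpret V: submonoid V G by fact
  show "fractions G V \<subseteq> carrier G" by (auto simp: fractions_def)
  have "\<one> = \<one> \<otimes> inv \<one>" by simp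
  then show "\<one> \<in> fractions G V" using V.one_closed unfolding fractions_def by blast
  fix x y assume "x \<in> fractions G V" "y \<in> fractions G V"
  then obtain a b c d where h: "a \<in> V" "b \<in> V" "c \<in> V" "d \<in> V" "x = a \<otimes> inv b" "y = c \<otimes> inv d"
    by (auto simp: fractions_def)
  then have "x \<otimes> y = (a \<otimes> c) \<otimes> inv (b \<otimes> d)" by (simp add: inv_mult m_ac)
  then show "x \<otimes> y \<in> fractions G V" using h V.m_closed unfolding fractions_def by blast
next
  interpret V: submonoid V G by fact
  fix x assume "x \<in> fractions G V"
  then obtain a b where h: "a \<in> V" "b \<in> V" "x = a \<otimes> inv b" by (auto simp: fractions_def)
  then have "inv x = b \<otimes> inv a" by (simp add: inv_mult m_comm)
  then show "inv x \<in> fractions G V" using h unfolding fractions_def by blast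
qed

context
  fixes M
  assumes M: "submonoid M G"
begin

interpretation M: submonoid M G by (rule M)

section \<open>Pseudo-units and the group they generate\<close>

lemma pseudo_divisor_closed:
  assumes "a \<in> M" "h \<in> M" "a \<otimes> h \<in> pseudo M"
  shows "a \<in> pseudo M"
proof -
  have [simp]: "a \<in> carrier G" "h \<in> carrier G" using assms by auto
  have "a \<otimes> inv b \<in> M \<or> b \<otimes> inv a \<in> M" if b: "b \<in> M" for b
  proof -
    have [simp]: "b \<in> carrier G" using b by simp
    have "(a \<otimes> h) \<otimes> inv (b \<otimes> h) = a \<otimes> inv b" "(b \<otimes> h) \<otimes> inv (a \<otimes> h) = b \<otimes> inv a"
      by (simp_all add: inv_mult m_ac)
    then show ?thesis using assms(3) M.m_closed[OF b assms(2)] unfolding pseudo_def by fastforce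
  qed
  then show ?thesis using assms by (simp add: pseudo_def)
qed

text \<open>An element \<open>b\<close> is compared with \<open>a\<close> first; if \<open>a\<close>
  divides \<open>b\<close>, then \<open>b / a\<close> is an element of \<open>M\<close> and can be
  compared with \<open>a'\<close>.\<close>

lemma pseudo_submonoid: "submonoid (pseudo M) G"
proof
  show "pseudo M \<subseteq> carrier G" using M.subset by (auto simp: pseudo_def)
  show "\<one> \<in> pseudo M" by (simp add: pseudo_def)
  fix a a' assume a: "a \<in> pseudo M" "a' \<in> pseudo M"
  then have aM: "a \<in> M" "a' \<in> M" by (simp_all add: pseudo_def)
  then have [simp]: "a \<in> carrier G" "a' \<in> carrier G" by auto
  have "(a \<otimes> a') \<otimes> inv b \<in> M \<or> b \<otimes> inv (a \<otimes> a') \<in> M" if b: "b \<in> M" for b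
  proof -
    have [simp]: "b \<in> carrier G" using b by simp
    consider "a \<otimes> inv b \<in> M" | "b \<otimes> inv a \<in> M" using a b by (auto simp: pseudo_def)
    then show ?thesis
    proof cases
      case 1
      then have "(a \<otimes> inv b) \<otimes> a' \<in> M" using aM by simp
      then show ?thesis by (simp add: m_ac)
    next
      case 2
      then have "a' \<otimes> inv (b \<otimes> inv a) \<in> M \<or> (b \<otimes> inv a) \<otimes> inv a' \<in> M" using a(2) by (simp add: pseudo_def)
      then show ?thesis by (simp add: inv_mult m_ac)
    qed
  qed
  then show "a \<otimes> a' \<in> pseudo M" using aM by (simp add: pseudo_def)
qed

lemma pseudo_sub_fractions: "pseudo M \<subseteq> fractions G (pseudo M)"
proof
  interpret V: submonoid "pseudo M" G by (rule pseudo_submonoid)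
  fix x assume "x \<in> pseudo M"
  then have "x = x \<otimes> inv \<one>" "x \<in> pseudo M" "\<one> \<in> pseudo M" by auto
  then show "x \<in> fractions G (pseudo M)" unfolding fractions_def by blast
qed

text \<open>\<open>x = u / v\<close> means \<open>x v = u\<close>, so \<open>x\<close> divides a
  pseudo-unit.\<close>

lemma fractions_pseudo_inter: "x \<in> M \<Longrightarrow> x \<in> fractions G (pseudo M) \<Longrightarrow> x \<in> pseudo M"
proof -
  interpret V: submonoid "pseudo M" G by (rule pseudo_submonoid)
  assume x: "x \<in> M" "x \<in> fractions G (pseudo M)"
  then obtain u v where uv: "u \<in> pseudo M" "v \<in> pseudo M" "x = u \<otimes> inv v" by (auto simp: fractions_def)
  then have "x \<otimes> v = u" using x by (simp add: eq_div_iff)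
  then show ?thesis using pseudo_divisor_closed[of x v] uv x by (simp add: pseudo_def)
qed

text \<open>Write \<open>l = u / v\<close>. The pseudo-unit \<open>v\<close> is comparable with
  \<open>w u\<close>. If \<open>w u\<close> divided \<open>v\<close>, then \<open>w\<close> would
  divide a pseudo-unit and be one itself; hence \<open>v\<close> divides \<open>w u\<close>.\<close>

lemma nonpseudo_mult_fraction:
  assumes w: "w \<in> M" "w \<notin> pseudo M" and l: "l \<in> fractions G (pseudo M)"
  shows "w \<otimes> l \<in> M" "w \<otimes> l \<notin> pseudo M"
proof -
  interpret V: submonoid "pseudo M" G by (rule pseudo_submonoid)
  obtain u v where uv: "u \<in> pseudo M" "v \<in> pseudo M" "l = u \<otimes> inv v" using l by (auto simp: fractions_def)
  have uvM: "u \<in> M" "v \<in> M" using uv by (simp_all add: pseudo_def)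
  have [simp]: "w \<in> carrier G" "u \<in> carrier G" "v \<in> carrier G" using w uv by auto
  have wu: "w \<otimes> u \<in> M" using w uvM by simp
  have "v \<otimes> inv (w \<otimes> u) \<notin> M"
  proof
    assume c: "v \<otimes> inv (w \<otimes> u) \<in> M"
    have "w \<otimes> (u \<otimes> (v \<otimes> inv (w \<otimes> u))) = (w \<otimes> u) \<otimes> inv (w \<otimes> u) \<otimes> v"
      by (simp only: m_ac m_closed inv_closed \<open>w \<in> carrier G\<close> \<open>u \<in> carrier G\<close> \<open>v \<in> carrier G\<close>)
    then have "w \<otimes> (u \<otimes> (v \<otimes> inv (w \<otimes> u))) = v" by simp
    then show False using pseudo_divisor_closed[of w "u \<otimes> (v \<otimes> inv (w \<otimes> u))"] w uv c uvM by simp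
  qed
  then have "(w \<otimes> u) \<otimes> inv v \<in> M" using uv(2) wu by (auto simp: pseudo_def)
  then show 1: "w \<otimes> l \<in> M" by (simp add: uv m_assoc)
  show "w \<otimes> l \<notin> pseudo M"
  proof
    assume "w \<otimes> l \<in> pseudo M"
    then have "(w \<otimes> l) \<otimes> v \<in> pseudo M" using uv by simp
    moreover have "(w \<otimes> l) \<otimes> v = w \<otimes> u" by (simp add: uv m_assoc)
    ultimately show False using pseudo_divisor_closed[of w u] w uvM by simp
  qed
qed

lemma nonpseudo_mult:
  assumes "w \<in> M" "w \<notin> pseudo M" "w' \<in> M"
  shows "w \<otimes> w' \<in> M" "w \<otimes> w' \<notin> pseudo M"
  using assms pseudo_divisor_closed[of w w'] by auto

text \<open>For reduced \<open>M\<close> this makes \<open>pseudo M\<close> a cone of the group it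
  generates.\<close>

lemma pseudo_comparable:
  assumes "x \<in> fractions G (pseudo M)"
  shows "x \<in> pseudo M \<or> inv x \<in> pseudo M"
proof -
  interpret L: subgroup "fractions G (pseudo M)" G by (rule fractions_subgroup[OF pseudo_submonoid])
  obtain u v where uv: "u \<in> pseudo M" "v \<in> pseudo M" "x = u \<otimes> inv v"
    using assms by (auto simp: fractions_def)
  have [simp]: "u \<in> carrier G" "v \<in> carrier G" using uv M.subset by (auto simp: pseudo_def)
  have "inv x = v \<otimes> inv u" by (simp add: uv inv_mult m_comm)
  then have "x \<in> M \<or> inv x \<in> M" using uv by (auto simp: pseudo_def)
  then show ?thesis using fractions_pseudo_inter assms by auto
qed

text \<open>An element of \<open>M\<close> that is not a pseudo-unit has an incomparable partner, so
  \<open>inc\<close> puts it into \<open>K\<close>. The freedom to invert elements is thus confined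
  to the group generated by the pseudo-units.\<close>

lemma reorientation:
  assumes K: "submonoid K G" and red: "\<And>x. x \<in> K \<Longrightarrow> inv x \<in> K \<Longrightarrow> x = \<one>"
    and MK: "\<And>x. x \<in> M \<Longrightarrow> x \<in> K \<or> inv x \<in> K" and KM: "\<And>x. x \<in> K \<Longrightarrow> x \<in> M \<or> inv x \<in> M"
    and inc: "\<And>x y. x \<in> M \<Longrightarrow> y \<in> M \<Longrightarrow> x \<otimes> inv y \<notin> M \<Longrightarrow> y \<otimes> inv x \<notin> M \<Longrightarrow> x \<in> K"
  shows "cone (fractions G (pseudo M)) (K \<inter> fractions G (pseudo M))"
    "(M - pseudo M) \<union> (K \<inter> fractions G (pseudo M)) = K"
proof -
  let ?L = "fractions G (pseudo M)"
  interpret K: submonoid K G by fact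
  interpret L: subgroup ?L G by (rule fractions_subgroup[OF pseudo_submonoid])
  have "x \<in> K \<or> inv x \<in> K" if "x \<in> ?L" for x
  proof -
    have "x \<in> M \<or> inv x \<in> M" using pseudo_comparable[OF that] by (auto simp: pseudo_def)
    then show ?thesis using MK[of x] MK[of "inv x"] that by auto
  qed
  moreover have "submonoid (K \<inter> ?L) G" by unfold_locales auto
  ultimately show "cone ?L (K \<inter> ?L)" unfolding cone_def using red L.m_inv_closed by blast
  have WK: "w \<in> K" if w: "w \<in> M" "w \<notin> pseudo M" for w
  proof -
    obtain b where "b \<in> M" "w \<otimes> inv b \<notin> M" "b \<otimes> inv w \<notin> M" using w unfolding pseudo_def by blast
    then show ?thesis using inc w by blast
  qed
  have "k \<in> M - pseudo M \<or> k \<in> ?L" if k: "k \<in> K" for k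
  proof (cases "k \<in> M")
    case True
    then show ?thesis using pseudo_sub_fractions by blast
  next
    case False
    then have ik: "inv k \<in> M" using KM k by blast
    show ?thesis
    proof (cases "inv k \<in> pseudo M")
      case True
      then have "inv (inv k) \<in> ?L" using pseudo_sub_fractions by blast
      then show ?thesis using k by simp
    next
      case False
      \<comment> \<open>By \<open>WK\<close> the inverse of \<open>k\<close> lies in
        \<open>K\<close> together with \<open>k\<close>, so \<open>red\<close> applies.\<close>
      then have "k = \<one>" using WK ik red k by blast
      then show ?thesis by simp
    qed
  qed
  then show "(M - pseudo M) \<union> (K \<inter> ?L) = K" using WK by blast
qed

end

text \<open>The minimum for the order in which \<open>u\<close> precedes \<open>s\<close> when
  \<open>s / u\<close> lies in \<open>C\<close>.\<close>

definition least :: "'a set \<Rightarrow> 'a set \<Rightarrow> 'a" where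
  "least C S = (THE u. u \<in> S \<and> (\<forall>s\<in>S. s \<otimes> inv u \<in> C))"

lemma cone_one: "cone L C \<Longrightarrow> \<one> \<in> C"
  by (auto simp: cone_def dest: submonoid.one_closed)

lemma least_eqI:
  assumes C: "cone L C" and S: "S \<subseteq> carrier G" and u: "u \<in> S" "\<And>s. s \<in> S \<Longrightarrow> s \<otimes> inv u \<in> C"
  shows "least C S = u"
  unfolding least_def
proof (rule the_equality)
  show "u \<in> S \<and> (\<forall>s\<in>S. s \<otimes> inv u \<in> C)" using u by blast
  fix v assume v: "v \<in> S \<and> (\<forall>s\<in>S. s \<otimes> inv v \<in> C)"
  have [simp]: "u \<in> carrier G" "v \<in> carrier G" using u v S by auto
  have "inv (u \<otimes> inv v) = v \<otimes> inv u" by (simp add: inv_mult m_comm)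
  then have "u \<otimes> inv v = \<one>" using u v C unfolding cone_def by metis
  then show "v = u" by (simp add: div_eq_iff)
qed

lemma least_exists:
  assumes L: "subgroup L G" and C: "cone L C" and S: "finite S" "S \<noteq> {}" "S \<subseteq> L"
  shows "\<exists>u\<in>S. \<forall>s\<in>S. s \<otimes> inv u \<in> C"
  using S
proof (induction S rule: finite_ne_induct)
  interpret L: subgroup L G by fact
  case (singleton x)
  then show ?case using cone_one[OF C] by simp
next
  interpret L: subgroup L G by fact
  interpret C: submonoid C G using C by (simp add: cone_def)
  case (insert x S)
  then obtain u where u: "u \<in> S" "\<forall>s\<in>S. s \<otimes> inv u \<in> C" by auto
  have [simp]: "u \<in> carrier G" "x \<in> carrier G" "\<And>s. s \<in> S \<Longrightarrow> s \<in> carrier G" using insert u by auto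
  have "x \<otimes> inv u \<in> L" using insert u by auto
  then consider "x \<otimes> inv u \<in> C" | "inv (x \<otimes> inv u) \<in> C" using C by (auto simp: cone_def)
  then show ?case
  proof cases
    case 1 then show ?thesis using u by blast
  next
    case 2
    then have ux: "u \<otimes> inv x \<in> C" by (simp add: inv_mult m_comm)
    have "s \<otimes> inv x \<in> C" if "s \<in> insert x S" for s
    proof (cases "s = x")
      case True then show ?thesis using cone_one[OF C] by simp
    next
      case False
      then have "(s \<otimes> inv u) \<otimes> (u \<otimes> inv x) \<in> C" using u ux that by simp
      moreover have "s \<in> carrier G" using that by auto
      then have "(s \<otimes> inv u) \<otimes> (u \<otimes> inv x) = s \<otimes> (inv u \<otimes> u) \<otimes> inv x"
        by (simp only: m_assoc m_closed inv_closed \<open>u \<in> carrier G\<close> \<open>x \<in> carrier G\<close>)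
      ultimately show ?thesis using \<open>s \<in> carrier G\<close> by simp
    qed
    then show ?thesis by blast
  qed
qed

lemma least_props:
  assumes L: "subgroup L G" and C: "cone L C" and S: "finite S" "S \<noteq> {}" "S \<subseteq> L"
  shows "least C S \<in> S" "\<And>s. s \<in> S \<Longrightarrow> s \<otimes> inv (least C S) \<in> C"
proof -
  interpret L: subgroup L G by fact
  obtain u where u: "u \<in> S" "\<forall>s\<in>S. s \<otimes> inv u \<in> C" using least_exists[OF assms] by blast
  have "least C S = u" using S u by (intro least_eqI[OF C]) auto
  then show "least C S \<in> S" "\<And>s. s \<in> S \<Longrightarrow> s \<otimes> inv (least C S) \<in> C" using u by auto
qed

definition rebase :: "'a set \<Rightarrow> 'a set \<Rightarrow> 'a set \<Rightarrow> 'a set" where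
  "rebase L C X = {inv (least C (X \<inter> L))} <#> X"

context
  fixes L W
  assumes L: "subgroup L G"
    and W: "W \<subseteq> carrier G" "W \<inter> L = {}" "\<And>w l. w \<in> W \<Longrightarrow> l \<in> L \<Longrightarrow> w \<otimes> l \<in> W"
      "\<And>w w'. w \<in> W \<Longrightarrow> w' \<in> W \<Longrightarrow> w \<otimes> w' \<in> W"
begin

interpretation L: subgroup L G by (rule L)

text \<open>With respect to \<open>V\<close>, the least element of \<open>X \<inter> L\<close> is 1,
  as \<open>X \<inter> L\<close> is contained in \<open>V\<close>. Division by \<open>u\<close>
  moves it to the inverse of \<open>u\<close>; this is why rebasing with \<open>V\<close> undoes
  rebasing with \<open>T\<close>.\<close>

lemma rebase_in:
  assumes V: "cone L V" and T: "cone L T" and X: "X \<in> Pset G (V \<union> W)"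
  shows "rebase L T X \<in> Pset G (T \<union> W)" "least V (rebase L T X \<inter> L) = inv (least T (X \<inter> L))"
    "least T (X \<inter> L) \<in> L"
proof -
  define u where "u = least T (X \<inter> L)"
  have XS: "finite X" "X \<subseteq> V \<union> W" "\<one> \<in> X" using X by (auto simp: Pset_def)
  have XL: "finite (X \<inter> L)" "X \<inter> L \<noteq> {}" "X \<inter> L \<subseteq> L" using XS by auto
  note u = least_props[OF L T XL, folded u_def]
  then have uL[simp]: "u \<in> L" "u \<in> carrier G" by auto
  then show "least T (X \<inter> L) \<in> L" by (simp add: u_def)
  have VL: "V \<subseteq> L" using V by (simp add: cone_def)
  then have XG: "X \<subseteq> carrier G" using XS(2) W(1) L.subset by blast
  have r: "rebase L T X = (\<lambda>x. x \<otimes> inv u) ` X"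
    unfolding rebase_def u_def[symmetric] set_mult_def using XG by (auto simp: m_comm subset_eq)
  have "x \<otimes> inv u \<in> T \<union> W" if x: "x \<in> X" for x
  proof (cases "x \<in> L")
    case True then show ?thesis using u x by auto
  next
    case False
    then have "x \<in> W" using XS(2) x VL by blast
    then show ?thesis using W(3) by auto
  qed
  moreover have "\<one> \<in> rebase L T X" unfolding r using u by (intro image_eqI[of _ _ u]) auto
  ultimately show "rebase L T X \<in> Pset G (T \<union> W)" using XS by (auto simp: r Pset_def)
  have inL: "y \<in> rebase L T X \<inter> L \<Longrightarrow> \<exists>x\<in>X \<inter> L. y = x \<otimes> inv u" for y
  proof -
    assume "y \<in> rebase L T X \<inter> L"
    then obtain x where x: "x \<in> X" "y = x \<otimes> inv u" "y \<in> L" by (auto simp: r)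
    then have "x = y \<otimes> u" using XG by (auto simp: m_assoc)
    then have "x \<in> L" using L.m_closed[OF x(3) uL(1)] by simp
    then show "\<exists>x\<in>X \<inter> L. y = x \<otimes> inv u" using x by blast
  qed
  show "least V (rebase L T X \<inter> L) = inv (least T (X \<inter> L))"
    unfolding u_def[symmetric]
  proof (rule least_eqI[OF V])
    show "rebase L T X \<inter> L \<subseteq> carrier G" by auto
    have "\<one> \<otimes> inv u \<in> rebase L T X" unfolding r using XS by blast
    then show "inv u \<in> rebase L T X \<inter> L" by simp
    fix s assume "s \<in> rebase L T X \<inter> L"
    then obtain x where x: "x \<in> X" "x \<in> L" "s = x \<otimes> inv u" using inL by blast
    then have "s \<otimes> inv (inv u) = x" by (simp add: m_assoc)
    moreover have "x \<in> V" using x XS(2) W(2) by blast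
    ultimately show "s \<otimes> inv (inv u) \<in> V" by simp
  qed
qed

lemma rebase_rebase:
  assumes V: "cone L V" and T: "cone L T" and X: "X \<in> Pset G (V \<union> W)"
  shows "rebase L V (rebase L T X) = X"
proof -
  note r = rebase_in[OF V T X]
  have "X \<subseteq> V \<union> W" "V \<subseteq> L" using X V by (simp_all add: cone_def Pset_def)
  then have XG: "X \<subseteq> carrier G" using W(1) L.subset by blast
  have [simp]: "least T (X \<inter> L) \<in> carrier G" using r(3) by simp
  have "rebase L V (rebase L T X) = {least T (X \<inter> L)} <#> rebase L T X"
    unfolding rebase_def[of L V] r(2) by simp
  also have "\<dots> = X" unfolding rebase_def using XG
    by (simp add: set_mult_assoc[symmetric] set_mult_singletons set_mult_one_left)
  finally show ?thesis .
qed

text \<open>A product lies in \<open>L\<close> only if both factors do, so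
  \<open>(X <#> Y) \<inter> L\<close> is the product of \<open>X \<inter> L\<close> and
  \<open>Y \<inter> L\<close>, and their least elements multiply.\<close>

lemma rebase_mult:
  assumes V: "cone L V" and T: "cone L T" and X: "X \<in> Pset G (V \<union> W)" and Y: "Y \<in> Pset G (V \<union> W)"
  shows "rebase L T (X <#> Y) = rebase L T X <#> rebase L T Y"
proof -
  interpret V: submonoid V G using V by (simp add: cone_def)
  interpret T: submonoid T G using T by (simp add: cone_def)
  define u where "u = least T (X \<inter> L)"
  define v where "v = least T (Y \<inter> L)"
  have XL: "finite (X \<inter> L)" "X \<inter> L \<noteq> {}" "X \<inter> L \<subseteq> L" "finite (Y \<inter> L)" "Y \<inter> L \<noteq> {}" "Y \<inter> L \<subseteq> L"
    using X Y by (auto simp: Pset_def)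
  note u = least_props[OF L T XL(1-3), folded u_def] and v = least_props[OF L T XL(4-6), folded v_def]
  have [simp]: "u \<in> L" "v \<in> L" "u \<in> carrier G" "v \<in> carrier G" using u v by auto
  have VL: "V \<subseteq> L" using V by (simp add: cone_def)
  have XS: "X \<subseteq> V \<union> W" "Y \<subseteq> V \<union> W" using X Y by (auto simp: Pset_def)
  have XG: "X \<subseteq> carrier G" "Y \<subseteq> carrier G" using XS VL W(1) L.subset by blast+
  \<comment> \<open>An element of \<open>W\<close> stays in \<open>W\<close> when multiplied by
    elements of \<open>L\<close> or \<open>W\<close>, and \<open>W\<close> does not meet
    \<open>L\<close>.\<close>
  have split: "x \<in> L \<and> y \<in> L" if "x \<in> X" "y \<in> Y" "x \<otimes> y \<in> L" for x y
  proof (rule ccontr)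
    assume "\<not> ?thesis"
    moreover have "x \<in> carrier G" "y \<in> carrier G" using that XG by auto
    moreover have "x \<in> W \<or> x \<in> L" "y \<in> W \<or> y \<in> L" using that XS VL by auto
    ultimately have "x \<otimes> y \<in> W" using W(3)[of x y] W(3)[of y x] W(4)[of x y] by (auto simp: m_comm)
    then show False using that W(2) by auto
  qed
  have "least T ((X <#> Y) \<inter> L) = u \<otimes> v"
  proof (rule least_eqI[OF T])
    show "(X <#> Y) \<inter> L \<subseteq> carrier G" by auto
    show "u \<otimes> v \<in> (X <#> Y) \<inter> L" using u v by (auto intro: set_multI)
    fix s assume "s \<in> (X <#> Y) \<inter> L"
    then obtain x y where xy: "x \<in> X" "y \<in> Y" "s = x \<otimes> y" "s \<in> L" by (auto simp: mem_set_mult_iff)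
    then have "x \<in> L" "y \<in> L" using split by auto
    then have "(x \<otimes> inv u) \<otimes> (y \<otimes> inv v) \<in> T" using u v xy by auto
    moreover have "s \<otimes> inv (u \<otimes> v) = (x \<otimes> inv u) \<otimes> (y \<otimes> inv v)"
      using xy \<open>x \<in> L\<close> \<open>y \<in> L\<close> by (simp add: inv_mult m_ac)
    ultimately show "s \<otimes> inv (u \<otimes> v) \<in> T" by simp
  qed
  then have "rebase L T (X <#> Y) = ({inv u} <#> {inv v}) <#> (X <#> Y)"
    unfolding rebase_def by (simp add: inv_mult set_mult_singletons)
  also have "\<dots> = ({inv u} <#> X) <#> ({inv v} <#> Y)"
    using XG by (simp add: set_mult_ac setmult_subset_G del: set_mult_singletons)
  also have "\<dots> = rebase L T X <#> rebase L T Y" by (simp add: rebase_def u_def v_def)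
  finally show ?thesis .
qed

lemma power_monoid_reorient:
  assumes V: "cone L V" and T: "cone L T"
  shows "power_monoid (G\<lparr>carrier := V \<union> W\<rparr>) \<cong> power_monoid (G\<lparr>carrier := T \<union> W\<rparr>)"
proof -
  have P: "carrier (power_monoid (G\<lparr>carrier := C\<rparr>)) = Pset G C" for C
    by (simp add: power_monoid_def Pset_def)
  have mult: "mult (power_monoid (G\<lparr>carrier := C\<rparr>)) = (\<lambda>X Y. X <#> Y)" for C
    by (simp add: power_monoid_def fun_eq_iff)
  have "bij_betw (rebase L T) (Pset G (V \<union> W)) (Pset G (T \<union> W))"
    using rebase_in(1)[OF V T] rebase_in(1)[OF T V] rebase_rebase[OF V T] rebase_rebase[OF T V]
    by (intro bij_betw_byWitness[of _ "rebase L V"]) auto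
  then have "rebase L T \<in> iso (power_monoid (G\<lparr>carrier := V \<union> W\<rparr>)) (power_monoid (G\<lparr>carrier := T \<union> W\<rparr>))"
    using rebase_mult[OF V T] rebase_in(1)[OF V T] by (auto simp: iso_def hom_def P mult)
  then show ?thesis unfolding is_iso_def by blast
qed

end

end

section \<open>Transport to the quotient group\<close>

lemma is_iso_sym:
  assumes "monoid G" "G \<cong> H"
  shows "H \<cong> G"
proof -
  interpret monoid G by fact
  obtain h where h: "h \<in> hom G H" "bij_betw h (carrier G) (carrier H)"
    using assms by (auto simp: is_iso_def iso_def)
  let ?i = "inv_into (carrier G) h"
  have hi: "h (?i y) = y" if "y \<in> carrier H" for y using h that by (simp add: bij_betw_inv_into_right)
  have ih: "?i (h x) = x" if "x \<in> carrier G" for x using h that by (simp add: bij_betw_inv_into_left)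
  have bij: "bij_betw ?i (carrier H) (carrier G)" using h by (simp add: bij_betw_inv_into)
  have ic: "?i y \<in> carrier G" if "y \<in> carrier H" for y using bij that by (auto simp: bij_betw_def)
  have "?i (x \<otimes>\<^bsub>H\<^esub> y) = ?i x \<otimes>\<^bsub>G\<^esub> ?i y" if "x \<in> carrier H" "y \<in> carrier H" for x y
  proof -
    have "h (?i x \<otimes>\<^bsub>G\<^esub> ?i y) = x \<otimes>\<^bsub>H\<^esub> y" using hom_mult[OF h(1)] that ic hi by simp
    then show ?thesis using ih[of "?i x \<otimes>\<^bsub>G\<^esub> ?i y"] that ic by simp
  qed
  then have "?i \<in> iso H G" using bij ic by (simp add: iso_def hom_def)
  then show ?thesis unfolding is_iso_def by blast
qed

text \<open>Membership in \<open>hom\<close> does not fix the identity of a monoid. Surjectivity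
  provides a preimage \<open>a\<close> of the identity of \<open>H\<close>, and \<open>a\<close>
  times the identity of \<open>G\<close> is \<open>a\<close>.\<close>

lemma iso_one:
  assumes "monoid G" "monoid H" "h \<in> iso G H"
  shows "h \<one>\<^bsub>G\<^esub> = \<one>\<^bsub>H\<^esub>"
proof -
  interpret G: monoid G by fact
  interpret H: monoid H by fact
  have h: "h \<in> hom G H" "h ` carrier G = carrier H" using assms(3) by (auto simp: iso_def bij_betw_def)
  obtain a where a: "a \<in> carrier G" "h a = \<one>\<^bsub>H\<^esub>" using h(2) H.one_closed by (metis imageE)
  have "h \<one>\<^bsub>G\<^esub> \<in> carrier H" using h(2) by blast
  moreover have "h (a \<otimes>\<^bsub>G\<^esub> \<one>\<^bsub>G\<^esub>) = h a \<otimes>\<^bsub>H\<^esub> h \<one>\<^bsub>G\<^esub>"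
    by (intro hom_mult[OF h(1)] a(1)) simp
  ultimately show ?thesis using a by simp
qed

lemma power_monoid_cong:
  assumes mon: "monoid G" "monoid H" and "G \<cong> H"
  shows "power_monoid G \<cong> power_monoid H"
proof -
  obtain h where iso: "h \<in> iso G H" using assms by (auto simp: is_iso_def)
  then have h: "h \<in> hom G H" "inj_on h (carrier G)" "h ` carrier G = carrier H"
    by (auto simp: iso_def bij_betw_def)
  interpret G: monoid G by fact
  have one: "h \<one>\<^bsub>G\<^esub> = \<one>\<^bsub>H\<^esub>" using iso_one[OF mon iso] .
  have "bij_betw ((`) h) (carrier (power_monoid G)) (carrier (power_monoid H))"
  proof (rule bij_betw_imageI)
    show "inj_on ((`) h) (carrier (power_monoid G))"
      using inj_on_image_eq_iff[OF h(2)] by (auto simp: inj_on_def[of "(`) h"] power_monoid_def)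
    have "\<exists>X\<in>carrier (power_monoid G). Y = h ` X" if Y: "Y \<in> carrier (power_monoid H)" for Y
    proof
      have YH: "finite Y" "Y \<subseteq> h ` carrier G" "h \<one>\<^bsub>G\<^esub> \<in> Y"
        using Y h(3) one by (auto simp: power_monoid_def)
      show "Y = h ` (inv_into (carrier G) h ` Y)" using image_inv_into_cancel[OF refl YH(2)] by simp
      have "\<one>\<^bsub>G\<^esub> \<in> inv_into (carrier G) h ` Y"
        using YH(3) inv_into_f_f[OF h(2) G.one_closed] by (metis imageI)
      then show "inv_into (carrier G) h ` Y \<in> carrier (power_monoid G)"
        using YH inv_into_into[of _ h "carrier G"] by (auto simp: power_monoid_def)
    qed
    then have "carrier (power_monoid H) \<subseteq> (`) h ` carrier (power_monoid G)" by blast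
    moreover have "(`) h X \<in> carrier (power_monoid H)" if X: "X \<in> carrier (power_monoid G)" for X
    proof -
      have "h \<one>\<^bsub>G\<^esub> \<in> h ` X" using X by (intro imageI) (simp add: power_monoid_def)
      then show ?thesis using X one h(3) by (auto simp: power_monoid_def)
    qed
    ultimately show "(`) h ` carrier (power_monoid G) = carrier (power_monoid H)" by blast
  qed
  moreover have "h ` (X <#>\<^bsub>G\<^esub> Y) = h ` X <#>\<^bsub>H\<^esub> h ` Y" if "X \<subseteq> carrier G" "Y \<subseteq> carrier G" for X Y
    using set_mult_hom[OF h(1) that] .
  ultimately have "(`) h \<in> iso (power_monoid G) (power_monoid H)"
    by (auto simp: iso_def hom_def bij_betw_def) (auto simp: power_monoid_def)
  then show ?thesis unfolding is_iso_def by blast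
qed

lemma reduced_monoid_cong:
  assumes mon: "monoid G" "monoid H" and "G \<cong> H" and red: "reduced_monoid G"
  shows "reduced_monoid H"
proof -
  interpret G: monoid G by fact
  interpret H: monoid H by fact
  obtain h where iso: "h \<in> iso G H" using assms by (auto simp: is_iso_def)
  then have h: "h \<in> hom G H" "inj_on h (carrier G)" "h ` carrier G = carrier H"
    by (auto simp: iso_def bij_betw_def)
  have one: "h \<one>\<^bsub>G\<^esub> = \<one>\<^bsub>H\<^esub>" using iso_one[OF mon iso] .
  have "y = \<one>\<^bsub>H\<^esub>" if y: "y \<in> Units H" for y
  proof -
    obtain z where z: "y \<in> carrier H" "z \<in> carrier H" "z \<otimes>\<^bsub>H\<^esub> y = \<one>\<^bsub>H\<^esub>" "y \<otimes>\<^bsub>H\<^esub> z = \<one>\<^bsub>H\<^esub>"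
      using y by (auto simp: Units_def)
    obtain a where a: "a \<in> carrier G" "y = h a" using z h(3) by blast
    obtain b where b: "b \<in> carrier G" "z = h b" using z h(3) by blast
    have "h (b \<otimes>\<^bsub>G\<^esub> a) = h \<one>\<^bsub>G\<^esub>" "h (a \<otimes>\<^bsub>G\<^esub> b) = h \<one>\<^bsub>G\<^esub>"
      using hom_mult[OF h(1)] a b z one by simp_all
    then have "b \<otimes>\<^bsub>G\<^esub> a = \<one>\<^bsub>G\<^esub>" "a \<otimes>\<^bsub>G\<^esub> b = \<one>\<^bsub>G\<^esub>" using inj_onD[OF h(2)] a b by auto
    then have "a \<in> Units G" using a b by (auto simp: Units_def)
    then show ?thesis using red a one by (simp add: reduced_monoid_def)
  qed
  then show ?thesis by (auto simp: reduced_monoid_def)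
qed

context comm_group
begin

section \<open>Submonoids of an abelian group as abstract monoids\<close>

lemma comm_monoid_cancel_submonoid:
  assumes "submonoid M G"
  shows "comm_monoid_cancel (G\<lparr>carrier := M\<rparr>)"
proof -
  interpret M: submonoid M G by fact
  show ?thesis by (rule comm_monoid_cancelI, rule comm_monoidI) (auto simp: m_ac)
qed

lemma monoid_submonoid: "submonoid M G \<Longrightarrow> monoid (G\<lparr>carrier := M\<rparr>)"
  using comm_monoid_cancel_submonoid by (simp add: comm_monoid_cancel.axioms(1) monoid_cancel.axioms(1))

lemma reduced_submonoid_iff:
  assumes "submonoid M G"
  shows "reduced_monoid (G\<lparr>carrier := M\<rparr>) \<longleftrightarrow> (\<forall>x\<in>M. inv x \<in> M \<longrightarrow> x = \<one>)"
proof -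
  interpret M: submonoid M G by fact
  have "x \<in> Units (G\<lparr>carrier := M\<rparr>) \<longleftrightarrow> x \<in> M \<and> inv x \<in> M" for x
  proof
    assume "x \<in> Units (G\<lparr>carrier := M\<rparr>)"
    then obtain y where y: "x \<in> M" "y \<in> M" "y \<otimes> x = \<one>" by (auto simp: Units_def)
    then have "inv x = y" using inv_equality by auto
    then show "x \<in> M \<and> inv x \<in> M" using y by simp
  next
    assume x: "x \<in> M \<and> inv x \<in> M"
    then have "x \<in> carrier G" by auto
    then show "x \<in> Units (G\<lparr>carrier := M\<rparr>)" using x by (auto simp: Units_def intro!: bexI[of _ "inv x"])
  qed
  then have "Units (G\<lparr>carrier := M\<rparr>) = {x \<in> M. inv x \<in> M}" by blast
  then show ?thesis by (auto simp: reduced_monoid_def)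
qed

text \<open>The abstract quotient group of the submonoid is traded for fractions inside
  \<open>G\<close>: a formal fraction of \<open>a\<close> and \<open>b\<close> is an embedded
  element exactly when \<open>a / b\<close> lies in \<open>M\<close>.\<close>

lemma valuation_submonoid_iff:
  assumes "submonoid M G"
  shows "valuation_monoid (G\<lparr>carrier := M\<rparr>) \<longleftrightarrow> (\<forall>x\<in>fractions G M. x \<in> M \<or> inv x \<in> M)"
proof -
  interpret M: submonoid M G by fact
  define N where "N = G\<lparr>carrier := M\<rparr>"
  have [simp]: "carrier N = M" "mult N = mult G" "one N = \<one>" by (simp_all add: N_def)
  interpret N: comm_monoid_cancel N unfolding N_def by (rule comm_monoid_cancel_submonoid[OF assms])
  interpret Q: comm_group "quot_group N" by (rule N.quot_group_comm_group)
  have mem: "formal_frac N a b \<in> quot_embed N ` M \<longleftrightarrow> a \<otimes> inv b \<in> M" if ab: "a \<in> M" "b \<in> M" for a b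
  proof -
    have c: "a \<in> carrier G" "b \<in> carrier G" using ab by auto
    have "formal_frac N a b = quot_embed N x \<longleftrightarrow> a \<otimes> inv b = x" if "x \<in> M" for x
      using that ab c N.frac_eq_iff[of a b x \<one>] div_eq_iff[of a b x] by (simp add: quot_embed_def)
    then show ?thesis by (auto simp: image_iff)
  qed
  have inv: "inv\<^bsub>quot_group N\<^esub> (formal_frac N a b) = formal_frac N b a" if ab: "a \<in> M" "b \<in> M" for a b
  proof (rule Q.inv_equality)
    have c: "a \<in> carrier G" "b \<in> carrier G" using ab by auto
    show "formal_frac N b a \<otimes>\<^bsub>quot_group N\<^esub> formal_frac N a b = \<one>\<^bsub>quot_group N\<^esub>"
      using ab c N.mult_frac[of b a a b] N.frac_eq_iff[of "b \<otimes> a" "a \<otimes> b" \<one> \<one>]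
        by (simp add: N.one_quot_group m_comm)
  qed (use ab in simp_all)
  have inv': "inv (a \<otimes> inv b) = b \<otimes> inv a" if "a \<in> M" "b \<in> M" for a b
    using that by (simp add: inv_mult m_comm)
  have "valuation_monoid N \<longleftrightarrow> (\<forall>a\<in>M. \<forall>b\<in>M. formal_frac N a b \<in> quot_embed N ` M \<or>
      inv\<^bsub>quot_group N\<^esub> (formal_frac N a b) \<in> quot_embed N ` M)"
    unfolding valuation_monoid_def N.carrier_quot_group \<open>carrier N = M\<close>
    using N.comm_monoid_cancel_axioms by blast
  also have "\<dots> \<longleftrightarrow> (\<forall>a\<in>M. \<forall>b\<in>M. a \<otimes> inv b \<in> M \<or> b \<otimes> inv a \<in> M)"
    by (intro ball_cong refl) (simp add: mem inv)
  also have "\<dots> \<longleftrightarrow> (\<forall>a\<in>M. \<forall>b\<in>M. a \<otimes> inv b \<in> M \<or> inv (a \<otimes> inv b) \<in> M)"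
    by (intro ball_cong refl) (simp only: inv')
  also have "\<dots> \<longleftrightarrow> (\<forall>x\<in>fractions G M. x \<in> M \<or> inv x \<in> M)"
    unfolding fractions_def by blast
  finally show ?thesis by (simp add: N_def)
qed

text \<open>This translates the wording of the theorem into orders on \<open>L\<close>. An element
  \<open>x\<close> of \<open>L\<close> is a fraction of \<open>T\<close> because \<open>x\<close> or
  its inverse lies in \<open>T\<close>.\<close>

lemma cone_iff:
  assumes L: "subgroup L G"
  shows "cone L T \<longleftrightarrow> submonoid T G \<and> reduced_monoid (G\<lparr>carrier := T\<rparr>) \<and> valuation_monoid (G\<lparr>carrier := T\<rparr>)
    \<and> fractions G T = L"
proof (cases "submonoid T G")
  case True
  interpret T: submonoid T G by fact
  interpret L: subgroup L G by fact
  have frac: "fractions G T = L" if T: "T \<subseteq> L" "\<forall>x\<in>L. x \<in> T \<or> inv x \<in> T"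
  proof
    show "fractions G T \<subseteq> L" using T(1) by (auto simp: fractions_def subset_eq)
    show "L \<subseteq> fractions G T"
    proof
      fix x assume x: "x \<in> L"
      then have "x = x \<otimes> inv \<one>" "x = \<one> \<otimes> inv (inv x)" by auto
      then show "x \<in> fractions G T" using T(2) x T.one_closed unfolding fractions_def by blast
    qed
  qed
  have "T \<subseteq> fractions G T"
  proof
    fix x assume x: "x \<in> T"
    then have "x = x \<otimes> inv \<one>" by auto
    then show "x \<in> fractions G T" using x T.one_closed unfolding fractions_def by blast
  qed
  then show ?thesis
    unfolding cone_def reduced_submonoid_iff[OF True] valuation_submonoid_iff[OF True]
      using True frac by blast
next
  case False
  then show ?thesis by (simp add: cone_def)
qed

end

lemma (in comm_group) Pset_carrier: "carrier (power_monoid (G\<lparr>carrier := M\<rparr>)) = Pset G M"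
  by (simp add: power_monoid_def Pset_def)

lemma is_iso_cong:
  assumes "G \<cong> G'" "G' \<cong> G" "H \<cong> H'" "H' \<cong> H"
  shows "G \<cong> H \<longleftrightarrow> G' \<cong> H'"
proof
  assume "G \<cong> H"
  show "G' \<cong> H'" by (rule iso_trans[OF assms(2) iso_trans[OF \<open>G \<cong> H\<close> assms(3)]])
next
  assume "G' \<cong> H'"
  show "G \<cong> H" by (rule iso_trans[OF assms(1) iso_trans[OF \<open>G' \<cong> H'\<close> assms(4)]])
qed

section \<open>The equivalence for submonoids that generate abelian groups\<close>

lemma power_iso_if_iso:
  assumes "comm_group A" "comm_group B"
    and "submonoid M A" "submonoid N B" "fractions A M = carrier A" "fractions B N = carrier B"
    and "\<exists>e\<in>M. aperiodic A e" "\<exists>e\<in>N. aperiodic B e"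
    and "power_monoid (A\<lparr>carrier := M\<rparr>) \<cong> power_monoid (B\<lparr>carrier := N\<rparr>)"
  shows "\<exists>f f'. power_iso A B M N f f'"
proof -
  interpret A: comm_group A by fact
  interpret B: comm_group B by fact
  obtain f where f: "f \<in> hom (power_monoid (A\<lparr>carrier := M\<rparr>)) (power_monoid (B\<lparr>carrier := N\<rparr>))"
    "bij_betw f (Pset A M) (Pset B N)"
    using assms(9) by (auto simp: is_iso_def iso_def A.Pset_carrier B.Pset_carrier)
  have mult: "mult (power_monoid (A\<lparr>carrier := M\<rparr>)) = (\<lambda>X Y. X <#>\<^bsub>A\<^esub> Y)"
    "mult (power_monoid (B\<lparr>carrier := N\<rparr>)) = (\<lambda>X Y. X <#>\<^bsub>B\<^esub> Y)"
    by (simp_all add: power_monoid_def fun_eq_iff)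
  let ?f' = "inv_into (Pset A M) f"
  have f': "bij_betw ?f' (Pset B N) (Pset A M)" using f(2) by (rule bij_betw_inv_into)
  have "power_iso A B M N f ?f'"
  proof (intro power_iso.intro power_iso_axioms.intro)
    fix X assume X: "X \<in> Pset A M"
    show "f X \<in> Pset B N" using bij_betw_apply[OF f(2) X] .
    show "?f' (f X) = X" using bij_betw_inv_into_left[OF f(2) X] .
    fix X' assume "X' \<in> Pset A M"
    then show "f (X <#>\<^bsub>A\<^esub> X') = f X <#>\<^bsub>B\<^esub> f X'"
      using hom_mult[OF f(1)] X by (simp add: mult A.Pset_carrier)
  next
    fix Y assume Y: "Y \<in> Pset B N"
    show "?f' Y \<in> Pset A M" using bij_betw_apply[OF f' Y] .
    show "f (?f' Y) = Y" using bij_betw_inv_into_right[OF f(2) Y] .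
  qed (rule assms)+
  then show ?thesis by blast
qed

lemma power_monoid_iso_iff:
  fixes A :: "('a, 'm) monoid_scheme" and B :: "('b, 'n) monoid_scheme"
  assumes A: "comm_group A" and B: "comm_group B"
    and M: "submonoid M A" and N: "submonoid N B"
    and gen: "fractions A M = carrier A" "fractions B N = carrier B"
    and ex: "\<exists>e\<in>M. aperiodic A e" "\<exists>e\<in>N. aperiodic B e"
  defines "V \<equiv> comm_group.pseudo A M"
  shows "power_monoid (A\<lparr>carrier := M\<rparr>) \<cong> power_monoid (B\<lparr>carrier := N\<rparr>) \<longleftrightarrow>
    A\<lparr>carrier := M\<rparr> \<cong> B\<lparr>carrier := N\<rparr> \<or>
    (reduced_monoid (A\<lparr>carrier := M\<rparr>) \<and> reduced_monoid (B\<lparr>carrier := N\<rparr>) \<and>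
     (\<exists>T. submonoid T A \<and> reduced_monoid (A\<lparr>carrier := T\<rparr>) \<and> valuation_monoid (A\<lparr>carrier := T\<rparr>) \<and>
       fractions A T = fractions A V \<and> (M - V) \<inter> T = {} \<and> submonoid ((M - V) \<union> T) A \<and>
       B\<lparr>carrier := N\<rparr> \<cong> A\<lparr>carrier := (M - V) \<union> T\<rparr>))"
    (is "?iso \<longleftrightarrow> ?iso' \<or> ?red \<and> ?red' \<and> ?T")
proof -
  interpret A: comm_group A by fact
  interpret B: comm_group B by fact
  let ?L = "fractions A V"
  have V: "submonoid V A" unfolding V_def by (rule A.pseudo_submonoid[OF M])
  have L: "subgroup ?L A" by (rule A.fractions_subgroup[OF V])
  have VM: "V \<subseteq> M" by (auto simp: V_def A.pseudo_def)
  show ?thesis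
  proof
    assume ?iso
    then obtain f f' where "power_iso A B M N f f'" using power_iso_if_iso[OF A B M N gen ex] by blast
    then interpret power_iso A B M N f f' .
    from power_iso_classification show "?iso' \<or> ?red \<and> ?red' \<and> ?T"
    proof (elim disjE conjE exE)
      fix K
      assume red: "\<forall>x\<in>M. inv\<^bsub>A\<^esub> x \<in> M \<longrightarrow> x = \<one>\<^bsub>A\<^esub>" "\<forall>x\<in>N. inv\<^bsub>B\<^esub> x \<in> N \<longrightarrow> x = \<one>\<^bsub>B\<^esub>"
        and K: "submonoid K A" "B\<lparr>carrier := N\<rparr> \<cong> A\<lparr>carrier := K\<rparr>" "\<forall>x\<in>K. inv\<^bsub>A\<^esub> x \<in> K \<longrightarrow> x = \<one>\<^bsub>A\<^esub>"
          "\<forall>x\<in>M. x \<in> K \<or> inv\<^bsub>A\<^esub> x \<in> K" "\<forall>x\<in>K. x \<in> M \<or> inv\<^bsub>A\<^esub> x \<in> M"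
          "\<forall>x\<in>M. \<forall>y\<in>M. x \<otimes>\<^bsub>A\<^esub> inv\<^bsub>A\<^esub> y \<notin> M \<longrightarrow> y \<otimes>\<^bsub>A\<^esub> inv\<^bsub>A\<^esub> x \<notin> M \<longrightarrow> x \<in> K"
      have T: "A.cone ?L (K \<inter> ?L)" and KT: "(M - V) \<union> (K \<inter> ?L) = K"
        using A.reorientation[OF M K(1)] K(3-6) unfolding V_def by blast+
      have "(M - V) \<inter> (K \<inter> ?L) = {}" using A.fractions_pseudo_inter[OF M] unfolding V_def by blast
      then have ?T using T KT K(1,2) V unfolding A.cone_iff[OF L] by (intro exI[of _ "K \<inter> ?L"]) simp
      then show ?thesis using red A.reduced_submonoid_iff[OF M] B.reduced_submonoid_iff[OF N] by blast
    qed simp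
  next
    have monM: "monoid (A\<lparr>carrier := M\<rparr>)" and monN: "monoid (B\<lparr>carrier := N\<rparr>)"
      using A.monoid_submonoid[OF M] B.monoid_submonoid[OF N] .
    assume "?iso' \<or> ?red \<and> ?red' \<and> ?T"
    then show ?iso
    proof (elim disjE conjE exE)
      assume ?iso'
      then show ?iso using power_monoid_cong[OF monM monN] by blast
    next
      fix T
      assume red: ?red
        and T: "submonoid T A" "reduced_monoid (A\<lparr>carrier := T\<rparr>)" "valuation_monoid (A\<lparr>carrier := T\<rparr>)"
        "fractions A T = ?L"
          and K: "submonoid ((M - V) \<union> T) A" "B\<lparr>carrier := N\<rparr> \<cong> A\<lparr>carrier := (M - V) \<union> T\<rparr>"
      have coneT: "A.cone ?L T" using T A.cone_iff[OF L] by blast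
      \<comment> \<open>The pseudo-units form a cone because \<open>M\<close> is reduced. So
        \<open>V\<close> and \<open>T\<close> are two orders on one group, completed by the same
        part \<open>M - V\<close>.\<close>
      have coneV: "A.cone ?L V"
        using V A.pseudo_sub_fractions[OF M] A.pseudo_comparable[OF M] red A.reduced_submonoid_iff[OF M] VM
        unfolding A.cone_def V_def by blast
      have "power_monoid (A\<lparr>carrier := V \<union> (M - V)\<rparr>) \<cong> power_monoid (A\<lparr>carrier := T \<union> (M - V)\<rparr>)"
      proof (rule A.power_monoid_reorient[OF L _ _ _ _ coneV coneT])
        show "M - V \<subseteq> carrier A" using submonoid.subset[OF M] by blast
        show "(M - V) \<inter> ?L = {}" using A.fractions_pseudo_inter[OF M] unfolding V_def by blast
        show "w \<otimes>\<^bsub>A\<^esub> l \<in> M - V" if "w \<in> M - V" "l \<in> ?L" for w l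
          using that A.nonpseudo_mult_fraction[OF M] unfolding V_def by blast
        show "w \<otimes>\<^bsub>A\<^esub> w' \<in> M - V" if "w \<in> M - V" "w' \<in> M - V" for w w'
          using that A.nonpseudo_mult[OF M] unfolding V_def by blast
      qed
      moreover have "V \<union> (M - V) = M" "T \<union> (M - V) = (M - V) \<union> T" using VM by blast+
      ultimately have "power_monoid (A\<lparr>carrier := M\<rparr>) \<cong> power_monoid (A\<lparr>carrier := (M - V) \<union> T\<rparr>)" by simp
      also have "\<dots> \<cong> power_monoid (B\<lparr>carrier := N\<rparr>)"
        using power_monoid_cong[OF A.monoid_submonoid[OF K(1)] monN is_iso_sym[OF monN K(2)]] .
      finally show ?iso .
    qed
  qed
qed

context comm_monoid_cancel
begin

interpretation Q: comm_group "quot_group G" by (rule quot_group_comm_group)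

section \<open>A cancellative monoid inside its quotient group\<close>

lemma quot_embed_one: "quot_embed G \<one> = \<one>\<^bsub>quot_group G\<^esub>"
  by (simp add: quot_embed_def one_quot_group)

lemma submonoid_quot_embed: "submonoid (quot_embed G ` carrier G) (quot_group G)"
proof
  show "quot_embed G ` carrier G \<subseteq> carrier (quot_group G)" using hom_carrier[OF quot_embed_hom] .
  show "\<one>\<^bsub>quot_group G\<^esub> \<in> quot_embed G ` carrier G" using quot_embed_one by (metis imageI one_closed)
  fix x y assume "x \<in> quot_embed G ` carrier G" "y \<in> quot_embed G ` carrier G"
  then obtain a b where ab: "a \<in> carrier G" "b \<in> carrier G" "x = quot_embed G a" "y = quot_embed G b"
    by blast
  then have "x \<otimes>\<^bsub>quot_group G\<^esub> y = quot_embed G (a \<otimes> b)" using hom_mult[OF quot_embed_hom] by simp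
  then show "x \<otimes>\<^bsub>quot_group G\<^esub> y \<in> quot_embed G ` carrier G" using ab by simp
qed

lemma iso_quot_embed: "G \<cong> quot_group G\<lparr>carrier := quot_embed G ` carrier G\<rparr>"
  using quot_embed_hom quot_embed_inj unfolding is_iso_def iso_def
  by (auto simp: hom_def bij_betw_def intro!: exI[of _ "quot_embed G"])

lemma fractions_quot_embed: "fractions (quot_group G) (quot_embed G ` carrier G) = carrier (quot_group G)"
  unfolding fractions_def carrier_quot_group using frac_eq_quot_embed by blast

lemma quot_embed_pow: "x \<in> carrier G \<Longrightarrow>
  quot_embed G (x [^] n) = quot_embed G x [^]\<^bsub>quot_group G\<^esub> (n::nat)"
  by (induction n) (simp_all add: quot_embed_one hom_mult[OF quot_embed_hom])

text \<open>If \<open>x^n = 1\<close> with \<open>n > 0\<close>, reduction of exponents modulo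
  \<open>n\<close> leaves finitely many powers, whereas \<open>infinite_order\<close> asks for
  infinitely many.\<close>

lemma aperiodic_quot_embed:
  assumes x: "x \<in> carrier G" and inf: "infinite_order G x"
  shows "aperiodic (quot_group G) (quot_embed G x)"
  unfolding aperiodic_def
proof (intro allI impI notI)
  fix n :: nat
  assume n: "n > 0" and "quot_embed G x [^]\<^bsub>quot_group G\<^esub> n = \<one>\<^bsub>quot_group G\<^esub>"
  then have "quot_embed G (x [^] n) = quot_embed G \<one>" using x by (simp add: quot_embed_pow quot_embed_one)
  then have 1: "x [^] n = \<one>" using inj_onD[OF quot_embed_inj] x by simp
  have "x [^] k \<in> (\<lambda>i. x [^] i) ` {..<n}" for k :: nat
  proof -
    have "x [^] (n * (k div n) + k mod n) = (x [^] n) [^] (k div n) \<otimes> x [^] (k mod n)"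
      using x by (simp only: nat_pow_mult[symmetric] nat_pow_pow)
    then have "x [^] k = x [^] (k mod n)" using x 1 by simp
    then show ?thesis using n by simp
  qed
  then have "range (\<lambda>i::nat. x [^] i) \<subseteq> (\<lambda>i. x [^] i) ` {..<n}" by blast
  then show False using inf finite_subset unfolding infinite_order_def by blast
qed

lemma pseudo_quot_embed:
  "comm_group.pseudo (quot_group G) (quot_embed G ` carrier G) = quot_embed G ` pseudo_units G"
  unfolding Q.pseudo_def pseudo_units_def by blast

lemma nonpseudo_quot_embed:
  "quot_embed G ` carrier G - quot_embed G ` pseudo_units G = quot_embed G ` (carrier G - pseudo_units G)"
  using inj_on_image_set_diff[OF quot_embed_inj, of "carrier G" "pseudo_units G"]
    by (auto simp: pseudo_units_def)

end

theorem theorem18: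
  fixes H :: "('a, 'm) monoid_scheme" and K :: "('b, 'n) monoid_scheme"
  assumes "comm_monoid_cancel H" and "comm_monoid_cancel K"
    and "\<exists>x \<in> carrier H. infinite_order H x"
    and "\<exists>x \<in> carrier K. infinite_order K x"
  shows "power_monoid H \<cong> power_monoid K \<longleftrightarrow>
    H \<cong> K \<or>
    (reduced_monoid H \<and> reduced_monoid K \<and>
     (\<exists>T. submonoid T (quot_group H) \<and>
          reduced_monoid (quot_group H\<lparr>carrier := T\<rparr>) \<and>
          valuation_monoid (quot_group H\<lparr>carrier := T\<rparr>) \<and>
          fractions (quot_group H) T =
            fractions (quot_group H) (quot_embed H ` pseudo_units H) \<and>
          quot_embed H ` (carrier H - pseudo_units H) \<inter> T = {} \<and>
          submonoid (quot_embed H ` (carrier H - pseudo_units H) \<union> T) (quot_group H) \<and>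
          K \<cong> quot_group H\<lparr>carrier := quot_embed H ` (carrier H - pseudo_units H) \<union> T\<rparr>))"
proof -
  interpret H: comm_monoid_cancel H by fact
  interpret K: comm_monoid_cancel K by fact
  interpret A: comm_group "quot_group H" by (rule H.quot_group_comm_group)
  interpret B: comm_group "quot_group K" by (rule K.quot_group_comm_group)
  \<comment> \<open>The power monoids, reducedness and isomorphism are all invariant under
    isomorphism, so both monoids may be replaced by their copies in the quotient groups, where
    \<open>power_monoid_iso_iff\<close> applies.\<close>
  define H' where "H' = quot_group H\<lparr>carrier := quot_embed H ` carrier H\<rparr>"
  define K' where "K' = quot_group K\<lparr>carrier := quot_embed K ` carrier K\<rparr>"
  have mon: "monoid H" "monoid K" "monoid H'" "monoid K'" unfolding H'_def K'_def
    by (rule H.monoid_axioms K.monoid_axioms A.monoid_submonoid[OF H.submonoid_quot_embed]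
        B.monoid_submonoid[OF K.submonoid_quot_embed])+
  have HH': "H \<cong> H'" "H' \<cong> H" and KK': "K \<cong> K'" "K' \<cong> K"
    using H.iso_quot_embed K.iso_quot_embed is_iso_sym[OF mon(1)] is_iso_sym[OF mon(2)]
    unfolding H'_def K'_def by blast+
  have "power_monoid H \<cong> power_monoid K \<longleftrightarrow> power_monoid H' \<cong> power_monoid K'"
    by (intro is_iso_cong power_monoid_cong mon HH' KK')
  moreover have "H \<cong> K \<longleftrightarrow> H' \<cong> K'" by (intro is_iso_cong HH' KK')
  moreover have "reduced_monoid H \<longleftrightarrow> reduced_monoid H'"
    using reduced_monoid_cong[OF mon(1,3) HH'(1)] reduced_monoid_cong[OF mon(3,1) HH'(2)] by blast
  moreover have "reduced_monoid K \<longleftrightarrow> reduced_monoid K'"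
    using reduced_monoid_cong[OF mon(2,4) KK'(1)] reduced_monoid_cong[OF mon(4,2) KK'(2)] by blast
  \<comment> \<open>Only \<open>K\<close> is replaced here, since the submonoid on the right already
    lives in the quotient group of \<open>H\<close>.\<close>
  moreover have "K \<cong> J \<longleftrightarrow> K' \<cong> J" for J :: "('a \<times> 'a) set monoid"
    using iso_trans[OF KK'(1), of J] iso_trans[OF KK'(2), of J] by blast
  moreover have "\<exists>e\<in>quot_embed H ` carrier H. aperiodic (quot_group H) e"
    "\<exists>e\<in>quot_embed K ` carrier K. aperiodic (quot_group K) e"
    using assms(3,4) H.aperiodic_quot_embed K.aperiodic_quot_embed by blast+
  note power_monoid_iso_iff[OF A.comm_group_axioms B.comm_group_axioms H.submonoid_quot_embed K.submonoid_quot_embed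
      H.fractions_quot_embed K.fractions_quot_embed this,
      unfolded H.pseudo_quot_embed H.nonpseudo_quot_embed, folded H'_def K'_def]
  ultimately show ?thesis by simp
qed

end
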